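(* For $\tilde\sigma=\eta_G(\sigma,\mathcal{E}_\sigma^g)\in Z^G(\mathcal{D}_0)_g$ and $\tilde\rho=\eta_G(\rho,\mathcal{E}_\rho^h)\in Z^G(\mathcal{D}_0)_h$ define $\mathcal{E}_G(\tilde\sigma,\tilde\rho):=\mathcal{E}_\sigma^g(\rho)\otimes1$. Then $\mathcal{E}_G$ gives a $G$-braiding on $Z^G(\mathcal{D}_0)$, where $G$ acts by $k[\theta]=\beta_k\theta\beta_k^{-1}$. That is: (BF0) $\mathcal{E}_G(\tilde\sigma,\tilde\rho)$ is a unitary in $(\tilde\sigma\tilde\rho,g[\tilde\rho]\tilde\sigma)$ for $\tilde\sigma\in Z^G(\mathcal{D}_0)_g$; (BF1) $g[\tilde\xi](\mathcal{E}_G(\tilde\sigma,\tilde\eta))\mathcal{E}_G(\tilde\sigma,\tilde\xi)=\mathcal{E}_G(\tilde\sigma,\tilde\xi\tilde\eta)$ for $\tilde\sigma\in Z^G(\mathcal{D}_0)_g$, and $\beta_g(T)\mathcal{E}_G(\tilde\sigma,\tilde\rho)=\mathcal{E}_G(\tilde\sigma,\tilde\rho')\tilde\sigma(T)$ for $T\in(\tilde\rho,\tilde\rho')$; (BF2) $\mathcal{E}_G(\tilde\sigma,h[\tilde\xi])\tilde\sigma(\mathcal{E}_G(\tilde\rho,\tilde\xi))=\mathcal{E}_G(\tilde\sigma\tilde\rho,\tilde\xi)$ for $\tilde\sigma\in Z^G(\mathcal{D}_0)_g$, $\tilde\rho\in Z^G(\mathcal{D}_0)_h$, and $g[\tilde\xi](T)\mathcal{E}_G(\tilde\sigma,\tilde\xi)=\mathcal{E}_G(\tilde\sigma',\tilde\xi)T$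 for $\tilde\sigma,\tilde\sigma'\in Z^G(\mathcal{D}_0)_g$, $T\in(\tilde\sigma,\tilde\sigma')$; (BF3) $\mathcal{E}_G(k[\tilde\sigma],k[\tilde\rho])=\beta_k(\mathcal{E}_G(\tilde\sigma,\tilde\rho))$ for $k\in G$.
   Context: $\mathcal{M}$ is a type III factor with a faithful normal state; $\mathrm{End}_0(\cdot)$ denotes finite index endomorphisms; $(\rho,\sigma)=\{T\mid T\rho(x)=\sigma(x)T\ \forall x\}$; $\rho\sim\sigma$ means $\rho=\mathrm{Ad}\,u\circ\sigma$ for a unitary $u$. For $\rho\in\mathrm{End}_0(\mathcal{M})$ with conjugate $\bar\rho$ a solution of the conjugate equation $R_\rho\in(\mathrm{id},\bar\rho\rho)$, $\bar R_\rho\in(\mathrm{id},\rho\bar\rho)$, $R_\rho^*R_\rho=\bar R_\rho^*\bar R_\rho=d(\rho)$, $R_\rho^*\bar\rho(\bar R_\rho)=\bar R_\rho^*\rho(R_\rho)=1$ is fixed. $\mathcal{D}_0\subset\mathrm{End}_0(\mathcal{M})$ is a rigid C$^*$-tensor category (full, closed under unitary equivalence, composition, conjugates, finite direct sums and subobjects, containing $\mathrm{id}$) with at most countable set $\mathrm{Irr}(\mathcal{D}_0)$ of representatives of irreducibles; $G$ is a discrete group with neutral element $0$; $\alpha$ is an action of $G$ on $\mathcal{M}$ with $g[\rho]:=\alpha_g\rho\alpha_g^{-1}\in\mathcal{D}_0$ for all $\rho\in\mathcal{D}_0$, and $\alpha_g\notin\mathcal{D}_0$ for $g\ne0$. $j:\mathcal{M}\to\mathcal{M}^{\mathrm{op}}$,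 $j(x)=x^*$, $\pi^{\mathrm{op}}=j\pi j^{-1}$ (also for automorphisms), $\mathcal{A}=\mathcal{M}\otimes\mathcal{M}^{\mathrm{op}}$. The Longo-Rehren inclusion $\mathcal{A}\subset\mathcal{B}$ of $\mathcal{D}_0$: $\mathcal{B}$ is the von Neumann algebra generated by $\mathcal{A}$ and $\lambda_\pi$ ($\pi\in\mathcal{D}_0$) with $\lambda_\pi a=(\pi\otimes\pi^{\mathrm{op}})(a)\lambda_\pi$, $\lambda_\pi\lambda_\rho=\lambda_{\pi\rho}$, $\lambda_\pi^*=(R_\pi\otimes j(R_\pi))^*\lambda_{\bar\pi}$, $(T\otimes1)\lambda_\pi=(1\otimes j(T^* ))\lambda_\rho$ for $T\in(\pi,\rho)$, together with a faithful normal conditional expectation $E:\mathcal{B}\to\mathcal{A}$, $E(a\lambda_\pi)=\delta_{\mathrm{id},\pi}a$ for $\pi\in\mathrm{Irr}(\mathcal{D}_0)$. $\beta_g\in\mathrm{Aut}(\mathcal{B})$ is $\beta_g(a\lambda_\pi)=(\alpha_g\otimes\alpha_g^{\mathrm{op}})(a)\lambda_{g[\pi]}$. For $\sigma\in\mathcal{D}_0$, $g\in G$, a $g$-half braiding of $\sigma$ is a family of unitaries $\{\mathcal{E}_\sigma^g(\pi)\}_{\pi\in\mathcal{D}_0}\subset\mathcal{M}$ with $\mathcal{E}_\sigma^g(\pi)\in(\sigma\pi,g[\pi]\sigma)$, $\mathcal{E}_\sigma^g(\pi\rho)=g[\pi](\mathcal{E}_\sigma^g(\rho))\mathcal{E}_\sigma^g(\pi)$,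 and $\alpha_g(T)\mathcal{E}_\sigma^g(\pi)=\mathcal{E}_\sigma^g(\rho)\sigma(T)$ for $T\in(\pi,\rho)$. Then $\eta_G(\sigma,\mathcal{E}_\sigma^g)\in\mathrm{End}_0(\mathcal{B})$ is defined by $a\mapsto(\sigma\otimes\alpha_g^{\mathrm{op}})(a)$ for $a\in\mathcal{A}$ and $\lambda_\pi\mapsto(\mathcal{E}_\sigma^g(\pi)^*\otimes1)\lambda_{g[\pi]}$. $Z^G(\mathcal{D}_0)_g=\{\theta\in\mathrm{End}_0(\mathcal{B})\mid\theta\sim\eta_G(\sigma,\mathcal{E}_\sigma^g)\text{ for some }g\text{-half braiding}\}$, $Z^G(\mathcal{D}_0)=\bigoplus_gZ^G(\mathcal{D}_0)_g$. Symbols $\tilde\sigma,\tilde\sigma',\tilde\rho,\tilde\rho',\tilde\xi,\tilde\eta$ denote $\eta_G$-extensions. Products and conjugates are again $\eta_G$-extensions: $\eta_G(\sigma,\mathcal{E}_\sigma^g)\eta_G(\rho,\mathcal{E}_\rho^h)=\eta_G(\sigma\rho,\mathcal{E}_{\sigma\rho}^{gh})$ with $\mathcal{E}_{\sigma\rho}^{gh}(\pi)=\mathcal{E}_\sigma^g(h[\pi])\sigma(\mathcal{E}_\rho^h(\pi))$, and $k[\eta_G(\sigma,\mathcal{E}_\sigma^g)]=\eta_G(k[\sigma],k[\mathcal{E}_\sigma^g])$ with $k[\mathcal{E}_\sigma^g](\pi)=\alpha_k(\mathcal{E}_\sigma^g(k^{-1}[\pi]))$. *)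

theory Defs
  imports "HOL-Analysis.Analysis"
begin

section \<open>Complex Hilbert spaces and bounded operators\<close>

text \<open>The inner product is conjugate-linear in its first argument.\<close>

class chilbert_space = banach +
  fixes scaleC :: "complex \<Rightarrow> 'a \<Rightarrow> 'a"  (infixr "*\<^sub>C" 75)
    and cinner :: "'a \<Rightarrow> 'a \<Rightarrow> complex"
  assumes scaleC_add_right: "c *\<^sub>C (x + y) = c *\<^sub>C x + c *\<^sub>C y"
    and scaleC_add_left: "(b + c) *\<^sub>C x = b *\<^sub>C x + c *\<^sub>C x"
    and scaleC_scaleC: "b *\<^sub>C c *\<^sub>C x = (b * c) *\<^sub>C x"
    and scaleR_scaleC: "scaleR r x = complex_of_real r *\<^sub>C x"
    and cinner_add_right: "cinner x (y + z) = cinner x y + cinner x z"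
    and cinner_scaleC_right: "cinner x (c *\<^sub>C y) = c * cinner x y"
    and cinner_commute: "cinner x y = cnj (cinner y x)"
    and cinner_self: "cinner x x = complex_of_real ((norm x)\<^sup>2)"

lemma scaleC_one [simp]: "1 *\<^sub>C x = (x :: 'a::chilbert_space)"
  using scaleR_scaleC[of 1 x] by simp

lemma scaleC_zero_right [simp]: "c *\<^sub>C 0 = (0 :: 'a::chilbert_space)"
  using scaleC_add_right[of c "0::'a" 0] by simp

lemma scaleC_minus_right [simp]: "c *\<^sub>C (- x) = - (c *\<^sub>C (x :: 'a::chilbert_space))"
  using scaleC_add_right[of c x "- x"] by (simp add: eq_neg_iff_add_eq_0 add.commute)

lemma scaleC_diff_right: "c *\<^sub>C (x - y) = c *\<^sub>C x - c *\<^sub>C (y :: 'a::chilbert_space)"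
  using scaleC_add_right[of c x "- y"] by simp

lemma norm_scaleC [simp]: "norm (c *\<^sub>C x) = cmod c * norm (x :: 'a::chilbert_space)"
proof -
  have "complex_of_real ((norm (c *\<^sub>C x))\<^sup>2) = cinner (c *\<^sub>C x) (c *\<^sub>C x)"
    by (simp add: cinner_self)
  also have "\<dots> = c * cnj (c * cinner x x)"
    by (metis cinner_scaleC_right cinner_commute)
  also have "\<dots> = complex_of_real ((cmod c * norm x)\<^sup>2)"
    using complex_norm_square[of c] by (simp add: cinner_self power_mult_distrib)
  finally have "(norm (c *\<^sub>C x))\<^sup>2 = (cmod c * norm x)\<^sup>2"
    using of_real_eq_iff by blast
  then show ?thesis
    by (simp add: power2_eq_iff_nonneg)
qed

typedef (overloaded) 'h bop =
  "{f :: 'h::chilbert_space \<Rightarrow> 'h. bounded_linear f \<and> (\<forall>c x. f (c *\<^sub>C x) = c *\<^sub>C f x)}"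
  morphisms app Bop
  by (rule exI[of _ "\<lambda>_. 0"]) (simp add: bounded_linear_zero)

setup_lifting type_definition_bop

instantiation bop :: (chilbert_space) "{ring, monoid_mult}"
begin

lift_definition zero_bop :: "'a bop" is "\<lambda>_. 0"
  by (simp add: bounded_linear_zero)
lift_definition one_bop :: "'a bop" is "\<lambda>x. x"
  by (simp add: bounded_linear_ident)
lift_definition plus_bop :: "'a bop \<Rightarrow> 'a bop \<Rightarrow> 'a bop" is "\<lambda>f g x. f x + g x"
  by (simp add: bounded_linear_add scaleC_add_right)
lift_definition uminus_bop :: "'a bop \<Rightarrow> 'a bop" is "\<lambda>f x. - f x"
  by (simp add: bounded_linear_minus)
lift_definition minus_bop :: "'a bop \<Rightarrow> 'a bop \<Rightarrow> 'a bop" is "\<lambda>f g x. f x - g x"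
  by (simp add: bounded_linear_sub scaleC_diff_right)
lift_definition times_bop :: "'a bop \<Rightarrow> 'a bop \<Rightarrow> 'a bop" is "\<lambda>f g x. f (g x)"
  by (simp add: bounded_linear_compose)

instance
proof
  fix a b c :: "'a bop"
  show "a + b + c = a + (b + c)" by transfer (simp add: add.assoc)
  show "a + b = b + a" by transfer (simp add: add.commute)
  show "0 + a = a" by transfer simp
  show "- a + a = 0" by transfer simp
  show "a - b = a + - b" by transfer simp
  show "a * b * c = a * (b * c)" by transfer simp
  show "(a + b) * c = a * c + b * c" by transfer simp
  show "a * (b + c) = a * b + a * c" by transfer (auto simp: linear_simps)
  show "1 * a = a" by transfer simp
  show "a * 1 = a" by transfer simp
qed

end

lift_definition scale_op :: "complex \<Rightarrow> 'h::chilbert_space bop \<Rightarrow> 'h bop"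
  is "\<lambda>c f x. c *\<^sub>C f x"
proof -
  fix c :: complex and f :: "'h \<Rightarrow> 'h"
  assume f: "bounded_linear f \<and> (\<forall>c x. f (c *\<^sub>C x) = c *\<^sub>C f x)"
  then obtain K where K: "\<And>x. norm (f x) \<le> norm x * K"
    using bounded_linear.bounded by blast
  have "bounded_linear (\<lambda>x. c *\<^sub>C f x)"
  proof (rule bounded_linear_intro[where K = "cmod c * K"])
    fix x y r
    show "c *\<^sub>C f (x + y) = c *\<^sub>C f x + c *\<^sub>C f y"
      using f by (simp add: linear_simps scaleC_add_right)
    show "c *\<^sub>C f (scaleR r x) = scaleR r (c *\<^sub>C f x)"
      using f by (simp add: scaleR_scaleC scaleC_scaleC mult.commute)
    show "norm (c *\<^sub>C f x) \<le> norm x * (cmod c * K)"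
      using mult_left_mono[OF K[of x], of "cmod c"] by (simp add: algebra_simps)
  qed
  then show "bounded_linear (\<lambda>x. c *\<^sub>C f x) \<and>
      (\<forall>b x. c *\<^sub>C f (b *\<^sub>C x) = b *\<^sub>C c *\<^sub>C f x)"
    using f by (simp add: scaleC_scaleC mult.commute)
qed

definition adj :: "'h::chilbert_space bop \<Rightarrow> 'h bop" where
  "adj T = (THE S. \<forall>u v. cinner (app S u) v = cinner u (app T v))"

definition positive_op :: "'h::chilbert_space bop \<Rightarrow> bool" where
  "positive_op T \<longleftrightarrow> (\<forall>v. cinner v (app T v) \<in> \<real>\<^sub>\<ge>\<^sub>0)"


section \<open>Conjugate Hilbert space and Hilbert space tensor product\<close>

typedef 'h cnj_space = "UNIV :: 'h set"
  morphisms of_cnj to_cnj ..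

setup_lifting type_definition_cnj_space

instantiation cnj_space :: (chilbert_space) real_normed_vector
begin

lift_definition zero_cnj_space :: "'a cnj_space" is 0 .
lift_definition plus_cnj_space :: "'a cnj_space \<Rightarrow> 'a cnj_space \<Rightarrow> 'a cnj_space" is "(+)" .
lift_definition minus_cnj_space :: "'a cnj_space \<Rightarrow> 'a cnj_space \<Rightarrow> 'a cnj_space" is "(-)" .
lift_definition uminus_cnj_space :: "'a cnj_space \<Rightarrow> 'a cnj_space" is uminus .
lift_definition scaleR_cnj_space :: "real \<Rightarrow> 'a cnj_space \<Rightarrow> 'a cnj_space" is scaleR .
lift_definition norm_cnj_space :: "'a cnj_space \<Rightarrow> real" is norm .
lift_definition dist_cnj_space :: "'a cnj_space \<Rightarrow> 'a cnj_space \<Rightarrow> real" is dist .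
lift_definition sgn_cnj_space :: "'a cnj_space \<Rightarrow> 'a cnj_space" is sgn .

definition uniformity_cnj_space :: "('a cnj_space \<times> 'a cnj_space) filter" where
  "uniformity_cnj_space = (INF e\<in>{0 <..}. principal {(x, y). dist x y < e})"
definition open_cnj_space :: "'a cnj_space set \<Rightarrow> bool" where
  "open_cnj_space U \<longleftrightarrow>
     (\<forall>x\<in>U. eventually (\<lambda>(x', y). x' = x \<longrightarrow> y \<in> U) uniformity)"

instance
proof
  fix x y z :: "'a cnj_space" and r s :: real
  show "x + y + z = x + (y + z)" by transfer (simp add: add.assoc)
  show "x + y = y + x" by transfer (simp add: add.commute)
  show "0 + x = x" by transfer simp
  show "- x + x = 0" by transfer simp
  show "x - y = x + - y" by transfer simp
  show "scaleR r (x + y) = scaleR r x + scaleR r y" by transfer (simp add: scaleR_add_right)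
  show "scaleR (r + s) x = scaleR r x + scaleR s x" by transfer (simp add: scaleR_add_left)
  show "scaleR r (scaleR s x) = scaleR (r * s) x" by transfer simp
  show "scaleR 1 x = x" by transfer simp
  show "dist x y = norm (x - y)" by transfer (simp add: dist_norm)
  show "sgn x = scaleR (inverse (norm x)) x" by transfer (simp add: sgn_div_norm)
  show "norm x = 0 \<longleftrightarrow> x = 0" by transfer simp
  show "norm (x + y) \<le> norm x + norm y" by transfer (rule norm_triangle_ineq)
  show "norm (scaleR r x) = \<bar>r\<bar> * norm x" by transfer simp
next
  show "uniformity = (INF e\<in>{0 <..}. principal {(x, y :: 'a cnj_space). dist x y < e})"
    by (rule uniformity_cnj_space_def)
  show "open U \<longleftrightarrow> (\<forall>x\<in>U. eventually (\<lambda>(x', y). x' = x \<longrightarrow> y \<in> U) uniformity)"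
    for U :: "'a cnj_space set"
    by (rule open_cnj_space_def)
qed

end

instantiation cnj_space :: (chilbert_space) chilbert_space
begin

lift_definition scaleC_cnj_space :: "complex \<Rightarrow> 'a cnj_space \<Rightarrow> 'a cnj_space"
  is "\<lambda>c x. cnj c *\<^sub>C x" .
lift_definition cinner_cnj_space :: "'a cnj_space \<Rightarrow> 'a cnj_space \<Rightarrow> complex"
  is "\<lambda>x y. cinner y x" .
instance
proof
  fix x y z :: "'a cnj_space" and b c :: complex and r :: real
  show "c *\<^sub>C (x + y) = c *\<^sub>C x + c *\<^sub>C y" by transfer (simp add: scaleC_add_right)
  show "(b + c) *\<^sub>C x = b *\<^sub>C x + c *\<^sub>C x" by transfer (simp add: scaleC_add_left)
  show "b *\<^sub>C c *\<^sub>C x = (b * c) *\<^sub>C x" by transfer (simp add: scaleC_scaleC)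
  show "scaleR r x = complex_of_real r *\<^sub>C x" by transfer (simp add: scaleR_scaleC)
  show "cinner x (y + z) = cinner x y + cinner x z"
    by transfer (metis cinner_add_right cinner_commute complex_cnj_add)
  show "cinner x (c *\<^sub>C y) = c * cinner x y"
    by transfer (metis cinner_commute cinner_scaleC_right complex_cnj_cnj complex_cnj_mult)
  show "cinner x y = cnj (cinner y x)" by transfer (rule cinner_commute)
  show "cinner x x = complex_of_real ((norm x)\<^sup>2)" by transfer (rule cinner_self)
next
  fix X :: "nat \<Rightarrow> 'a cnj_space"
  assume "Cauchy X"
  then have "Cauchy (\<lambda>n. of_cnj (X n))"
    by (simp add: Cauchy_def dist_cnj_space.rep_eq)
  then obtain l where l: "(\<lambda>n. of_cnj (X n)) \<longlonglongrightarrow> l"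
    using Cauchy_convergent convergent_def by blast
  have "X \<longlonglongrightarrow> to_cnj l"
    using l unfolding lim_sequentially
    by (simp add: dist_cnj_space.rep_eq to_cnj_inverse)
  then show "convergent X"
    using convergent_def by blast
qed

end

lift_definition cnj_op :: "'h::chilbert_space bop \<Rightarrow> 'h cnj_space bop"
  is "\<lambda>f x. to_cnj (f (of_cnj x))"
proof -
  fix f :: "'h \<Rightarrow> 'h"
  assume f: "bounded_linear f \<and> (\<forall>c x. f (c *\<^sub>C x) = c *\<^sub>C f x)"
  then obtain K where K: "\<And>x. norm (f x) \<le> norm x * K"
    using bounded_linear.bounded by blast
  have "bounded_linear (\<lambda>x. to_cnj (f (of_cnj x)))"
    using f K
    by (intro bounded_linear_intro[where K = K])
       (simp_all add: plus_cnj_space_def scaleR_cnj_space_def norm_cnj_space_def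
          to_cnj_inverse linear_simps)
  then show "bounded_linear (\<lambda>x. to_cnj (f (of_cnj x))) \<and>
      (\<forall>c x. to_cnj (f (of_cnj (c *\<^sub>C x))) = c *\<^sub>C to_cnj (f (of_cnj x)))"
    using f by (simp add: scaleC_cnj_space_def to_cnj_inverse)
qed

text \<open>
  A Hilbert space tensor product is determined up to unitary equivalence by the following
  property, so an arbitrary realisation of it is allowed.  The real span suffices for totality,
  because complex scalars can be absorbed into a factor.
\<close>

definition hilbert_tensor ::
  "('a::chilbert_space \<Rightarrow> 'b::chilbert_space \<Rightarrow> 't::chilbert_space) \<Rightarrow> bool" where
  "hilbert_tensor t \<longleftrightarrow>
     (\<forall>u u' v. t (u + u') v = t u v + t u' v) \<and>
     (\<forall>u v v'. t u (v + v') = t u v + t u v') \<and>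
     (\<forall>c u v. t (c *\<^sub>C u) v = c *\<^sub>C t u v) \<and>
     (\<forall>c u v. t u (c *\<^sub>C v) = c *\<^sub>C t u v) \<and>
     (\<forall>u v u' v'. cinner (t u v) (t u' v') = cinner u u' * cinner v v') \<and>
     closure (span {t u v | u v. True}) = UNIV"

definition tensor_op ::
  "('a::chilbert_space \<Rightarrow> 'b::chilbert_space \<Rightarrow> 't::chilbert_space) \<Rightarrow>
     'a bop \<Rightarrow> 'b bop \<Rightarrow> 't bop" where
  "tensor_op t x y = (THE T. \<forall>u v. app T (t u v) = t (app x u) (app y v))"


section \<open>Von Neumann algebras and normal maps\<close>

text \<open>
  The ultraweak topology is the coarsest topology for which all functionals
  \<open>T \<mapsto> (\<Sum>n. \<langle>u n, T (v n)\<rangle>)\<close> with square-summable sequences \<open>u\<close> and \<open>v\<close> are continuous.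
  By the bicommutant theorem, the ultraweakly closed unital *-subalgebras are exactly those
  that equal their bicommutant, and normality of a positive linear map amounts to
  ultraweak continuity.
\<close>

definition ultraweak :: "'h::chilbert_space bop topology" where
  "ultraweak = topology_generated_by
     {(\<lambda>T. \<Sum>n. cinner (u n) (app T (v n))) -` U | (u :: nat \<Rightarrow> 'h) (v :: nat \<Rightarrow> 'h) U.
        summable (\<lambda>n. (norm (u n))\<^sup>2) \<and> summable (\<lambda>n. (norm (v n))\<^sup>2) \<and> open U}"

definition von_neumann_algebra :: "'h::chilbert_space bop set \<Rightarrow> bool" where
  "von_neumann_algebra N \<longleftrightarrow>
     1 \<in> N \<and> (\<forall>x\<in>N. \<forall>y\<in>N. x + y \<in> N \<and> x * y \<in> N) \<and>
     (\<forall>c. \<forall>x\<in>N. scale_op c x \<in> N) \<and> (\<forall>x\<in>N. adj x \<in> N) \<and>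
     closedin ultraweak N"

definition vn_generated :: "'h::chilbert_space bop set \<Rightarrow> 'h bop set" where
  "vn_generated S = \<Inter>{N. von_neumann_algebra N \<and> S \<subseteq> N}"

definition linear_on :: "'h::chilbert_space bop set \<Rightarrow> ('h bop \<Rightarrow> 'k::chilbert_space bop) \<Rightarrow> bool" where
  "linear_on N f \<longleftrightarrow>
     (\<forall>x\<in>N. \<forall>y\<in>N. f (x + y) = f x + f y) \<and>
     (\<forall>c. \<forall>x\<in>N. f (scale_op c x) = scale_op c (f x))"

definition normal_on :: "'h::chilbert_space bop set \<Rightarrow> ('h bop \<Rightarrow> 'k::chilbert_space bop) \<Rightarrow> bool" where
  "normal_on N f \<longleftrightarrow> continuous_map (subtopology ultraweak N) ultraweak f"

text \<open>
  Maps between von Neumann algebras are extensional (\<open>undefined\<close> outside their domain), so that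
  equality of endomorphisms is equality of functions and \<^const>\<open>compose\<close> is their composition.
\<close>

definition normal_hom ::
  "'h::chilbert_space bop set \<Rightarrow> 'k::chilbert_space bop set \<Rightarrow> ('h bop \<Rightarrow> 'k bop) \<Rightarrow> bool" where
  "normal_hom N P f \<longleftrightarrow>
     f \<in> N \<rightarrow>\<^sub>E P \<and> linear_on N f \<and> normal_on N f \<and> f 1 = 1 \<and>
     (\<forall>x\<in>N. \<forall>y\<in>N. f (x * y) = f x * f y) \<and> (\<forall>x\<in>N. f (adj x) = adj (f x))"

type_synonym 'h opmap = "'h bop \<Rightarrow> 'h bop"

definition Endo :: "'h::chilbert_space bop set \<Rightarrow> 'h opmap set" where
  "Endo N = {\<rho>. normal_hom N N \<rho>}"

definition Auto :: "'h::chilbert_space bop set \<Rightarrow> 'h opmap set" where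
  "Auto N = {\<alpha> \<in> Endo N. bij_betw \<alpha> N N}"

definition id_on :: "'h::chilbert_space bop set \<Rightarrow> 'h opmap" where
  "id_on N = (\<lambda>x\<in>N. x)"

text \<open>The endomorphism \<open>\<alpha>\<rho>\<alpha>\<^sup>-\<^sup>1\<close>.\<close>

definition conj_by :: "'h::chilbert_space bop set \<Rightarrow> 'h opmap \<Rightarrow> 'h opmap \<Rightarrow> 'h opmap" where
  "conj_by N \<alpha> \<rho> = compose N \<alpha> (compose N \<rho> (restrict (inv_into N \<alpha>) N))"

definition unitary_in :: "'h::chilbert_space bop set \<Rightarrow> 'h bop \<Rightarrow> bool" where
  "unitary_in N u \<longleftrightarrow> u \<in> N \<and> adj u * u = 1 \<and> u * adj u = 1"

definition projection_in :: "'h::chilbert_space bop set \<Rightarrow> 'h bop \<Rightarrow> bool" where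
  "projection_in N p \<longleftrightarrow> p \<in> N \<and> adj p = p \<and> p * p = p"

definition factor :: "'h::chilbert_space bop set \<Rightarrow> bool" where
  "factor N \<longleftrightarrow> von_neumann_algebra N \<and>
     {x \<in> N. \<forall>y\<in>N. x * y = y * x} = range (\<lambda>c. scale_op c 1)"

definition finite_projection :: "'h::chilbert_space bop set \<Rightarrow> 'h bop \<Rightarrow> bool" where
  "finite_projection N p \<longleftrightarrow> projection_in N p \<and>
     (\<forall>v\<in>N. adj v * v = p \<and> p * (v * adj v) = v * adj v \<longrightarrow> v * adj v = p)"

definition type_III_factor :: "'h::chilbert_space bop set \<Rightarrow> bool" where
  "type_III_factor N \<longleftrightarrow> factor N \<and> (\<forall>p. finite_projection N p \<longrightarrow> p = 0)"

definition faithful_normal_state ::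
  "'h::chilbert_space bop set \<Rightarrow> ('h bop \<Rightarrow> complex) \<Rightarrow> bool" where
  "faithful_normal_state N \<phi> \<longleftrightarrow>
     (\<forall>x\<in>N. \<forall>y\<in>N. \<phi> (x + y) = \<phi> x + \<phi> y) \<and>
     (\<forall>c. \<forall>x\<in>N. \<phi> (scale_op c x) = c * \<phi> x) \<and>
     continuous_map (subtopology ultraweak N) euclidean \<phi> \<and>
     (\<forall>x\<in>N. \<phi> (adj x * x) \<in> \<real>\<^sub>\<ge>\<^sub>0) \<and> \<phi> 1 = 1 \<and>
     (\<forall>x\<in>N. \<phi> (adj x * x) = 0 \<longrightarrow> x = 0)"

definition faithful_normal_expectation ::
  "'h::chilbert_space bop set \<Rightarrow> 'h bop set \<Rightarrow> 'h opmap \<Rightarrow> bool" where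
  "faithful_normal_expectation N P E \<longleftrightarrow>
     P \<subseteq> N \<and> E \<in> N \<rightarrow> P \<and> linear_on N E \<and> normal_on N E \<and>
     (\<forall>x\<in>N. positive_op x \<longrightarrow> positive_op (E x)) \<and>
     (\<forall>a\<in>P. E a = a) \<and> (\<forall>a\<in>P. \<forall>b\<in>P. \<forall>x\<in>N. E (a * x * b) = a * E x * b) \<and>
     (\<forall>x\<in>N. E (adj x * x) = 0 \<longrightarrow> x = 0)"


section \<open>Endomorphisms, intertwiners and conjugates\<close>

definition intertwiners ::
  "'h::chilbert_space bop set \<Rightarrow> 'h opmap \<Rightarrow> 'h opmap \<Rightarrow> 'h bop set" where
  "intertwiners N \<rho> \<sigma> = {T \<in> N. \<forall>x\<in>N. T * \<rho> x = \<sigma> x * T}"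

definition unitarily_equivalent ::
  "'h::chilbert_space bop set \<Rightarrow> 'h opmap \<Rightarrow> 'h opmap \<Rightarrow> bool" where
  "unitarily_equivalent N \<rho> \<sigma> \<longleftrightarrow>
     (\<exists>u. unitary_in N u \<and> \<rho> = (\<lambda>x\<in>N. u * \<sigma> x * adj u))"

definition irreducible_end :: "'h::chilbert_space bop set \<Rightarrow> 'h opmap \<Rightarrow> bool" where
  "irreducible_end N \<rho> \<longleftrightarrow> intertwiners N \<rho> \<rho> = range (\<lambda>c. scale_op c 1)"

text \<open>\<open>R\<close>, \<open>R'\<close> solve the conjugate equations for \<open>\<rho>\<close> and \<open>\<rho>'\<close>, normalised to \<open>d\<close>.\<close>

definition conjugate_solution ::
  "'h::chilbert_space bop set \<Rightarrow> 'h opmap \<Rightarrow> 'h opmap \<Rightarrow> 'h bop \<Rightarrow> 'h bop \<Rightarrow> real \<Rightarrow> bool" where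
  "conjugate_solution N \<rho> \<rho>' R R' d \<longleftrightarrow>
     \<rho> \<in> Endo N \<and> \<rho>' \<in> Endo N \<and>
     R \<in> intertwiners N (id_on N) (compose N \<rho>' \<rho>) \<and>
     R' \<in> intertwiners N (id_on N) (compose N \<rho> \<rho>') \<and>
     adj R * R = scale_op (complex_of_real d) 1 \<and>
     adj R' * R' = scale_op (complex_of_real d) 1 \<and>
     adj R * \<rho>' R' = 1 \<and> adj R' * \<rho> R = 1"

definition conjugate_of :: "'h::chilbert_space bop set \<Rightarrow> 'h opmap \<Rightarrow> 'h opmap \<Rightarrow> bool" where
  "conjugate_of N \<rho> \<rho>' \<longleftrightarrow> (\<exists>R R' d. conjugate_solution N \<rho> \<rho>' R R' d)"

text \<open>
  Finite index is existence of a conjugate, and the dimension \<open>d(\<rho>)\<close> is the minimal value of a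
  normalised solution (Longo--Roberts).
\<close>

definition Endo0 :: "'h::chilbert_space bop set \<Rightarrow> 'h opmap set" where
  "Endo0 N = {\<rho> \<in> Endo N. \<exists>\<rho>'. conjugate_of N \<rho> \<rho>'}"

definition stat_dim :: "'h::chilbert_space bop set \<Rightarrow> 'h opmap \<Rightarrow> real" where
  "stat_dim N \<rho> = Inf {d. \<exists>\<rho>' R R'. conjugate_solution N \<rho> \<rho>' R R' d}"

definition rigid_category :: "'h::chilbert_space bop set \<Rightarrow> 'h opmap set \<Rightarrow> bool" where
  "rigid_category N D \<longleftrightarrow>
     D \<subseteq> Endo0 N \<and> id_on N \<in> D \<and>
     (\<forall>\<rho>\<in>D. \<forall>\<sigma>. unitarily_equivalent N \<sigma> \<rho> \<longrightarrow> \<sigma> \<in> D) \<and>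
     (\<forall>\<rho>\<in>D. \<forall>\<sigma>\<in>D. compose N \<rho> \<sigma> \<in> D) \<and>
     (\<forall>\<rho>\<in>D. \<forall>\<sigma>. conjugate_of N \<rho> \<sigma> \<longrightarrow> \<sigma> \<in> D) \<and>
     (\<forall>\<rho>\<in>D. \<forall>\<sigma>\<in>D. \<forall>\<tau>\<in>Endo N. \<forall>V\<in>intertwiners N \<rho> \<tau>. \<forall>W\<in>intertwiners N \<sigma> \<tau>.
        adj V * V = 1 \<and> adj W * W = 1 \<and> V * adj V + W * adj W = 1 \<longrightarrow> \<tau> \<in> D) \<and>
     (\<forall>\<rho>\<in>D. \<forall>\<tau>\<in>Endo N. \<forall>V\<in>intertwiners N \<tau> \<rho>. adj V * V = 1 \<longrightarrow> \<tau> \<in> D)"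

definition irreducible_representatives ::
  "'h::chilbert_space bop set \<Rightarrow> 'h opmap set \<Rightarrow> 'h opmap set \<Rightarrow> bool" where
  "irreducible_representatives N D I \<longleftrightarrow>
     I \<subseteq> D \<and> (\<forall>\<pi>\<in>I. irreducible_end N \<pi>) \<and>
     (\<forall>\<rho>\<in>D. irreducible_end N \<rho> \<longrightarrow> (\<exists>!\<pi>. \<pi> \<in> I \<and> unitarily_equivalent N \<rho> \<pi>))"


section \<open>The opposite algebra and the Longo--Rehren inclusion\<close>

text \<open>
  The opposite of \<open>M\<close> is realised on the conjugate Hilbert space, where \<open>x\<close> (as an element of the
  opposite algebra) acts as the conjugate of the operator \<open>adj x\<close>; this reverses products.
  Consequently \<open>j x\<close>, i.e. \<open>adj x\<close> in the opposite algebra, acts as the conjugate of \<open>x\<close> itself,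
  so \<open>j\<close> is \<^const>\<open>cnj_op\<close>, a conjugate-linear *-isomorphism.
\<close>

abbreviation j_op :: "'h::chilbert_space bop \<Rightarrow> 'h cnj_space bop" where
  "j_op \<equiv> cnj_op"

definition opposite :: "'h::chilbert_space bop set \<Rightarrow> 'h cnj_space bop set" where
  "opposite N = j_op ` N"

definition op_end :: "'h::chilbert_space bop set \<Rightarrow> 'h opmap \<Rightarrow> 'h cnj_space opmap" where
  "op_end N \<pi> = (\<lambda>y\<in>opposite N. j_op (\<pi> (inv_into N j_op y)))"

definition vn_tensor ::
  "('a::chilbert_space \<Rightarrow> 'b::chilbert_space \<Rightarrow> 't::chilbert_space) \<Rightarrow>
     'a bop set \<Rightarrow> 'b bop set \<Rightarrow> 't bop set" where
  "vn_tensor t N P = vn_generated {tensor_op t x y | x y. x \<in> N \<and> y \<in> P}"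

text \<open>\<open>F\<close> is the tensor product of the normal endomorphisms \<open>f\<close> and \<open>g\<close>; it is unique.\<close>

definition tensor_end ::
  "('a::chilbert_space \<Rightarrow> 'b::chilbert_space \<Rightarrow> 't::chilbert_space) \<Rightarrow>
     'a bop set \<Rightarrow> 'b bop set \<Rightarrow> 'a opmap \<Rightarrow> 'b opmap \<Rightarrow> 't opmap \<Rightarrow> bool" where
  "tensor_end t N P f g F \<longleftrightarrow> F \<in> Endo (vn_tensor t N P) \<and>
     (\<forall>x\<in>N. \<forall>y\<in>P. F (tensor_op t x y) = tensor_op t (f x) (g y))"

text \<open>
  The data of the construction: the factor \<open>\<M>\<close>, a tensor product of its Hilbert space with the
  conjugate one, the category with its irreducible representatives and the fixed conjugates
  and solutions, the action \<open>\<alpha>\<close>, the embedding \<open>\<iota>\<close> of \<open>\<A>\<close> into \<open>\<B>\<close>, the operators \<open>\<lambda>\<^sub>\<pi>\<close>,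
  the expectation of \<open>\<B>\<close> onto the image of \<open>\<A>\<close>, and the automorphisms \<open>\<beta>\<close> of \<open>\<B>\<close>.
\<close>

record (overloaded) ('h, 't, 'k, 'g) lr_data =
  alg_M :: "'h bop set"
  htensor :: "'h \<Rightarrow> 'h cnj_space \<Rightarrow> 't"
  cat :: "'h opmap set"
  irr :: "'h opmap set"
  conjugate :: "'h opmap \<Rightarrow> 'h opmap"
  sol_R :: "'h opmap \<Rightarrow> 'h bop"
  sol_Rbar :: "'h opmap \<Rightarrow> 'h bop"
  alpha :: "'g \<Rightarrow> 'h opmap"
  iota :: "'t bop \<Rightarrow> 'k bop"
  lam :: "'h opmap \<Rightarrow> 'k bop"
  alg_B :: "'k bop set"
  expect :: "'k opmap"
  beta :: "'g \<Rightarrow> 'k opmap"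


definition alg_A :: "('h::chilbert_space, 't::chilbert_space, 'k::chilbert_space, 'g) lr_data \<Rightarrow> 't bop set" where
  "alg_A D = vn_tensor (htensor D) (alg_M D) (opposite (alg_M D))"

text \<open>The element \<open>x \<otimes> y\<close> of \<open>\<A>\<close>, viewed in \<open>\<B>\<close>.\<close>

definition elem ::
  "('h::chilbert_space, 't::chilbert_space, 'k::chilbert_space, 'g) lr_data \<Rightarrow>
     'h bop \<Rightarrow> 'h cnj_space bop \<Rightarrow> 'k bop" where
  "elem D x y = iota D (tensor_op (htensor D) x y)"

text \<open>The actions \<open>g[\<pi>]\<close> on endomorphisms of \<open>\<M>\<close> and \<open>k[\<theta>]\<close> on endomorphisms of \<open>\<B>\<close>.\<close>

definition act_M ::
  "('h::chilbert_space, 't::chilbert_space, 'k::chilbert_space, 'g) lr_data \<Rightarrow>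
     'g \<Rightarrow> 'h opmap \<Rightarrow> 'h opmap" where
  "act_M D g \<pi> = conj_by (alg_M D) (alpha D g) \<pi>"

definition act_B ::
  "('h::chilbert_space, 't::chilbert_space, 'k::chilbert_space, 'g) lr_data \<Rightarrow>
     'g \<Rightarrow> 'k opmap \<Rightarrow> 'k opmap" where
  "act_B D k \<theta> = conj_by (alg_B D) (beta D k) \<theta>"

definition category_data ::
  "('h::chilbert_space, 't::chilbert_space, 'k::chilbert_space, 'g) lr_data \<Rightarrow> bool" where
  "category_data D \<longleftrightarrow>
     type_III_factor (alg_M D) \<and> (\<exists>\<phi>. faithful_normal_state (alg_M D) \<phi>) \<and>
     hilbert_tensor (htensor D) \<and>
     rigid_category (alg_M D) (cat D) \<and>
     irreducible_representatives (alg_M D) (cat D) (irr D) \<and>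
     countable (irr D) \<and> id_on (alg_M D) \<in> irr D \<and>
     (\<forall>\<rho>\<in>Endo0 (alg_M D). conjugate_solution (alg_M D) \<rho> (conjugate D \<rho>)
        (sol_R D \<rho>) (sol_Rbar D \<rho>) (stat_dim (alg_M D) \<rho>))"

definition group_action ::
  "('h::chilbert_space, 't::chilbert_space, 'k::chilbert_space, 'g::group_add) lr_data \<Rightarrow> bool" where
  "group_action D \<longleftrightarrow>
     (\<forall>g. alpha D g \<in> Auto (alg_M D)) \<and>
     alpha D 0 = id_on (alg_M D) \<and>
     (\<forall>g h. alpha D (g + h) = compose (alg_M D) (alpha D g) (alpha D h)) \<and>
     (\<forall>g. \<forall>\<rho>\<in>cat D. act_M D g \<rho> \<in> cat D) \<and>
     (\<forall>g. g \<noteq> 0 \<longrightarrow> alpha D g \<notin> cat D)"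

definition longo_rehren ::
  "('h::chilbert_space, 't::chilbert_space, 'k::chilbert_space, 'g) lr_data \<Rightarrow> bool" where
  "longo_rehren D \<longleftrightarrow>
     von_neumann_algebra (alg_B D) \<and>
     normal_hom (alg_A D) (alg_B D) (iota D) \<and> inj_on (iota D) (alg_A D) \<and>
     lam D \<in> cat D \<rightarrow> alg_B D \<and>
     alg_B D = vn_generated (iota D ` alg_A D \<union> lam D ` cat D) \<and>
     (\<forall>\<pi>\<in>cat D. \<exists>P.
        tensor_end (htensor D) (alg_M D) (opposite (alg_M D)) \<pi> (op_end (alg_M D) \<pi>) P \<and>
        (\<forall>a\<in>alg_A D. lam D \<pi> * iota D a = iota D (P a) * lam D \<pi>)) \<and>
     (\<forall>\<pi>\<in>cat D. \<forall>\<rho>\<in>cat D. lam D \<pi> * lam D \<rho> = lam D (compose (alg_M D) \<pi> \<rho>)) \<and>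
     (\<forall>\<pi>\<in>cat D. adj (lam D \<pi>) =
        adj (elem D (sol_R D \<pi>) (j_op (sol_R D \<pi>))) * lam D (conjugate D \<pi>)) \<and>
     (\<forall>\<pi>\<in>cat D. \<forall>\<rho>\<in>cat D. \<forall>T\<in>intertwiners (alg_M D) \<pi> \<rho>.
        elem D T 1 * lam D \<pi> = elem D 1 (j_op (adj T)) * lam D \<rho>) \<and>
     faithful_normal_expectation (alg_B D) (iota D ` alg_A D) (expect D) \<and>
     (\<forall>a\<in>alg_A D. \<forall>\<pi>\<in>irr D.
        expect D (iota D a * lam D \<pi>) = (if \<pi> = id_on (alg_M D) then iota D a else 0))"

definition beta_extends ::
  "('h::chilbert_space, 't::chilbert_space, 'k::chilbert_space, 'g::group_add) lr_data \<Rightarrow> bool" where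
  "beta_extends D \<longleftrightarrow>
     (\<forall>g. beta D g \<in> Auto (alg_B D) \<and>
       (\<exists>P. tensor_end (htensor D) (alg_M D) (opposite (alg_M D))
              (alpha D g) (op_end (alg_M D) (alpha D g)) P \<and>
          (\<forall>a\<in>alg_A D. \<forall>\<pi>\<in>cat D.
             beta D g (iota D a * lam D \<pi>) = iota D (P a) * lam D (act_M D g \<pi>))))"

definition equivariant_longo_rehren ::
  "('h::chilbert_space, 't::chilbert_space, 'k::chilbert_space, 'g::group_add) lr_data \<Rightarrow> bool" where
  "equivariant_longo_rehren D \<longleftrightarrow>
     category_data D \<and> group_action D \<and> longo_rehren D \<and> beta_extends D"


section \<open>Half braidings and the G-twisted centre\<close>

definition half_braiding ::
  "('h::chilbert_space, 't::chilbert_space, 'k::chilbert_space, 'g::group_add) lr_data \<Rightarrow>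
     'g \<Rightarrow> 'h opmap \<Rightarrow> ('h opmap \<Rightarrow> 'h bop) \<Rightarrow> bool" where
  "half_braiding D g \<sigma> \<E> \<longleftrightarrow>
     \<sigma> \<in> cat D \<and>
     (\<forall>\<pi>\<in>cat D. unitary_in (alg_M D) (\<E> \<pi>) \<and>
        \<E> \<pi> \<in> intertwiners (alg_M D) (compose (alg_M D) \<sigma> \<pi>) (compose (alg_M D) (act_M D g \<pi>) \<sigma>)) \<and>
     (\<forall>\<pi>\<in>cat D. \<forall>\<rho>\<in>cat D. \<E> (compose (alg_M D) \<pi> \<rho>) = act_M D g \<pi> (\<E> \<rho>) * \<E> \<pi>) \<and>
     (\<forall>\<pi>\<in>cat D. \<forall>\<rho>\<in>cat D. \<forall>T\<in>intertwiners (alg_M D) \<pi> \<rho>.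
        alpha D g T * \<E> \<pi> = \<E> \<rho> * \<sigma> T)"

text \<open>\<open>\<theta> = \<eta>\<^sub>G(\<sigma>, \<E>)\<close> for the \<open>g\<close>-half braiding \<open>\<E>\<close> of \<open>\<sigma>\<close>; these conditions determine \<open>\<theta>\<close>.\<close>

definition eta_extension ::
  "('h::chilbert_space, 't::chilbert_space, 'k::chilbert_space, 'g::group_add) lr_data \<Rightarrow>
     'g \<Rightarrow> 'h opmap \<Rightarrow> ('h opmap \<Rightarrow> 'h bop) \<Rightarrow> 'k opmap \<Rightarrow> bool" where
  "eta_extension D g \<sigma> \<E> \<theta> \<longleftrightarrow>
     half_braiding D g \<sigma> \<E> \<and> \<theta> \<in> Endo0 (alg_B D) \<and>
     (\<exists>P. tensor_end (htensor D) (alg_M D) (opposite (alg_M D)) \<sigma> (op_end (alg_M D) (alpha D g)) P \<and>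
        (\<forall>a\<in>alg_A D. \<theta> (iota D a) = iota D (P a))) \<and>
     (\<forall>\<pi>\<in>cat D. \<theta> (lam D \<pi>) = elem D (adj (\<E> \<pi>)) 1 * lam D (act_M D g \<pi>))"

definition eta_objects ::
  "('h::chilbert_space, 't::chilbert_space, 'k::chilbert_space, 'g::group_add) lr_data \<Rightarrow>
     'g \<Rightarrow> 'k opmap set" where
  "eta_objects D g = {\<theta>. \<exists>\<sigma> \<E>. eta_extension D g \<sigma> \<E> \<theta>}"

text \<open>The homogeneous component \<open>Z\<^sup>G(\<D>\<^sub>0)\<^sub>g\<close>.\<close>

definition ZG ::
  "('h::chilbert_space, 't::chilbert_space, 'k::chilbert_space, 'g::group_add) lr_data \<Rightarrow>
     'g \<Rightarrow> 'k opmap set" where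
  "ZG D g = {\<theta> \<in> Endo0 (alg_B D). \<exists>\<phi>\<in>eta_objects D g. unitarily_equivalent (alg_B D) \<theta> \<phi>}"

text \<open>
  \<open>\<E>\<^sub>G(\<theta>, \<phi>)\<close> as a function of the endomorphisms themselves; that it does not depend on the
  presentations of \<open>\<theta>\<close> and \<open>\<phi>\<close> as \<open>\<eta>\<^sub>G\<close>-extensions is a consequence of the axioms.
\<close>

definition braiding_G ::
  "('h::chilbert_space, 't::chilbert_space, 'k::chilbert_space, 'g::group_add) lr_data \<Rightarrow>
     'k opmap \<Rightarrow> 'k opmap \<Rightarrow> 'k bop" where
  "braiding_G D \<theta> \<phi> = (THE X. \<exists>g \<sigma> \<E> h \<rho> \<F>.
     eta_extension D g \<sigma> \<E> \<theta> \<and> eta_extension D h \<rho> \<F> \<phi> \<and> X = elem D (\<E> \<rho>) 1)"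

end

theory Submission
  imports Defs
begin

text \<open>
  All braiding identities are statements about operators \<open>X \<otimes> 1\<close> with \<open>X \<in> \<M>\<close>, and reduce to the
  half braiding relations once three facts about \<open>\<A> \<subset> \<B>\<close> are available.  First, normal
  homomorphisms on \<open>\<B>\<close> that agree on \<open>\<A>\<close> and on the \<open>\<lambda>\<^sub>\<pi>\<close> coincide, which gives (BF0).  Second,
  \<open>(x \<otimes> 1) \<lambda>\<^sub>\<pi>\<close> determines \<open>x\<close>, by the conjugate equations; so the braiding is well defined.  Third,
  an intertwiner \<open>T \<noteq> 0\<close> between \<open>\<eta>\<^sub>G\<close>-extensions of degrees \<open>g\<close> and \<open>h\<close> forces \<open>g = h\<close> and has the
  form \<open>X \<otimes> 1\<close>: the slices of the Fourier coefficients \<open>E(\<lambda>\<^sub>\<pi> T)\<close> intertwine \<open>\<alpha>\<^sub>k\<^sup>-\<^sup>1\<close> with \<open>\<pi>\<close> for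
  \<open>k = h g\<^sup>-\<^sup>1\<close>, and no \<open>\<alpha>\<^sub>k\<close> with \<open>k \<noteq> 0\<close> lies in the category.
\<close>

section \<open>Hilbert space preliminaries\<close>

text \<open>Two obstacles shape the proof. \<open>adj\<close>, \<open>tensor_op\<close> and
  \<open>braiding_G\<close> are definite descriptions, so existence and uniqueness have to come
  first: hence Riesz representation, the extension of x \<otimes> y from elementary tensors, and the
  recovery of all data of an \<eta>-extension from its values. Moreover, no convergent expansion in
  the \<lambda>_\<pi> is at hand, and multiplication is only separately ultraweakly continuous.
  Convergence is avoided: closed conditions are checked on generators, and faithfulness of E turns
  vanishing coefficients into a vanishing operator.

  The recurring device is naturality of \<lambda>: for V \<in> (id, \<pi>) it reads (1 \<otimes>
  j(adj V)) \<lambda>_\<pi> = V \<otimes> 1, once \<lambda>_id = 1 is known. With V from the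
  conjugate equations it removes \<lambda>_\<pi>; with V a slice of a coefficient it shows that T -
  E(T) has no coefficients. The degree is detected on the opposite leg, where an \<eta>-extension
  acts by \<alpha>_g whatever \<sigma> is; 1 \<otimes> j(z) is therefore the probe used on
  intertwiners.\<close>

lemma cinner_add_left: "cinner (x + y) z = cinner x z + cinner y (z :: 'a::chilbert_space)"
  by (metis cinner_add_right cinner_commute complex_cnj_add)

lemma cinner_scaleC_left: "cinner (c *\<^sub>C x) y = cnj c * cinner x (y :: 'a::chilbert_space)"
  by (metis cinner_commute cinner_scaleC_right complex_cnj_mult)

lemma cinner_zero_right [simp]: "cinner x (0 :: 'a::chilbert_space) = 0"
  using cinner_add_right[of x 0 0] by simp

lemma cinner_zero_left [simp]: "cinner (0 :: 'a::chilbert_space) x = 0"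
  using cinner_add_left[of 0 0 x] by simp

lemma cinner_minus_right: "cinner x (- y) = - cinner x (y :: 'a::chilbert_space)"
  using cinner_add_right[of x y "- y"] by (simp add: add_eq_0_iff)

lemma cinner_minus_left: "cinner (- x) y = - cinner x (y :: 'a::chilbert_space)"
  using cinner_add_left[of x "- x" y] by (simp add: add_eq_0_iff)

lemma cinner_diff_right: "cinner x (y - z) = cinner x y - cinner x (z :: 'a::chilbert_space)"
  using cinner_add_right[of x y "- z"] by (simp add: cinner_minus_right)

lemma cinner_diff_left: "cinner (x - y) z = cinner x z - cinner y (z :: 'a::chilbert_space)"
  using cinner_add_left[of x "- y" z] by (simp add: cinner_minus_left)

lemma cinner_scaleR_right: "cinner x (scaleR r y) = of_real r * cinner x (y :: 'a::chilbert_space)"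
  by (simp add: scaleR_scaleC cinner_scaleC_right)

lemma cinner_scaleR_left: "cinner (scaleR r x) y = of_real r * cinner x (y :: 'a::chilbert_space)"
  by (simp add: scaleR_scaleC cinner_scaleC_left)

lemma cinner_sum_right: "cinner x (\<Sum>i\<in>I. f i) = (\<Sum>i\<in>I. cinner x (f i :: 'a::chilbert_space))"
  by (induction I rule: infinite_finite_induct) (auto simp: cinner_add_right)

lemma cinner_sum_left: "cinner (\<Sum>i\<in>I. f i) x = (\<Sum>i\<in>I. cinner (f i :: 'a::chilbert_space) x)"
  by (induction I rule: infinite_finite_induct) (auto simp: cinner_add_left)

lemma scaleC_zero_left [simp]: "0 *\<^sub>C x = (0 :: 'a::chilbert_space)"
  using scaleR_scaleC[of 0 x] by simp

lemma cinner_self_eq_0: "cinner x x = 0 \<longleftrightarrow> x = (0 :: 'a::chilbert_space)"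
  by (simp add: cinner_self)

lemma cinner_eqI:
  assumes "\<And>u. cinner u x = cinner u (y :: 'a::chilbert_space)" shows "x = y"
  using assms[of "x - y"] cinner_self_eq_0[of "x - y"] by (simp add: cinner_diff_right)

lemma norm_power2_cinner: "(norm x)\<^sup>2 = Re (cinner x (x :: 'a::chilbert_space))"
  by (simp add: cinner_self)

lemma cauchy_schwarz: "cmod (cinner x y) \<le> norm x * norm (y :: 'a::chilbert_space)"
proof (cases "x = 0")
  case False
  define c where "c = cinner x y"
  \<comment> \<open>\<open>z\<close> is a multiple of the component of \<open>y\<close> orthogonal
    to \<open>x\<close>, scaled to avoid a division; the inequality is nonnegativity of its
    norm.\<close>
  define z where "z = ((norm x)\<^sup>2) *\<^sub>R y - c *\<^sub>C x"
  have xz: "cinner x z = 0"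
    by (simp add: z_def cinner_diff_right cinner_scaleR_right cinner_scaleC_right cinner_self c_def)
  have yx: "cinner y x = cnj c"
    using cinner_commute[of y x] by (simp add: c_def)
  have "cinner z z = of_real ((norm x)\<^sup>2) * cinner y z"
    using xz by (subst z_def) (simp add: cinner_diff_left cinner_scaleR_left cinner_scaleC_left)
  also have "cinner y z = of_real ((norm x)\<^sup>2 * (norm y)\<^sup>2 - (cmod c)\<^sup>2)"
    using complex_norm_square[of c]
    by (simp add: z_def cinner_diff_right cinner_scaleR_right cinner_scaleC_right cinner_self yx)
  finally have "(norm z)\<^sup>2 = (norm x)\<^sup>2 * ((norm x)\<^sup>2 * (norm y)\<^sup>2 - (cmod c)\<^sup>2)"
    unfolding cinner_self of_real_mult[symmetric] of_real_eq_iff .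
  then have "0 \<le> (norm x)\<^sup>2 * ((norm x)\<^sup>2 * (norm y)\<^sup>2 - (cmod c)\<^sup>2)"
    by (metis zero_le_power2)
  then have "(cmod c)\<^sup>2 \<le> (norm x * norm y)\<^sup>2"
    using False by (simp add: zero_le_mult_iff power_mult_distrib)
  then show ?thesis
    unfolding c_def by (rule power2_le_imp_le) simp
qed simp

lemma norm_add_power2:
  "(norm (x + y))\<^sup>2 = (norm x)\<^sup>2 + (norm y)\<^sup>2 + 2 * Re (cinner x (y :: 'a::chilbert_space))"
proof -
  have "Re (cinner y x) = Re (cinner x y)"
    by (metis cinner_commute complex_cnj complex.sel(1) complex_surj)
  then show ?thesis
    by (simp add: norm_power2_cinner cinner_add_left cinner_add_right)
qed

lemma parallelogram:
  "(norm (x - y))\<^sup>2 + (norm (x + y))\<^sup>2 = 2 * (norm x)\<^sup>2 + 2 * (norm (y :: 'a::chilbert_space))\<^sup>2"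
  using norm_add_power2[of x y] norm_add_power2[of x "- y"] by (simp add: cinner_minus_right)

text \<open>The representing vector is the minimiser of \<open>\<parallel>v\<parallel>\<^sup>2 - 2 Re (\<phi> v)\<close>.\<close>

lemma riesz:
  fixes \<phi> :: "'a::chilbert_space \<Rightarrow> complex"
  assumes add: "\<And>x y. \<phi> (x + y) = \<phi> x + \<phi> y" and scale: "\<And>c x. \<phi> (c *\<^sub>C x) = c * \<phi> x"
    and bound: "\<And>x. cmod (\<phi> x) \<le> K * norm x"
  shows "\<exists>w. \<forall>v. \<phi> v = cinner w v"
proof -
  define J where "J v = (norm v)\<^sup>2 - 2 * Re (\<phi> v)" for v
  have scaleR: "\<phi> (scaleR r x) = of_real r * \<phi> x" for r x
    by (simp add: scaleR_scaleC scale)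
  have lower: "- K\<^sup>2 \<le> J v" for v
  proof -
    have "Re (\<phi> v) \<le> K * norm v"
      using bound[of v] complex_Re_le_cmod[of "\<phi> v"] by linarith
    moreover have "0 \<le> (norm v - K)\<^sup>2" by simp
    ultimately show ?thesis by (simp add: J_def power2_diff algebra_simps)
  qed
  define m where "m = Inf (range J)"
  have bdd: "bdd_below (range J)" using lower by (intro bdd_belowI[of _ "- K\<^sup>2"]) auto
  have m: "m \<le> J v" for v unfolding m_def by (rule cInf_lower) (auto simp: bdd)
  have "\<exists>v. J v < m + 1 / real (Suc n)" for n
  proof -
    have "Inf (range J) < m + 1 / real (Suc n)" by (simp add: m_def)
    then show ?thesis using cInf_less_iff[of "range J"] bdd by auto
  qed
  then obtain X where X: "\<And>n. J (X n) < m + 1 / real (Suc n)" by metis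
  \<comment> \<open>The value of \<open>J\<close> at the midpoint of \<open>x\<close> and
    \<open>y\<close> is at least \<open>m\<close>; the parallelogram law turns this into a bound on
    their distance, so a minimising sequence is Cauchy.\<close>
  have key: "(norm (x - y))\<^sup>2 \<le> 2 * (J x - m) + 2 * (J y - m)" for x y
  proof -
    have "(norm (x + y))\<^sup>2 = 4 * (norm (scaleR (1/2) (x + y)))\<^sup>2"
      by (simp add: power_mult_distrib power_divide)
    moreover have "Re (\<phi> (scaleR (1/2) (x + y))) = (Re (\<phi> x) + Re (\<phi> y)) / 2"
      by (simp add: scaleR add)
    moreover have "m \<le> J (scaleR (1/2) (x + y))" by (rule m)
    ultimately show ?thesis using parallelogram[of x y] by (simp add: J_def algebra_simps)
  qed
  have "Cauchy X"
  proof (rule metric_CauchyI)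
    fix e :: real assume "0 < e"
    then obtain N where N: "4 / e\<^sup>2 < real N" using reals_Archimedean2 by blast
    then have Npos: "0 < real (Suc N)" "4 / e\<^sup>2 < real (Suc N)" by simp_all
    have "dist (X i) (X j) < e" if "N \<le> i" "N \<le> j" for i j
    proof -
      have "1 / real (Suc i) \<le> 1 / real (Suc N)" "1 / real (Suc j) \<le> 1 / real (Suc N)"
        using that by (auto intro!: divide_left_mono)
      then have "J (X i) - m < 1 / real (Suc N)" "J (X j) - m < 1 / real (Suc N)"
        using X[of i] X[of j] by linarith+
      then have "(norm (X i - X j))\<^sup>2 < 4 / real (Suc N)"
        using key[of "X i" "X j"] by (simp add: divide_inverse)
      also have "\<dots> < e\<^sup>2" using Npos \<open>0 < e\<close> by (simp add: field_simps)
      finally show ?thesis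
        using \<open>0 < e\<close> by (simp add: dist_norm power2_less_imp_less)
    qed
    then show "\<exists>M. \<forall>i\<ge>M. \<forall>j\<ge>M. dist (X i) (X j) < e" by blast
  qed
  then obtain w where w: "X \<longlonglongrightarrow> w" using Cauchy_convergent convergent_def by blast
  have lin: "bounded_linear \<phi>"
    by (rule bounded_linear_intro[where K = K])
       (use bound in \<open>simp_all add: add scaleR scaleR_conv_of_real mult.commute\<close>)
  have "(\<lambda>n. J (X n)) \<longlonglongrightarrow> J w"
    unfolding J_def using w by (intro tendsto_intros bounded_linear.tendsto[OF lin])
  moreover have "(\<lambda>n. m + 1 / real (Suc n)) \<longlonglongrightarrow> m + 0"
    by (intro tendsto_intros LIMSEQ_Suc lim_1_over_n)
  ultimately have "J w \<le> m + 0"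
    by (rule LIMSEQ_le) (use X less_imp_le in blast)
  then have min: "J w \<le> J v" for v using m[of v] by simp
  have re: "Re (\<phi> v) = Re (cinner w v)" for v
  proof -
    define d where "d = Re (cinner w v) - Re (\<phi> v)"
    \<comment> \<open>First variation at the minimiser: a quadratic in \<open>t\<close> without
      constant term that is never negative has zero linear coefficient. This is read off at t = - d
      / n, with \<open>n\<close> shifted by 1 so that v = 0 needs no separate case.\<close>
    have q: "0 \<le> t\<^sup>2 * (norm v)\<^sup>2 + 2 * t * d" for t
      using min[of "w + scaleR t v"]
      by (simp add: J_def norm_add_power2 add scaleR cinner_scaleR_right power_mult_distrib
          d_def algebra_simps)
    define n where "n = (norm v)\<^sup>2 + 1"
    have "n > 0" by (simp add: n_def add_nonneg_pos)
    have "0 \<le> (- d / n)\<^sup>2 * (norm v)\<^sup>2 + 2 * (- d / n) * d" by (rule q)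
    also have "\<dots> \<le> (- d / n)\<^sup>2 * n + 2 * (- d / n) * d"
      by (simp add: n_def mult_left_mono)
    also have "\<dots> = - (d\<^sup>2 / n)" using \<open>n > 0\<close> by (simp add: field_simps power2_eq_square)
    finally have "d = 0" using \<open>n > 0\<close> by (simp add: divide_le_0_iff)
    then show ?thesis by (simp add: d_def)
  qed
  have "\<phi> v = cinner w v" for v
  proof (rule complex_eqI)
    show "Re (\<phi> v) = Re (cinner w v)" by (rule re)
    show "Im (\<phi> v) = Im (cinner w v)"
      using re[of "\<i> *\<^sub>C v"] by (simp add: scale cinner_scaleC_right)
  qed
  then show ?thesis by blast
qed

section \<open>Bounded operators and their adjoints\<close>

lemma bop_eqI:
  assumes "\<And>v. app S v = app T v" shows "S = T"
  using assms by (metis app_inject ext)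

lemma bop_cinner_eqI:
  assumes "\<And>u v. cinner u (app S v) = cinner u (app T v)" shows "S = T"
  by (intro bop_eqI cinner_eqI) (rule assms)

lemma app_add_right: "app T (x + y) = app T x + app T y"
  using app[of T] by (simp add: linear_simps)

lemma app_scaleC: "app T (c *\<^sub>C x) = c *\<^sub>C app T x"
  using app[of T] by simp

lemma app_zero_right [simp]: "app T 0 = 0"
  using app_add_right[of T 0 0] by simp

lemmas app_op_simps [simp] = zero_bop.rep_eq one_bop.rep_eq plus_bop.rep_eq uminus_bop.rep_eq
  minus_bop.rep_eq times_bop.rep_eq scale_op.rep_eq

lemma app_bounded: "\<exists>K\<ge>0. \<forall>x. norm (app T x) \<le> K * norm x"
  using app[of T] bounded_linear.nonneg_bounded[of "app T"] by (auto simp: mult.commute)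

lemma bounded_linear_app: "bounded_linear (app T)"
  using app[of T] by simp

text \<open>Riesz representation in the first variable, with the form conjugated because
  \<open>riesz\<close> treats linear functionals. Adjoints and slices are both produced this
  way.\<close>

lemma sesquilinear_bop:
  fixes B :: "'h::chilbert_space \<Rightarrow> 'h \<Rightarrow> complex"
  assumes addl: "\<And>u u' v. B (u + u') v = B u v + B u' v"
    and scl: "\<And>c u v. B (c *\<^sub>C u) v = cnj c * B u v"
    and addr: "\<And>u v v'. B u (v + v') = B u v + B u v'"
    and scr: "\<And>c u v. B u (c *\<^sub>C v) = c * B u v"
    and bound: "\<And>u v. cmod (B u v) \<le> K * norm u * norm v"
  shows "\<exists>S. \<forall>u v. cinner u (app S v) = B u v"
proof -
  have "\<exists>w. \<forall>u. cnj (B u v) = cinner w u" for v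
    by (rule riesz[where K = "K * norm v"])
       (use bound in \<open>simp_all add: addl scl mult.commute mult.left_commute\<close>)
  then obtain S where S: "\<And>v u. cnj (B u v) = cinner (S v) u" by metis
  have S': "cinner u (S v) = B u v" for u v
    by (metis S cinner_commute complex_cnj_cnj)
  have "bounded_linear S"
  proof (rule bounded_linear_intro[where K = K])
    show "S (x + y) = S x + S y" for x y
      by (rule cinner_eqI) (simp add: S' cinner_add_right addr)
    show "S (scaleR r x) = scaleR r (S x)" for r x
      by (rule cinner_eqI) (simp add: S' cinner_scaleR_right scaleR_scaleC cinner_scaleC_right scr)
    show "norm (S x) \<le> norm x * K" for x
    proof (cases "S x = 0")
      case True
      have "0 \<le> K * norm x * norm x" using bound[of x x] by (metis norm_ge_zero order_trans)
      then show ?thesis using True by (cases "x = 0") (simp_all add: zero_le_mult_iff)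
    next
      case False
      have "(norm (S x))\<^sup>2 = cmod (B (S x) x)"
        using S'[of "S x" x] by (metis cinner_self norm_of_real abs_power2)
      also have "\<dots> \<le> K * norm (S x) * norm x" by (rule bound)
      finally show ?thesis using False by (simp add: power2_eq_square mult.commute mult.left_commute)
    qed
  qed
  moreover have "S (c *\<^sub>C x) = c *\<^sub>C S x" for c x
    by (rule cinner_eqI) (simp add: S' cinner_scaleC_right scr)
  ultimately have "app (Bop S) = S" by (simp add: Bop_inverse)
  then show ?thesis using S' by metis
qed

text \<open>The property defining \<open>adj\<close> becomes available only after an operator with
  it is exhibited, here from the form that sends (v, u) to <T v, u>, and shown to be the only
  one.\<close>

lemma cinner_adj_left: "cinner (app (adj T) u) v = cinner u (app T v)"
proof -
  obtain K where K: "0 \<le> K" "\<And>x. norm (app T x) \<le> K * norm x" using app_bounded by blast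
  have "\<exists>S. \<forall>v u. cinner v (app S u) = cinner (app T v) u"
  proof (rule sesquilinear_bop[where K = K])
    fix u v
    have "cmod (cinner (app T u) v) \<le> norm (app T u) * norm v" by (rule cauchy_schwarz)
    also have "\<dots> \<le> K * norm u * norm v" using K by (simp add: mult_right_mono)
    finally show "cmod (cinner (app T u) v) \<le> K * norm u * norm v" .
  qed (simp_all add: app_add_right app_scaleC cinner_add_left cinner_add_right
      cinner_scaleC_left cinner_scaleC_right)
  then obtain S where "\<And>v u. cinner v (app S u) = cinner (app T v) u" by blast
  then have S: "cinner (app S u) v = cinner u (app T v)" for u v
    by (metis cinner_commute)
  have "S' = S" if "\<forall>u v. cinner (app S' u) v = cinner u (app T v)" for S'
    by (rule bop_cinner_eqI) (metis S that cinner_commute)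
  then have "adj T = S"
    unfolding adj_def using S by (intro the_equality) auto
  then show ?thesis by (simp add: S)
qed

lemma cinner_adj_right: "cinner u (app (adj T) v) = cinner (app T u) v"
  by (metis cinner_adj_left cinner_commute)

lemma adj_eqI:
  assumes "\<And>u v. cinner u (app S v) = cinner (app T u) v" shows "adj T = S"
  by (rule bop_cinner_eqI) (simp add: assms cinner_adj_right)

lemma adj_adj [simp]: "adj (adj T) = T"
  by (rule adj_eqI) (simp add: cinner_adj_left)

lemma adj_mult [simp]: "adj (S * T) = adj T * adj S"
  by (rule adj_eqI) (simp add: cinner_adj_right)

lemma adj_one [simp]: "adj 1 = 1"
  by (rule adj_eqI) simp

lemma adj_add [simp]: "adj (S + T) = adj S + adj T"
  by (rule adj_eqI) (simp add: cinner_adj_right cinner_add_left cinner_add_right)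

lemma adj_diff [simp]: "adj (S - T) = adj S - adj T"
  by (rule adj_eqI) (simp add: cinner_adj_right cinner_diff_left cinner_diff_right)

lemma adj_scale [simp]: "adj (scale_op c T) = scale_op (cnj c) (adj T)"
  by (rule adj_eqI) (simp add: cinner_adj_right cinner_scaleC_left cinner_scaleC_right)

lemma scale_op_mult_left [simp]: "scale_op c S * T = scale_op c (S * T)"
  by (rule bop_eqI) simp

lemma scale_op_mult_right [simp]: "S * scale_op c T = scale_op c (S * T)"
  by (rule bop_eqI) (simp add: app_scaleC)

lemma scale_op_scale_op [simp]: "scale_op b (scale_op c T) = scale_op (b * c) T"
  by (rule bop_eqI) (simp add: scaleC_scaleC)

lemma scale_op_one [simp]: "scale_op 1 T = T"
  by (rule bop_eqI) simp

lemma scale_op_zero [simp]: "scale_op 0 T = 0"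
  by (rule bop_eqI) simp

lemma scale_op_zero_right [simp]: "scale_op c 0 = 0"
  by (rule bop_eqI) simp

lemma scale_op_minus_one: "scale_op (- 1) T = - T"
proof (rule bop_eqI)
  fix v show "app (scale_op (- 1) T) v = app (- T) v"
    using scaleC_add_left[of "- 1" 1 "app T v"] by (simp add: eq_neg_iff_add_eq_0)
qed

lemma adj_mult_self_eq_0: "adj T * T = 0 \<longleftrightarrow> T = 0"
proof
  assume z: "adj T * T = 0"
  have "app T v = 0" for v
    using cinner_adj_right[of v T "app T v"] arg_cong[OF z, of "\<lambda>S. cinner v (app S v)"]
    by (simp add: cinner_self_eq_0)
  then show "T = 0" by (intro bop_eqI) simp
qed simp

section \<open>The ultraweak topology\<close>

definition square_summable :: "(nat \<Rightarrow> 'h::chilbert_space) \<Rightarrow> bool" where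
  "square_summable u \<longleftrightarrow> summable (\<lambda>n. (norm (u n))\<^sup>2)"

definition uw_functional :: "(nat \<Rightarrow> 'h) \<Rightarrow> (nat \<Rightarrow> 'h) \<Rightarrow> 'h::chilbert_space bop \<Rightarrow> complex" where
  "uw_functional u v T = (\<Sum>n. cinner (u n) (app T (v n)))"

lemma uw_summable:
  assumes "square_summable u" "square_summable v"
  shows "summable (\<lambda>n. cinner (u n) (app T (v n)))"
proof -
  obtain K where K: "0 \<le> K" "\<And>x. norm (app T x) \<le> K * norm x" using app_bounded by blast
  show ?thesis
  proof (rule summable_comparison_test')
    show "summable (\<lambda>n. K * ((norm (u n))\<^sup>2 + (norm (v n))\<^sup>2))"
      using assms unfolding square_summable_def by (intro summable_mult summable_add)
    fix n
    have "cmod (cinner (u n) (app T (v n))) \<le> norm (u n) * norm (app T (v n))"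
      by (rule cauchy_schwarz)
    also have "\<dots> \<le> norm (u n) * (K * norm (v n))"
      using K by (simp add: mult_left_mono)
    also have "\<dots> = K * (norm (u n) * norm (v n))" by simp
    also have "norm (u n) * norm (v n) \<le> (norm (u n))\<^sup>2 + (norm (v n))\<^sup>2"
      using sum_squares_bound[of "norm (u n)" "norm (v n)"]
        mult_nonneg_nonneg[OF norm_ge_zero[of "u n"] norm_ge_zero[of "v n"]] by linarith
    finally show "norm (cinner (u n) (app T (v n))) \<le> K * ((norm (u n))\<^sup>2 + (norm (v n))\<^sup>2)"
      using K by (simp add: mult_left_mono)
  qed
qed

lemma square_summable_app:
  assumes "square_summable u" shows "square_summable (\<lambda>n. app T (u n))"
proof -
  obtain K where K: "0 \<le> K" "\<And>x. norm (app T x) \<le> K * norm x" using app_bounded by blast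
  show ?thesis unfolding square_summable_def
  proof (rule summable_comparison_test')
    show "summable (\<lambda>n. K\<^sup>2 * (norm (u n))\<^sup>2)"
      using assms unfolding square_summable_def by (rule summable_mult)
    show "norm ((norm (app T (u n)))\<^sup>2) \<le> K\<^sup>2 * (norm (u n))\<^sup>2" for n
      using power_mono[OF K(2)[of "u n"], of 2] by (simp add: power_mult_distrib)
  qed
qed

lemma uw_functional_mult_left:
  "uw_functional u v (S * T) = uw_functional (\<lambda>n. app (adj S) (u n)) v T"
  by (simp add: uw_functional_def cinner_adj_left)

lemma uw_functional_mult_right:
  "uw_functional u v (T * S) = uw_functional u (\<lambda>n. app S (v n)) T"
  by (simp add: uw_functional_def)

lemma uw_functional_adj:
  assumes "square_summable u" "square_summable v"
  shows "uw_functional u v (adj T) = cnj (uw_functional v u T)"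
proof -
  have "cinner (u n) (app (adj T) (v n)) = cnj (cinner (v n) (app T (u n)))" for n
    by (metis cinner_adj_right cinner_commute)
  moreover have "(\<lambda>n. cinner (v n) (app T (u n))) sums uw_functional v u T"
    unfolding uw_functional_def using uw_summable[OF assms(2,1)] by (rule summable_sums)
  ultimately show ?thesis
    using sums_cnj[of "\<lambda>n. cinner (v n) (app T (u n))" "uw_functional v u T"]
    unfolding uw_functional_def[of u v] by (simp add: sums_iff)
qed

text \<open>Sequences supported at index 0 recover matrix coefficients. These separate operators,
  which is what makes the topology Hausdorff.\<close>

lemma uw_functional_single:
  "uw_functional (\<lambda>n. if n = 0 then u else 0) (\<lambda>n. if n = 0 then v else 0) T = cinner u (app T v)"
proof -
  have eq: "(\<lambda>n. cinner (if n = 0 then u else 0) (app T (if n = 0 then v else 0)))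
    = (\<lambda>n::nat. if n = 0 then cinner u (app T v) else 0)" by auto
  show ?thesis
    unfolding uw_functional_def eq by (rule sums_unique[symmetric, OF sums_single])
qed

lemma square_summable_single: "square_summable (\<lambda>n. if n = 0 then u else 0)"
  unfolding square_summable_def by (rule summable_finite[of "{0}"]) auto

lemma ultraweak_altdef: "ultraweak = topology_generated_by
  {uw_functional u v -` U | u v U. square_summable u \<and> square_summable v \<and> open U}"
  unfolding ultraweak_def uw_functional_def[abs_def] square_summable_def by simp

lemma topspace_ultraweak [simp]: "topspace (ultraweak :: 'h::chilbert_space bop topology) = UNIV"
proof -
  have "square_summable (\<lambda>n. 0 :: 'h::chilbert_space)" by (simp add: square_summable_def)
  then have "uw_functional (\<lambda>n. 0 :: 'h) (\<lambda>n. 0) -` UNIV \<in>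
    {uw_functional u v -` U | u v U. square_summable u \<and> square_summable v \<and> open U}" by blast
  then show ?thesis unfolding ultraweak_altdef topology_generated_by_topspace by blast
qed

lemma continuous_map_uw_functional:
  assumes "square_summable u" "square_summable v"
  shows "continuous_map ultraweak euclidean (uw_functional u v)"
proof -
  have "openin ultraweak (uw_functional u v -` U)" if "open U" for U
    unfolding ultraweak_altdef by (rule topology_generated_by_Basis) (use assms that in blast)
  then show ?thesis
    by (simp add: continuous_map_def vimage_def)
qed

lemma continuous_map_into_ultraweak:
  fixes f :: "'a \<Rightarrow> 'h::chilbert_space bop"
  assumes "\<And>u v. square_summable u \<Longrightarrow> square_summable v \<Longrightarrow>
    continuous_map X euclidean (\<lambda>x. uw_functional u v (f x))"
  shows "continuous_map X ultraweak f"
  unfolding ultraweak_altdef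
proof (rule continuous_on_generated_topo)
  fix W :: "'h bop set"
  assume "W \<in> {uw_functional u v -` U | u v U. square_summable u \<and> square_summable v \<and> open U}"
  then obtain u v U where W: "W = uw_functional u v -` U" "square_summable u" "square_summable v" "open U"
    by blast
  have "f -` W \<inter> topspace X = {x \<in> topspace X. uw_functional u v (f x) \<in> U}"
    using W by auto
  then show "openin X (f -` W \<inter> topspace X)"
    using assms[OF W(2,3)] W(4) by (simp add: continuous_map_def)
next
  show "f ` topspace X \<subseteq> \<Union> {uw_functional u v -` U | u v U. square_summable u \<and> square_summable v \<and> open U}"
    unfolding topology_generated_by_topspace[symmetric] ultraweak_altdef[symmetric] by simp
qed

lemma Hausdorff_ultraweak: "Hausdorff_space (ultraweak :: 'h::chilbert_space bop topology)"
  unfolding Hausdorff_space_def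
proof (intro allI impI)
  fix S T :: "'h bop" assume "S \<in> topspace ultraweak \<and> T \<in> topspace ultraweak \<and> S \<noteq> T"
  then obtain u v where uv: "cinner u (app S v) \<noteq> cinner u (app T v)"
    using bop_cinner_eqI by blast
  define f where "f = uw_functional (\<lambda>n. if n = 0 then u else 0) (\<lambda>n::nat. if n = 0 then v else 0)"
  have c: "continuous_map ultraweak euclidean f"
    unfolding f_def by (intro continuous_map_uw_functional square_summable_single)
  have "f S \<noteq> f T" using uv by (simp add: f_def uw_functional_single)
  then obtain U V where "open U" "open V" "f S \<in> U" "f T \<in> V" "U \<inter> V = {}"
    by (metis hausdorff)
  moreover have "openin ultraweak {x. f x \<in> U}" "openin ultraweak {x. f x \<in> V}"
    using c \<open>open U\<close> \<open>open V\<close> by (auto simp: continuous_map_def)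
  ultimately show "\<exists>U V. openin ultraweak U \<and> openin ultraweak V \<and> S \<in> U \<and> T \<in> V \<and> disjnt U V"
    by (intro exI[of _ "{x. f x \<in> U}"] exI[of _ "{x. f x \<in> V}"]) (auto simp: disjnt_def)
qed

lemma continuous_map_mult_left: "continuous_map ultraweak ultraweak (\<lambda>T. S * T)"
  by (rule continuous_map_into_ultraweak)
     (simp add: uw_functional_mult_left continuous_map_uw_functional square_summable_app)

lemma continuous_map_mult_right: "continuous_map ultraweak ultraweak (\<lambda>T. T * S)"
  by (rule continuous_map_into_ultraweak)
     (simp add: uw_functional_mult_right continuous_map_uw_functional square_summable_app)

lemma continuous_map_adj: "continuous_map ultraweak ultraweak adj"
proof (rule continuous_map_into_ultraweak)
  fix u v :: "nat \<Rightarrow> 'a" assume uv: "square_summable u" "square_summable v"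
  have "continuous_map euclidean euclidean cnj" by (simp add: continuous_on_cnj)
  then show "continuous_map ultraweak euclidean (\<lambda>x. uw_functional u v (adj x))"
    using continuous_map_compose[OF continuous_map_uw_functional[OF uv(2,1)], of euclidean cnj]
    by (simp add: uw_functional_adj[OF uv] o_def)
qed

section \<open>Von Neumann algebras\<close>

lemma von_neumann_algebraD:
  assumes "von_neumann_algebra N"
  shows "1 \<in> N" "\<And>x y. x \<in> N \<Longrightarrow> y \<in> N \<Longrightarrow> x + y \<in> N" "\<And>x y. x \<in> N \<Longrightarrow> y \<in> N \<Longrightarrow> x * y \<in> N"
    "\<And>c x. x \<in> N \<Longrightarrow> scale_op c x \<in> N" "\<And>x. x \<in> N \<Longrightarrow> adj x \<in> N" "closedin ultraweak N"
  using assms unfolding von_neumann_algebra_def by auto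

lemma von_neumann_algebra_zero: "von_neumann_algebra N \<Longrightarrow> 0 \<in> N"
  using von_neumann_algebraD(4)[OF _ von_neumann_algebraD(1), of N 0] by simp

lemma von_neumann_algebra_diff:
  assumes "von_neumann_algebra N" "x \<in> N" "y \<in> N" shows "x - y \<in> N"
  using von_neumann_algebraD(2)[OF assms(1,2) von_neumann_algebraD(4)[OF assms(1,3), of "- 1"]]
  by (simp add: scale_op_minus_one)

lemma von_neumann_algebra_Inter:
  assumes "\<And>N. N \<in> \<N> \<Longrightarrow> von_neumann_algebra N" shows "von_neumann_algebra (\<Inter>\<N>)"
proof (cases "\<N> = {}")
  case True
  then show ?thesis using closedin_topspace[of ultraweak] by (simp add: von_neumann_algebra_def)
next
  case False
  then have "closedin ultraweak (\<Inter>\<N>)"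
    by (intro closedin_Inter) (auto intro: von_neumann_algebraD assms)
  then show ?thesis
    using assms unfolding von_neumann_algebra_def by blast
qed

lemma von_neumann_algebra_vn_generated: "von_neumann_algebra (vn_generated S)"
  unfolding vn_generated_def by (rule von_neumann_algebra_Inter) blast

lemma vn_generated_incl: "S \<subseteq> vn_generated S"
  unfolding vn_generated_def by blast

lemma vn_generated_least: "von_neumann_algebra N \<Longrightarrow> S \<subseteq> N \<Longrightarrow> vn_generated S \<subseteq> N"
  unfolding vn_generated_def by blast

definition closed_csubspace :: "'h::chilbert_space bop set \<Rightarrow> bool" where
  "closed_csubspace W \<longleftrightarrow> closedin ultraweak W \<and>
     (\<forall>x\<in>W. \<forall>y\<in>W. x + y \<in> W) \<and> (\<forall>c. \<forall>x\<in>W. scale_op c x \<in> W)"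

text \<open>The scalar \<open>b\<close> may differ from \<open>c\<close>, so that the
  conjugate-linear map \<open>adj\<close> is covered along with the linear ones.\<close>

lemma closed_csubspace_vimage:
  assumes W: "closed_csubspace W" and f: "continuous_map ultraweak ultraweak f"
    and "\<And>x y. f (x + y) = f x + f y" "\<And>c x. \<exists>b. f (scale_op c x) = scale_op b (f x)"
  shows "closed_csubspace {x. f x \<in> W}"
proof -
  have "closedin ultraweak {x. f x \<in> W}"
    using closedin_continuous_map_preimage[OF f, of W] W by (simp add: closed_csubspace_def)
  moreover have "f (scale_op c x) \<in> W" if "f x \<in> W" for c x
    using W that assms(4)[of c x] unfolding closed_csubspace_def by metis
  ultimately show ?thesis using W assms(3) by (simp add: closed_csubspace_def)
qed

text \<open>The closed linear span of a *-monoid is already an algebra, by separate continuity.\<close>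

lemma vn_generated_subset_closed_csubspace:
  assumes one: "1 \<in> S" and mult: "\<And>x y. x \<in> S \<Longrightarrow> y \<in> S \<Longrightarrow> x * y \<in> S"
    and adj: "\<And>x. x \<in> S \<Longrightarrow> adj x \<in> S"
    and W: "closed_csubspace W" "S \<subseteq> W"
  shows "vn_generated S \<subseteq> W"
proof -
  define C where "C = \<Inter>{W. closed_csubspace W \<and> S \<subseteq> W}"
  have C: "closed_csubspace C"
  proof -
    have "closedin ultraweak C"
      unfolding C_def by (rule closedin_Inter) (use W in \<open>auto simp: closed_csubspace_def\<close>)
    moreover have "x + y \<in> C" if "x \<in> C" "y \<in> C" for x y
      using that unfolding C_def closed_csubspace_def by blast
    moreover have "scale_op c x \<in> C" if "x \<in> C" for x c
      using that unfolding C_def closed_csubspace_def by blast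
    ultimately show ?thesis by (simp add: closed_csubspace_def)
  qed
  have SC: "S \<subseteq> C" unfolding C_def by blast
  have least: "C \<subseteq> W'" if "closed_csubspace W'" "S \<subseteq> W'" for W'
    using that unfolding C_def by blast
  \<comment> \<open>The factors are extended one at a time: here the left one stays in
    \<open>S\<close>; afterwards a fixed right factor in \<open>C\<close> lets the left one run
    through \<open>C\<close>.\<close>
  have SCC: "x * y \<in> C" if "x \<in> S" "y \<in> C" for x y
  proof -
    have "closed_csubspace {y. x * y \<in> C}"
      by (rule closed_csubspace_vimage[OF C continuous_map_mult_left])
         (auto simp: distrib_left)
    then have "C \<subseteq> {y. x * y \<in> C}" by (rule least) (use SC mult that in blast)
    then show ?thesis using that by blast
  qed
  have CCC: "x * y \<in> C" if "x \<in> C" "y \<in> C" for x y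
  proof -
    have "closed_csubspace {x. x * y \<in> C}"
      by (rule closed_csubspace_vimage[OF C continuous_map_mult_right])
         (auto simp: distrib_right)
    then have "C \<subseteq> {x. x * y \<in> C}" by (rule least) (use SCC that in blast)
    then show ?thesis using that by blast
  qed
  have adjC: "adj x \<in> C" if "x \<in> C" for x
  proof -
    have "closed_csubspace {x. adj x \<in> C}"
      by (rule closed_csubspace_vimage[OF C continuous_map_adj]) auto
    then have "C \<subseteq> {x. adj x \<in> C}" by (rule least) (use SC adj in blast)
    then show ?thesis using that by blast
  qed
  have "von_neumann_algebra C"
    using C SC one CCC adjC unfolding von_neumann_algebra_def closed_csubspace_def by blast
  then have "vn_generated S \<subseteq> C" using SC by (rule vn_generated_least)
  then show ?thesis using least[OF W] by blast
qed

subsection \<open>Normal homomorphisms\<close>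

lemma normal_homD:
  assumes "normal_hom N P f"
  shows "f \<in> N \<rightarrow>\<^sub>E P" "\<And>x. x \<in> N \<Longrightarrow> f x \<in> P" "\<And>x y. x \<in> N \<Longrightarrow> y \<in> N \<Longrightarrow> f (x + y) = f x + f y"
    "\<And>c x. x \<in> N \<Longrightarrow> f (scale_op c x) = scale_op c (f x)"
    "continuous_map (subtopology ultraweak N) ultraweak f"
    "f 1 = 1" "\<And>x y. x \<in> N \<Longrightarrow> y \<in> N \<Longrightarrow> f (x * y) = f x * f y"
    "\<And>x. x \<in> N \<Longrightarrow> f (adj x) = adj (f x)"
  using assms unfolding normal_hom_def linear_on_def normal_on_def by (blast dest: PiE_mem)+

lemma normal_hom_zero:
  assumes "von_neumann_algebra N" "normal_hom N P f" shows "f 0 = 0"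
  using normal_homD(4)[OF assms(2) von_neumann_algebra_zero[OF assms(1)], of 0] by simp

lemma normal_hom_compose:
  assumes N: "von_neumann_algebra N" and f: "normal_hom N P f" and g: "normal_hom P Q g"
  shows "normal_hom N Q (compose N g f)"
proof -
  note f' = normal_homD[OF f] and g' = normal_homD[OF g]
  have "continuous_map (subtopology ultraweak N) (subtopology ultraweak P) f"
    using f'(5,2) by (auto simp: continuous_map_in_subtopology)
  then have c: "continuous_map (subtopology ultraweak N) ultraweak (\<lambda>x. g (f x))"
    using continuous_map_compose[OF _ g'(5)] by (auto simp: o_def)
  have "continuous_map (subtopology ultraweak N) ultraweak (compose N g f)"
    by (rule continuous_map_eq[OF c]) (simp add: compose_def)
  moreover have "compose N g f \<in> N \<rightarrow>\<^sub>E Q" using f'(2) g'(2) by (simp add: compose_def)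
  ultimately show ?thesis
    using f'(2-4,6-8) g'(2-4,6-8) N
    by (simp add: normal_hom_def linear_on_def normal_on_def compose_def von_neumann_algebraD)
qed

text \<open>The equaliser of two normal homomorphisms is itself a von Neumann algebra; it is closed
  because the target topology is Hausdorff and \<open>N\<close> is closed.\<close>

lemma normal_hom_eq_on_vn_generated:
  assumes N: "von_neumann_algebra N" and f: "normal_hom N P f" and g: "normal_hom N Q g"
    and S: "S \<subseteq> N" "\<And>x. x \<in> S \<Longrightarrow> f x = g x" and x: "x \<in> vn_generated S"
  shows "f x = g x"
proof -
  note f' = normal_homD[OF f] and g' = normal_homD[OF g] and N' = von_neumann_algebraD[OF N]
  have "closedin (subtopology ultraweak N) {x \<in> topspace (subtopology ultraweak N). f x = g x}"
    by (rule closedin_continuous_maps_eq[OF Hausdorff_ultraweak f'(5) g'(5)])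
  then have "closedin ultraweak {x \<in> N. f x = g x}"
    using N'(6) by (auto intro: closedin_trans_full)
  then have "von_neumann_algebra {x \<in> N. f x = g x}"
    using N' f' g' by (simp add: von_neumann_algebra_def)
  then have "vn_generated S \<subseteq> {x \<in> N. f x = g x}"
    by (rule vn_generated_least) (use S in blast)
  then show ?thesis using x by blast
qed

lemma extensional_eqI:
  assumes "f \<in> N \<rightarrow>\<^sub>E P" "g \<in> N \<rightarrow>\<^sub>E Q" "\<And>x. x \<in> N \<Longrightarrow> f x = g x"
  shows "f = g"
  using assms by (intro extensionalityI[of f N g]) (auto simp: PiE_def)

lemma EndoD:
  assumes "\<rho> \<in> Endo N"
  shows "\<And>x. x \<in> N \<Longrightarrow> \<rho> x \<in> N" "\<And>x y. x \<in> N \<Longrightarrow> y \<in> N \<Longrightarrow> \<rho> (x + y) = \<rho> x + \<rho> y"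
    "\<And>c x. x \<in> N \<Longrightarrow> \<rho> (scale_op c x) = scale_op c (\<rho> x)" "\<rho> 1 = 1"
    "\<And>x y. x \<in> N \<Longrightarrow> y \<in> N \<Longrightarrow> \<rho> (x * y) = \<rho> x * \<rho> y"
    "\<And>x. x \<in> N \<Longrightarrow> \<rho> (adj x) = adj (\<rho> x)" "\<rho> \<in> N \<rightarrow>\<^sub>E N" "normal_hom N N \<rho>"
  using assms normal_homD[of N N \<rho>] by (simp_all add: Endo_def)

lemma Endo_compose:
  "von_neumann_algebra N \<Longrightarrow> \<rho> \<in> Endo N \<Longrightarrow> \<sigma> \<in> Endo N \<Longrightarrow> compose N \<rho> \<sigma> \<in> Endo N"
  by (simp add: Endo_def normal_hom_compose)

lemma Endo_id_on: "von_neumann_algebra N \<Longrightarrow> id_on N \<in> Endo N"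
  by (auto simp: Endo_def normal_hom_def id_on_def linear_on_def normal_on_def
      von_neumann_algebraD intro: continuous_map_eq[of _ _ "\<lambda>x. x"]
      continuous_map_from_subtopology)

lemma intertwinersD:
  assumes "T \<in> intertwiners N \<rho> \<sigma>"
  shows "T \<in> N" "\<And>x. x \<in> N \<Longrightarrow> T * \<rho> x = \<sigma> x * T"
  using assms by (auto simp: intertwiners_def)

lemma compose_app [simp]: "x \<in> N \<Longrightarrow> compose N f g x = f (g x)"
  by (simp add: compose_def)

lemma id_on_app [simp]: "x \<in> N \<Longrightarrow> id_on N x = x"
  by (simp add: id_on_def)

section \<open>Finite index under composition and conjugation\<close>

lemma Endo0D: "\<rho> \<in> Endo0 N \<Longrightarrow> \<rho> \<in> Endo N"
  by (simp add: Endo0_def)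

text \<open>The conjugate of a product is the product of the conjugates in reverse order. Its
  solution nests one given solution inside the other, which is the origin of \<open>Q\<close> and
  \<open>Q'\<close>, and the normalising scalars multiply.\<close>

lemma Endo0_compose:
  assumes N: "von_neumann_algebra N" and \<rho>: "\<rho> \<in> Endo0 N" and \<sigma>: "\<sigma> \<in> Endo0 N"
  shows "compose N \<rho> \<sigma> \<in> Endo0 N"
proof -
  obtain \<rho>' R R' d where c: "conjugate_solution N \<rho> \<rho>' R R' d"
    using \<rho> by (auto simp: Endo0_def conjugate_of_def)
  obtain \<sigma>' S S' e where s: "conjugate_solution N \<sigma> \<sigma>' S S' e"
    using \<sigma> by (auto simp: Endo0_def conjugate_of_def)
  note N' = von_neumann_algebraD[OF N]
  have E: "\<rho> \<in> Endo N" "\<rho>' \<in> Endo N" "\<sigma> \<in> Endo N" "\<sigma>' \<in> Endo N"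
    using c s by (auto simp: conjugate_solution_def)
  note r = EndoD[OF E(1)] and r' = EndoD[OF E(2)] and q = EndoD[OF E(3)] and q' = EndoD[OF E(4)]
  have RN: "R \<in> N" "R' \<in> N" "S \<in> N" "S' \<in> N"
    using c s by (auto simp: conjugate_solution_def intertwiners_def)
  have RI: "R * x = \<rho>' (\<rho> x) * R" "R' * x = \<rho> (\<rho>' x) * R'"
    "S * x = \<sigma>' (\<sigma> x) * S" "S' * x = \<sigma> (\<sigma>' x) * S'" if "x \<in> N" for x
    using c s that by (auto simp: conjugate_solution_def intertwiners_def)
  have eq: "adj R * R = scale_op (complex_of_real d) 1" "adj R' * R' = scale_op (complex_of_real d) 1"
    "adj R * \<rho>' R' = 1" "adj R' * \<rho> R = 1"
    "adj S * S = scale_op (complex_of_real e) 1" "adj S' * S' = scale_op (complex_of_real e) 1"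
    "adj S * \<sigma>' S' = 1" "adj S' * \<sigma> S = 1"
    using c s by (auto simp: conjugate_solution_def)
  define Q where "Q = \<sigma>' R * S"
  define Q' where "Q' = \<rho> S' * R'"
  have QN: "Q \<in> N" "Q' \<in> N" using RN r q' N' by (simp_all add: Q_def Q'_def)
  have "Q * x = \<sigma>' (\<rho>' (\<rho> (\<sigma> x))) * Q" if x: "x \<in> N" for x
  proof -
    have "Q * x = \<sigma>' R * \<sigma>' (\<sigma> x) * S"
      by (simp add: Q_def mult.assoc RI x)
    also have "\<sigma>' R * \<sigma>' (\<sigma> x) = \<sigma>' (\<rho>' (\<rho> (\<sigma> x))) * \<sigma>' R"
      using q'(5)[of R "\<sigma> x"] q'(5)[of "\<rho>' (\<rho> (\<sigma> x))" R] RI(1)[of "\<sigma> x"] x RN q(1) r(1) r'(1)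
      by metis
    finally show ?thesis by (simp add: Q_def mult.assoc)
  qed
  moreover have "Q' * x = \<rho> (\<sigma> (\<sigma>' (\<rho>' x))) * Q'" if x: "x \<in> N" for x
  proof -
    have "Q' * x = \<rho> S' * \<rho> (\<rho>' x) * R'"
      by (simp add: Q'_def mult.assoc RI x)
    also have "\<rho> S' * \<rho> (\<rho>' x) = \<rho> (\<sigma> (\<sigma>' (\<rho>' x))) * \<rho> S'"
      using r(5)[of S' "\<rho>' x"] r(5)[of "\<sigma> (\<sigma>' (\<rho>' x))" S'] RI(4)[of "\<rho>' x"] x RN q(1) q'(1) r'(1)
      by metis
    finally show ?thesis by (simp add: Q'_def mult.assoc)
  qed
  moreover have "adj Q * Q = scale_op (complex_of_real (d * e)) 1"
  proof -
    have "adj Q * Q = adj S * (\<sigma>' (adj R) * \<sigma>' R) * S"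
      using RN by (simp add: Q_def mult.assoc q'(6))
    also have "\<sigma>' (adj R) * \<sigma>' R = scale_op (complex_of_real d) 1"
      using RN N' q'(5)[of "adj R" R] q'(3)[of 1 "complex_of_real d"] by (simp add: eq q'(4))
    finally show ?thesis by (simp add: eq)
  qed
  moreover have "adj Q' * Q' = scale_op (complex_of_real (d * e)) 1"
  proof -
    have "adj Q' * Q' = adj R' * (\<rho> (adj S') * \<rho> S') * R'"
      using RN by (simp add: Q'_def mult.assoc r(6))
    also have "\<rho> (adj S') * \<rho> S' = scale_op (complex_of_real e) 1"
      using RN N' r(5)[of "adj S'" S'] r(3)[of 1 "complex_of_real e"] by (simp add: eq r(4))
    finally show ?thesis by (simp add: eq mult.commute)
  qed
  \<comment> \<open>Zigzag of the nested pair: moving \<open>adj S'\<close> through \<open>R\<close>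
    by the intertwining relation leaves \<open>adj R * \<rho>' R' = 1\<close> inside, and then
    \<open>adj S * \<sigma>' S' = 1\<close> outside.\<close>
  moreover have "adj Q * \<sigma>' (\<rho>' Q') = 1"
  proof -
    have "adj Q * \<sigma>' (\<rho>' Q') = adj S * \<sigma>' (adj R * \<rho>' (\<rho> S' * R'))"
      using RN N' q'(5)[of "adj R" "\<rho>' (\<rho> S' * R')"]
      by (simp add: Q_def Q'_def mult.assoc q'(6) r(1) r'(1) q'(1))
    also have "adj R * \<rho>' (\<rho> S' * R') = adj (\<rho>' (\<rho> (adj S')) * R) * \<rho>' R'"
      using RN N' by (simp add: r r' mult.assoc)
    also have "\<rho>' (\<rho> (adj S')) * R = R * adj S'"
      using RI(1)[of "adj S'"] RN N' by simp
    also have "adj (R * adj S') * \<rho>' R' = S'"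
      by (simp add: mult.assoc eq)
    finally show ?thesis by (simp add: eq)
  qed
  moreover have "adj Q' * \<rho> (\<sigma> Q) = 1"
  proof -
    have "adj Q' * \<rho> (\<sigma> Q) = adj R' * \<rho> (adj S' * \<sigma> (\<sigma>' R * S))"
      using RN N' r(5)[of "adj S'" "\<sigma> (\<sigma>' R * S)"]
      by (simp add: Q_def Q'_def mult.assoc r(6) r(1) q(1) q'(1))
    also have "adj S' * \<sigma> (\<sigma>' R * S) = adj (\<sigma> (\<sigma>' (adj R)) * S') * \<sigma> S"
      using RN N' by (simp add: q q' mult.assoc)
    also have "\<sigma> (\<sigma>' (adj R)) * S' = S' * adj R"
      using RI(4)[of "adj R"] RN N' by simp
    also have "adj (S' * adj R) * \<sigma> S = R"
      by (simp add: mult.assoc eq)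
    finally show ?thesis by (simp add: eq)
  qed
  ultimately have "conjugate_solution N (compose N \<rho> \<sigma>) (compose N \<sigma>' \<rho>') Q Q' (d * e)"
    using QN N r(1) q(1) r'(1) q'(1) Endo_compose[OF N E(1,3)] Endo_compose[OF N E(4,2)]
    by (simp add: conjugate_solution_def intertwiners_def)
  then show ?thesis
    unfolding Endo0_def conjugate_of_def using Endo_compose[OF N E(1,3)] by blast
qed

text \<open>An automorphism has its inverse as conjugate, with both solutions and the scalar equal
  to 1. This is what keeps k[\<theta>] of finite index.\<close>

lemma Endo0_conjugate_by_inverse_pair:
  assumes N: "von_neumann_algebra N" and \<rho>: "\<rho> \<in> Endo0 N"
    and \<alpha>: "\<alpha> \<in> Endo N" and \<beta>: "\<beta> \<in> Endo N"
    and inv: "\<And>x. x \<in> N \<Longrightarrow> \<alpha> (\<beta> x) = x" "\<And>x. x \<in> N \<Longrightarrow> \<beta> (\<alpha> x) = x"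
  shows "compose N \<alpha> (compose N \<rho> \<beta>) \<in> Endo0 N"
proof -
  have "conjugate_solution N \<alpha> \<beta> 1 1 1" "conjugate_solution N \<beta> \<alpha> 1 1 1"
    using \<alpha> \<beta> inv von_neumann_algebraD(1)[OF N] EndoD(4)[OF \<alpha>] EndoD(4)[OF \<beta>]
    by (simp_all add: conjugate_solution_def intertwiners_def)
  then have "\<alpha> \<in> Endo0 N" "\<beta> \<in> Endo0 N"
    using \<alpha> \<beta> unfolding Endo0_def conjugate_of_def by blast+
  then show ?thesis using \<rho> N by (simp add: Endo0_compose)
qed

section \<open>Tensor products\<close>

text \<open>A bounded linear relation with dense domain is the graph of an operator once it is closed.\<close>

lemma bop_of_bounded_relation:
  fixes R :: "('t::chilbert_space \<times> 't) set"
  assumes sub: "subspace R" and scale: "\<And>a b c. (a, b) \<in> R \<Longrightarrow> (c *\<^sub>C a, c *\<^sub>C b) \<in> R"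
    and bound: "\<And>a b. (a, b) \<in> R \<Longrightarrow> norm b \<le> K * norm a"
    and dense: "closure (fst ` R) = UNIV"
  shows "\<exists>F. \<forall>(a, b)\<in>R. app F a = b"
proof -
  define C where "C = closure R"
  have subC: "subspace C"
    unfolding subspace_def
  proof (intro conjI ballI allI)
    show "0 \<in> C" unfolding C_def using sub closure_subset[of R] by (auto simp: subspace_def)
    show "x + y \<in> C" if "x \<in> C" "y \<in> C" for x y
    proof -
      from \<open>x \<in> C\<close> \<open>y \<in> C\<close> obtain p q where pq:
        "\<forall>n. p n \<in> R" "p \<longlonglongrightarrow> x" "\<forall>n. q n \<in> R" "q \<longlonglongrightarrow> y"
        unfolding C_def closure_sequential by metis
      from pq(1,3) have "\<forall>n. p n + q n \<in> R" using sub by (simp add: subspace_def)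
      moreover from pq(2,4) have "(\<lambda>n. p n + q n) \<longlonglongrightarrow> x + y" by (rule tendsto_add)
      ultimately have "(\<forall>n. p n + q n \<in> R) \<and> (\<lambda>n. p n + q n) \<longlonglongrightarrow> x + y" ..
      then show ?thesis unfolding C_def closure_sequential by (intro exI)
    qed
    show "scaleR c x \<in> C" if "x \<in> C" for c x
    proof -
      from \<open>x \<in> C\<close> obtain p where p: "\<forall>n. p n \<in> R" "p \<longlonglongrightarrow> x"
        unfolding C_def closure_sequential by metis
      from p(1) have "\<forall>n. scaleR c (p n) \<in> R" using sub by (simp add: subspace_def)
      moreover from p(2) have "(\<lambda>n. scaleR c (p n)) \<longlonglongrightarrow> scaleR c x"
        by (rule tendsto_scaleR[OF tendsto_const])
      ultimately have "(\<forall>n. scaleR c (p n) \<in> R) \<and> (\<lambda>n. scaleR c (p n)) \<longlonglongrightarrow> scaleR c x" ..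
      then show ?thesis unfolding C_def closure_sequential by (intro exI)
    qed
  qed
  have "C \<subseteq> {p. norm (snd p) \<le> K * norm (fst p)}"
    unfolding C_def
    by (rule closure_minimal)
       (use bound in \<open>auto intro!: closed_Collect_le continuous_intros\<close>)
  then have boundC: "norm b \<le> K * norm a" if "(a, b) \<in> C" for a b using that by auto
  have scaleC: "(c *\<^sub>C a, c *\<^sub>C b) \<in> C" if "(a, b) \<in> C" for a b c
  proof -
    obtain s where s: "\<And>n. s n \<in> R" "s \<longlonglongrightarrow> (a, b)"
      using \<open>(a, b) \<in> C\<close> unfolding C_def closure_sequential by blast
    have bl: "bounded_linear (\<lambda>x. c *\<^sub>C (x :: 't))"
      using bounded_linear_app[of "scale_op c 1"] by simp
    have "(\<lambda>n. (c *\<^sub>C fst (s n), c *\<^sub>C snd (s n))) \<longlonglongrightarrow> (c *\<^sub>C a, c *\<^sub>C b)"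
      using tendsto_fst[OF s(2)] tendsto_snd[OF s(2)]
      by (intro tendsto_Pair bounded_linear.tendsto[OF bl]) simp_all
    moreover have "\<forall>n. (c *\<^sub>C fst (s n), c *\<^sub>C snd (s n)) \<in> R"
      using s(1) by (intro allI scale) simp
    ultimately show ?thesis unfolding C_def closure_sequential
      by (intro exI[of _ "\<lambda>n. (c *\<^sub>C fst (s n), c *\<^sub>C snd (s n))"]) simp
  qed
  \<comment> \<open>Linearity puts (0, b - b') into \<open>C\<close>, where the norm bound leaves
    only b = b'.\<close>
  have unique: "b = b'" if "(a, b) \<in> C" "(a, b') \<in> C" for a b b'
    using boundC[of 0 "b - b'"] subspace_diff[OF subC that] by simp
  have total: "\<exists>b. (a, b) \<in> C" for a
  proof -
    have "a \<in> closure (fst ` R)" using dense by simp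
    then obtain s where s: "\<And>n. s n \<in> fst ` R" "s \<longlonglongrightarrow> a"
      unfolding closure_sequential by blast
    then have "\<forall>n. \<exists>y. (s n, y) \<in> R" by force
    then obtain y where y: "\<And>n. (s n, y n) \<in> R" by metis
    have diff: "norm (y m - y n) \<le> K * norm (s m - s n)" for m n
      using bound subspace_diff[OF sub y[of m] y[of n]] by simp
    have "Cauchy y"
    proof (rule metric_CauchyI)
      fix e :: real assume "0 < e"
      have "Cauchy s" using s(2) by (rule LIMSEQ_imp_Cauchy)
      then obtain M where M: "\<And>m n. M \<le> m \<Longrightarrow> M \<le> n \<Longrightarrow> norm (s m - s n) < e / (\<bar>K\<bar> + 1)"
        using \<open>0 < e\<close> unfolding Cauchy_def dist_norm
        by (metis divide_pos_pos abs_ge_zero add_nonneg_pos zero_less_one)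
      have "norm (y m - y n) < e" if "M \<le> m" "M \<le> n" for m n
      proof -
        have "norm (y m - y n) \<le> (\<bar>K\<bar> + 1) * norm (s m - s n)"
          using diff[of m n] by (rule order_trans) (simp add: mult_right_mono)
        also have "\<dots> < (\<bar>K\<bar> + 1) * (e / (\<bar>K\<bar> + 1))"
          by (rule mult_strict_left_mono[OF M[OF that]]) simp
        finally show ?thesis by simp
      qed
      then show "\<exists>M. \<forall>m\<ge>M. \<forall>n\<ge>M. dist (y m) (y n) < e"
        unfolding dist_norm by blast
    qed
    then obtain b where "y \<longlonglongrightarrow> b" using Cauchy_convergent convergent_def by blast
    then have "(\<lambda>n. (s n, y n)) \<longlonglongrightarrow> (a, b)" using s(2) by (intro tendsto_Pair)
    then show ?thesis using y unfolding C_def closure_sequential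
      by (intro exI[of _ b] exI[of _ "\<lambda>n. (s n, y n)"]) simp
  qed
  define f where "f a = (SOME b. (a, b) \<in> C)" for a
  have f: "(a, f a) \<in> C" for a unfolding f_def using total by (rule someI_ex)
  have f_eq: "f a = b" if "(a, b) \<in> C" for a b using unique[OF f that] .
  have "bounded_linear f"
  proof (rule bounded_linear_intro[where K = K])
    show "f (x + y) = f x + f y" for x y
      using subspace_add[OF subC f[of x] f[of y]] by (intro f_eq) simp
    show "f (scaleR r x) = scaleR r (f x)" for r x
      using subspace_scale[OF subC f[of x], of r] by (intro f_eq) simp
    show "norm (f x) \<le> norm x * K" for x
      using boundC[OF f[of x]] by (simp add: mult.commute)
  qed
  moreover have "f (c *\<^sub>C x) = c *\<^sub>C f x" for c x by (intro f_eq scaleC f)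
  ultimately have "app (Bop f) = f" by (simp add: Bop_inverse)
  moreover have "f a = b" if "(a, b) \<in> R" for a b
    using that closure_subset[of R] by (intro f_eq) (auto simp: C_def)
  ultimately show ?thesis by (intro exI[of _ "Bop f"]) auto
qed

lemma hilbert_tensorD:
  assumes "hilbert_tensor t"
  shows "t (u + u') v = t u v + t u' v" "t u (v + v') = t u v + t u v'"
    "t (c *\<^sub>C u) v = c *\<^sub>C t u v" "t u (c *\<^sub>C v) = c *\<^sub>C t u v"
    "cinner (t u v) (t u' v') = cinner u u' * cinner v v'"
    "closure (span {t u v | u v. True}) = UNIV"
  using assms unfolding hilbert_tensor_def by blast+

text \<open>Exchanging the legs lets results about the first leg be reused for the second: for 1
  \<otimes> y and for slices over the second leg.\<close>

lemma hilbert_tensor_flip: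
  assumes "hilbert_tensor t" shows "hilbert_tensor (\<lambda>v u. t u v)"
proof -
  have "{t u v | v u. True} = {t u v | u v. True}" by blast
  then show ?thesis
    using hilbert_tensorD[OF assms] unfolding hilbert_tensor_def by (simp add: mult.commute)
qed

context
  fixes t :: "'a::chilbert_space \<Rightarrow> 'b::chilbert_space \<Rightarrow> 't::chilbert_space"
  assumes ht: "hilbert_tensor t"
begin

private lemmas htD = hilbert_tensorD[OF ht]

lemma tensor_zero_left [simp]: "t 0 v = 0"
  using htD(1)[of 0 0 v] by simp

lemma tensor_zero_right [simp]: "t u 0 = 0"
  using htD(2)[of u 0 0] by simp

lemma tensor_sum_right: "t u (\<Sum>i\<in>I. f i) = (\<Sum>i\<in>I. t u (f i))"
  by (induction I rule: infinite_finite_induct) (auto simp: htD(2))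

lemma norm_tensor: "norm (t u v) = norm u * norm v"
proof -
  have "complex_of_real ((norm (t u v))\<^sup>2) = complex_of_real ((norm u * norm v)\<^sup>2)"
    using htD(5)[of u v u v] by (simp add: cinner_self power_mult_distrib)
  then show ?thesis
    by (simp only: of_real_eq_iff) (simp add: power2_eq_iff_nonneg)
qed

lemma tensor_bop_eqI:
  assumes "\<And>u v. app S (t u v) = app T (t u v)" shows "S = T"
proof (rule bop_eqI)
  fix w
  have "span {t u v | u v. True} \<subseteq> {w. app S w = app T w}"
    by (rule span_minimal)
       (use assms in \<open>auto simp: subspace_def app_add_right scaleR_scaleC app_scaleC\<close>)
  moreover have "closed {w. app S w = app T w}"
    by (intro closed_Collect_eq linear_continuous_on bounded_linear_app)
  ultimately have "closure (span {t u v | u v. True}) \<subseteq> {w. app S w = app T w}"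
    by (rule closure_minimal)
  then show "app S w = app T w" using htD(6) by blast
qed

lemma tensor_cinner_eqI:
  assumes "\<And>u v u' v'. cinner (t u v) (app S (t u' v')) = cinner (t u v) (app T (t u' v'))"
  shows "S = T"
proof (rule tensor_bop_eqI)
  fix u' v'
  define z where "z = app S (t u' v') - app T (t u' v')"
  have "span {t u v | u v. True} \<subseteq> {w. cinner w z = 0}"
    by (rule span_minimal)
       (use assms in \<open>auto simp: subspace_def cinner_add_left cinner_scaleR_left z_def cinner_diff_right\<close>)
  moreover have "closed {w. cinner w z = 0}"
  proof -
    have "bounded_linear (\<lambda>w. cinner w z)"
      by (rule bounded_linear_intro[where K = "norm z"])
         (simp_all add: cinner_add_left cinner_scaleR_left scaleR_conv_of_real cauchy_schwarz)
    then show ?thesis by (intro closed_Collect_eq linear_continuous_on) simp_all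
  qed
  ultimately have "closure (span {t u v | u v. True}) \<subseteq> {w. cinner w z = 0}"
    by (rule closure_minimal)
  then have "cinner z z = 0" using htD(6) by blast
  then show "app S (t u' v') = app T (t u' v')" by (simp add: cinner_self z_def)
qed

text \<open>With orthonormal second legs the norm bound for \<open>x \<otimes> 1\<close> is Pythagoras.\<close>

lemma orthonormal_representation:
  assumes "(a, b) \<in> span {(t u v, t (app x u) v) | u v. True}"
  shows "\<exists>E f. finite E \<and> (\<forall>e\<in>E. \<forall>e'\<in>E. cinner e e' = (if e = e' then 1 else 0)) \<and>
    a = (\<Sum>e\<in>E. t (f e) e) \<and> b = (\<Sum>e\<in>E. t (app x (f e)) e)"
proof -
  define Q where "Q p \<longleftrightarrow> (\<exists>E f. finite E \<and>
    (\<forall>e\<in>E. \<forall>e'\<in>E. cinner e e' = (if e = e' then 1 else 0)) \<and>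
    fst p = (\<Sum>e\<in>E. t (f e) e) \<and> snd p = (\<Sum>e\<in>E. t (app x (f e)) e))" for p
  have "Q (a, b)"
    using assms
  proof (induction rule: span_induct_alt)
    case base
    show ?case unfolding Q_def by (rule exI[of _ "{}"]) simp
  next
    case (step c p q)
    then obtain u0 v where p: "p = (t u0 v, t (app x u0) v)" by blast
    define u where "u = of_real c *\<^sub>C u0"
    have cp: "scaleR c p = (t u v, t (app x u) v)"
      by (simp add: p u_def htD scaleR_scaleC app_scaleC)
    obtain E f where E: "finite E" "\<And>e e'. e \<in> E \<Longrightarrow> e' \<in> E \<Longrightarrow> cinner e e' = (if e = e' then 1 else 0)"
      "fst q = (\<Sum>e\<in>E. t (f e) e)" "snd q = (\<Sum>e\<in>E. t (app x (f e)) e)"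
      using step.IH unfolding Q_def by blast
    \<comment> \<open>Gram-Schmidt: \<open>r\<close> is the part of \<open>v\<close> orthogonal to
      \<open>E\<close>. The rest of \<open>v\<close> is absorbed into the coefficients
      \<open>g\<close>; a nonzero \<open>r\<close> contributes the new unit vector
      \<open>e0\<close>. Since \<open>x\<close> acts on coefficients only, both entries of the pair
      change in step.\<close>
    define r where "r = v - (\<Sum>e\<in>E. cinner e v *\<^sub>C e)"
    define g where "g e = f e + cinner e v *\<^sub>C u" for e
    have v: "v = (\<Sum>e\<in>E. cinner e v *\<^sub>C e) + r" by (simp add: r_def)
    have tv: "t w v = (\<Sum>e\<in>E. cinner e v *\<^sub>C t w e) + t w r" for w
      by (subst v) (simp add: htD tensor_sum_right)
    have sums: "fst (scaleR c p + q) = (\<Sum>e\<in>E. t (g e) e) + t u r"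
      "snd (scaleR c p + q) = (\<Sum>e\<in>E. t (app x (g e)) e) + t (app x u) r"
      unfolding cp fst_add snd_add E(3,4) fst_conv snd_conv tv g_def
      by (simp_all add: htD app_add_right app_scaleC sum.distrib)
    show ?case
    proof (cases "r = 0")
      case True
      then show ?thesis unfolding Q_def using E(1,2) sums
        by (intro exI[of _ E] exI[of _ g]) simp
    next
      case False
      have orth: "cinner e r = 0" if "e \<in> E" for e
      proof -
        have "(\<Sum>e'\<in>E. cinner e (cinner e' v *\<^sub>C e')) = (\<Sum>e'\<in>E. if e = e' then cinner e' v else 0)"
          by (rule sum.cong) (auto simp: cinner_scaleC_right E(2) that)
        then show ?thesis
          using E(1) that by (simp add: r_def cinner_diff_right cinner_sum_right)
      qed
      define e0 where "e0 = scaleR (1 / norm r) r"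
      have r: "r = of_real (norm r) *\<^sub>C e0"
        using False by (simp add: e0_def scaleR_scaleC[symmetric])
      have e0: "cinner e0 e0 = 1"
        using False by (simp add: e0_def cinner_self)
      have oe: "cinner e e0 = 0" "cinner e0 e = 0" if "e \<in> E" for e
        using orth[OF that] cinner_commute[of r e]
        by (simp_all add: e0_def cinner_scaleR_left cinner_scaleR_right)
      have "e0 \<notin> E" using e0 oe by auto
      define h where "h = g(e0 := of_real (norm r) *\<^sub>C u)"
      have h: "h e = g e" if "e \<in> E" for e using \<open>e0 \<notin> E\<close> that by (auto simp: h_def)
      have he0: "h e0 = of_real (norm r) *\<^sub>C u" by (simp add: h_def)
      have tr: "t w r = t (of_real (norm r) *\<^sub>C w) e0" for w
        by (subst r) (simp add: htD)
      have "fst (scaleR c p + q) = (\<Sum>e\<in>insert e0 E. t (h e) e)"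
        "snd (scaleR c p + q) = (\<Sum>e\<in>insert e0 E. t (app x (h e)) e)"
        unfolding sums using E(1) \<open>e0 \<notin> E\<close>
        by (simp_all add: h he0 tr app_scaleC cong: sum.cong)
      moreover have "\<forall>e\<in>insert e0 E. \<forall>e'\<in>insert e0 E. cinner e e' = (if e = e' then 1 else 0)"
        using E(2) e0 oe \<open>e0 \<notin> E\<close> by auto
      ultimately show ?thesis unfolding Q_def using E(1)
        by (intro exI[of _ "insert e0 E"] exI[of _ h]) simp
    qed
  qed
  then show ?thesis by (simp add: Q_def)
qed

text \<open>The operator x \<otimes> 1 starts as a relation, because a vector has many expressions
  as a sum of elementary tensors. Well-definedness and boundedness then come together from one norm
  estimate.\<close>

lemma tensor_left_exists: "\<exists>F. \<forall>u v. app F (t u v) = t (app x u) v"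
proof -
  define S where "S = {(t u v, t (app x u) v) | u v. True}"
  obtain K where K: "0 \<le> K" "\<And>u. norm (app x u) \<le> K * norm u" using app_bounded by blast
  have scale: "(c *\<^sub>C a, c *\<^sub>C b) \<in> span S" if "(a, b) \<in> span S" for a b c
  proof -
    have "(c *\<^sub>C fst p, c *\<^sub>C snd p) \<in> span S" if "p \<in> span S" for p
      using that
    proof (induction rule: span_induct_alt)
      case base then show ?case by (simp flip: zero_prod_def add: span_zero)
    next
      case (step d p q)
      then obtain u v where p: "p = (t u v, t (app x u) v)" by (auto simp: S_def)
      have "(t (c *\<^sub>C of_real d *\<^sub>C u) v, t (app x (c *\<^sub>C of_real d *\<^sub>C u)) v) \<in> span S"
        by (rule span_base) (auto simp: S_def)
      from span_add[OF this step.IH] show ?case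
        by (simp add: p htD app_scaleC scaleR_scaleC scaleC_add_right)
    qed
    from this[OF that] show ?thesis by simp
  qed
  have bound: "norm b \<le> K * norm a" if ab: "(a, b) \<in> span S" for a b
  proof -
    obtain E f where E: "finite E" "\<And>e e'. e \<in> E \<Longrightarrow> e' \<in> E \<Longrightarrow> cinner e e' = (if e = e' then 1 else 0)"
      and a: "a = (\<Sum>e\<in>E. t (f e) e)" and b: "b = (\<Sum>e\<in>E. t (app x (f e)) e)"
      using orthonormal_representation[OF ab[unfolded S_def]] by blast
    have norm: "(norm (\<Sum>e\<in>E. t (h e) e))\<^sup>2 = (\<Sum>e\<in>E. (norm (h e))\<^sup>2)" for h
    proof -
      have "cinner (\<Sum>e\<in>E. t (h e) e) (\<Sum>e\<in>E. t (h e) e)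
        = (\<Sum>e\<in>E. \<Sum>e'\<in>E. cinner (h e) (h e') * cinner e e')"
        by (simp add: cinner_sum_left cinner_sum_right htD) (rule sum.swap)
      also have "\<dots> = (\<Sum>e\<in>E. \<Sum>e'\<in>E. if e = e' then cinner (h e) (h e') else 0)"
        by (intro sum.cong) (auto simp: E(2))
      also have "\<dots> = (\<Sum>e\<in>E. cinner (h e) (h e))"
        using E(1) by simp
      finally show ?thesis
        by (simp add: norm_power2_cinner)
    qed
    have "(norm b)\<^sup>2 = (\<Sum>e\<in>E. (norm (app x (f e)))\<^sup>2)" unfolding b by (rule norm)
    also have "\<dots> \<le> (\<Sum>e\<in>E. K\<^sup>2 * (norm (f e))\<^sup>2)"
      using power_mono[OF K(2), of _ 2] by (intro sum_mono) (simp add: power_mult_distrib)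
    also have "\<dots> = (K * norm a)\<^sup>2"
      unfolding a power_mult_distrib norm by (simp add: sum_distrib_left)
    finally show ?thesis
      by (rule power2_le_imp_le) (simp add: K(1))
  qed
  have "fst ` span S = span (fst ` S)"
    by (rule span_linear_image[symmetric]) (simp add: linear_fst)
  also have "fst ` S = {t u v | u v. True}" by (force simp: S_def)
  finally have "closure (fst ` span S) = UNIV" by (simp only: htD(6))
  from bop_of_bounded_relation[OF subspace_span scale bound this]
  obtain F where "\<forall>(a, b)\<in>span S. app F a = b" by blast
  moreover have "(t u v, t (app x u) v) \<in> span S" for u v
    by (rule span_base) (auto simp: S_def)
  ultimately show ?thesis by (intro exI[of _ F] allI) (metis (mono_tags, lifting) case_prodD)
qed

end

text \<open>The witness is the product of x \<otimes> 1 and 1 \<otimes> y, the latter obtained with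
  exchanged legs; totality of elementary tensors makes it the only one, which settles the definite
  description \<open>tensor_op\<close>.\<close>

lemma app_tensor_op:
  assumes ht: "hilbert_tensor t"
  shows "app (tensor_op t x y) (t u v) = t (app x u) (app y v)"
proof -
  obtain F where F: "\<And>u v. app F (t u v) = t (app x u) v"
    using tensor_left_exists[OF ht] by blast
  obtain G where G: "\<And>u v. app G (t u v) = t u (app y v)"
    using tensor_left_exists[OF hilbert_tensor_flip[OF ht]] by blast
  have ex: "\<forall>u v. app (F * G) (t u v) = t (app x u) (app y v)" by (simp add: F G)
  have "tensor_op t x y = F * G"
    unfolding tensor_op_def
    by (rule the_equality) (use ex in \<open>auto intro: tensor_bop_eqI[OF ht]\<close>)
  then show ?thesis using ex by simp
qed

text \<open>The slice \<open>(\<omega> \<otimes> id)(T)\<close> for the functional \<open>\<omega> = \<langle>u, \<cdot> u'\<rangle>\<close>.\<close>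

definition slice :: "('a::chilbert_space \<Rightarrow> 'b::chilbert_space \<Rightarrow> 't::chilbert_space) \<Rightarrow>
    'a \<Rightarrow> 'a \<Rightarrow> 't bop \<Rightarrow> 'b bop" where
  "slice t u u' T = (SOME S. \<forall>v v'. cinner v (app S v') = cinner (t u v) (app T (t u' v')))"

context
  fixes t :: "'a::chilbert_space \<Rightarrow> 'b::chilbert_space \<Rightarrow> 't::chilbert_space"
  assumes ht: "hilbert_tensor t"
begin

private lemmas tensorD = hilbert_tensorD[OF ht]
private lemmas top [simp] = app_tensor_op[OF ht]

lemma tensor_op_mult: "tensor_op t x y * tensor_op t x' y' = tensor_op t (x * x') (y * y')"
  by (rule tensor_bop_eqI[OF ht]) simp

lemma tensor_op_one: "tensor_op t 1 1 = 1"
  by (rule tensor_bop_eqI[OF ht]) simp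

lemma adj_tensor_op: "adj (tensor_op t x y) = tensor_op t (adj x) (adj y)"
  by (rule tensor_cinner_eqI[OF ht]) (simp add: tensorD cinner_adj_right)

lemma cinner_slice: "cinner v (app (slice t u u' T) v') = cinner (t u v) (app T (t u' v'))"
proof -
  obtain K where K: "0 \<le> K" "\<And>w. norm (app T w) \<le> K * norm w" using app_bounded by blast
  have "\<exists>S. \<forall>v v'. cinner v (app S v') = cinner (t u v) (app T (t u' v'))"
  proof (rule sesquilinear_bop)
    fix v v'
    have "cmod (cinner (t u v) (app T (t u' v'))) \<le> norm (t u v) * norm (app T (t u' v'))"
      by (rule cauchy_schwarz)
    also have "\<dots> \<le> norm (t u v) * (K * norm (t u' v'))"
      using K(2) by (intro mult_left_mono) simp_all
    finally show "cmod (cinner (t u v) (app T (t u' v'))) \<le> (K * norm u * norm u') * norm v * norm v'"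
      by (simp add: norm_tensor[OF ht] algebra_simps)
  qed (simp_all add: tensorD app_add_right app_scaleC cinner_add_left cinner_add_right
      cinner_scaleC_left cinner_scaleC_right)
  then have "\<forall>v v'. cinner v (app (slice t u u' T) v') = cinner (t u v) (app T (t u' v'))"
    unfolding slice_def by (rule someI_ex)
  then show ?thesis by blast
qed

lemma slice_eqI:
  assumes "\<And>u u'. slice t u u' S = slice t u u' T" shows "S = T"
  by (rule tensor_cinner_eqI[OF ht]) (metis assms cinner_slice)

lemma slice_add: "slice t u u' (S + T) = slice t u u' S + slice t u u' T"
  by (rule bop_cinner_eqI) (simp add: cinner_slice cinner_add_right)

lemma slice_scale: "slice t u u' (scale_op c T) = scale_op c (slice t u u' T)"
  by (rule bop_cinner_eqI) (simp add: cinner_slice cinner_scaleC_right)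

lemma slice_zero: "slice t u u' 0 = 0"
  by (rule bop_cinner_eqI) (simp add: cinner_slice)

lemma slice_tensor_op: "slice t u u' (tensor_op t x y) = scale_op (cinner u (app x u')) y"
  by (rule bop_cinner_eqI) (simp add: cinner_slice tensorD cinner_scaleC_right)

lemma slice_mult_right: "slice t u u' (T * tensor_op t 1 y) = slice t u u' T * y"
  by (rule bop_cinner_eqI) (simp add: cinner_slice)

lemma slice_mult_left: "slice t u u' (tensor_op t 1 y * T) = y * slice t u u' T"
proof (rule bop_cinner_eqI)
  fix v v'
  have "cinner v (app (slice t u u' (tensor_op t 1 y * T)) v')
    = cinner (app (adj (tensor_op t 1 y)) (t u v)) (app T (t u' v'))"
    by (simp add: cinner_slice cinner_adj_left)
  also have "\<dots> = cinner v (app (y * slice t u u' T) v')"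
    by (simp add: adj_tensor_op flip: cinner_slice) (simp add: cinner_adj_left)
  finally show "cinner v (app (slice t u u' (tensor_op t 1 y * T)) v') = \<dots>" .
qed

lemma continuous_map_slice: "continuous_map ultraweak ultraweak (slice t u u')"
proof (rule continuous_map_into_ultraweak)
  fix p q :: "nat \<Rightarrow> 'b" assume pq: "square_summable p" "square_summable q"
  have ss: "square_summable (\<lambda>n. t w (p n))" if "square_summable p" for w p
    using that unfolding square_summable_def
    by (simp add: norm_tensor[OF ht] power_mult_distrib summable_mult)
  show "continuous_map ultraweak euclidean (\<lambda>x. uw_functional p q (slice t u u' x))"
    using continuous_map_uw_functional[OF ss[OF pq(1), of u] ss[OF pq(2), of u']]
    by (simp add: uw_functional_def[abs_def] cinner_slice)
qed

text \<open>\<open>slice\<close> is linear and continuous but not multiplicative, so algebra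
  generators alone would not suffice. Elementary tensors form a *-monoid, however, whose closed span
  is already the whole algebra.\<close>

lemma slice_in_vn_tensor:
  assumes N: "von_neumann_algebra N" and P: "von_neumann_algebra P" and T: "T \<in> vn_tensor t N P"
  shows "slice t u u' T \<in> P"
proof -
  note N' = von_neumann_algebraD[OF N] and P' = von_neumann_algebraD[OF P]
  have "vn_tensor t N P \<subseteq> {T. slice t u u' T \<in> P}"
    unfolding vn_tensor_def
  proof (rule vn_generated_subset_closed_csubspace)
    show "1 \<in> {tensor_op t x y |x y. x \<in> N \<and> y \<in> P}"
      using N' P' tensor_op_one[symmetric] by blast
    show "x * y \<in> {tensor_op t x y |x y. x \<in> N \<and> y \<in> P}"
      if "x \<in> {tensor_op t x y |x y. x \<in> N \<and> y \<in> P}" "y \<in> {tensor_op t x y |x y. x \<in> N \<and> y \<in> P}" for x y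
    proof -
      obtain a b a' b' where "x = tensor_op t a b" "y = tensor_op t a' b'"
        "a \<in> N" "b \<in> P" "a' \<in> N" "b' \<in> P" using \<open>x \<in> _\<close> \<open>y \<in> _\<close> by blast
      then have "x * y = tensor_op t (a * a') (b * b')" "a * a' \<in> N" "b * b' \<in> P"
        using N' P' by (simp_all add: tensor_op_mult)
      then show ?thesis by blast
    qed
    show "adj x \<in> {tensor_op t x y |x y. x \<in> N \<and> y \<in> P}"
      if "x \<in> {tensor_op t x y |x y. x \<in> N \<and> y \<in> P}" for x
    proof -
      obtain a b where "x = tensor_op t a b" "a \<in> N" "b \<in> P"
        using \<open>x \<in> _\<close> by blast
      then have "adj x = tensor_op t (adj a) (adj b)" "adj a \<in> N" "adj b \<in> P"
        using N' P' by (simp_all add: adj_tensor_op)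
      then show ?thesis by blast
    qed
    have "closed_csubspace P" using P' by (simp add: closed_csubspace_def)
    then show "closed_csubspace {T. slice t u u' T \<in> P}"
      by (rule closed_csubspace_vimage[OF _ continuous_map_slice])
         (auto simp: slice_add slice_scale)
    show "{tensor_op t x y |x y. x \<in> N \<and> y \<in> P} \<subseteq> {T. slice t u u' T \<in> P}"
      using P' by (auto simp: slice_tensor_op)
  qed
  then show ?thesis using T by blast
qed

end

lemma vn_tensor_flip: "vn_tensor (\<lambda>v u. t u v) P N = vn_tensor t N P"
proof -
  have "tensor_op (\<lambda>v u. t u v) y x = tensor_op t x y" for x y
    unfolding tensor_op_def by (rule arg_cong[where f = The]) blast
  then have "{tensor_op (\<lambda>v u. t u v) x y |x y. x \<in> P \<and> y \<in> N} = {tensor_op t x y |x y. x \<in> N \<and> y \<in> P}"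
    by auto
  then show ?thesis unfolding vn_tensor_def by simp
qed

text \<open>All slices of an element commuting with \<open>1 \<otimes> P\<close> lie in the centre of \<open>P\<close>.\<close>

lemma vn_tensor_commuting_right:
  fixes t :: "'a::chilbert_space \<Rightarrow> 'b::chilbert_space \<Rightarrow> 't::chilbert_space"
  assumes ht: "hilbert_tensor t" and N: "von_neumann_algebra N" and P: "factor P"
    and T: "T \<in> vn_tensor t N P"
    and comm: "\<And>y. y \<in> P \<Longrightarrow> T * tensor_op t 1 y = tensor_op t 1 y * T"
  shows "\<exists>X\<in>N. T = tensor_op t X 1"
proof -
  have PvN: "von_neumann_algebra P" using P by (simp add: factor_def)
  have "\<exists>k. slice t u u' T = scale_op k 1" for u u'
  proof -
    have "slice t u u' T * y = y * slice t u u' T" if "y \<in> P" for y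
      using comm[OF that] by (metis slice_mult_left[OF ht] slice_mult_right[OF ht])
    then have "slice t u u' T \<in> {x \<in> P. \<forall>y\<in>P. x * y = y * x}"
      using slice_in_vn_tensor[OF ht N PvN T] by blast
    then show ?thesis using P unfolding factor_def by blast
  qed
  then obtain k where k: "\<And>u u'. slice t u u' T = scale_op (k u u') 1" by metis
  show ?thesis
  proof (cases "\<exists>v :: 'b. v \<noteq> 0")
    case False
    then have "S = S'" for S S' :: "'b bop" by (metis bop_eqI)
    then have "T = tensor_op t 0 1" by (intro slice_eqI[OF ht])
    then show ?thesis using von_neumann_algebra_zero[OF N] by blast
  next
    case True
    then obtain v' :: 'b where "v' \<noteq> 0" by blast
    define v where "v = scaleR (1 / norm v') v'"
    have v: "cinner v v = 1" using \<open>v' \<noteq> 0\<close> by (simp add: v_def cinner_self)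
    \<comment> \<open>Slicing the second leg with a unit vector \<open>v\<close> gives <u, X u'> =
      <u \<otimes> v, T (u' \<otimes> v)> = k u u', so X \<otimes> 1 and \<open>T\<close> have the
      same slices over the first leg.\<close>
    define X where "X = slice (\<lambda>v u. t u v) v v T"
    have "X \<in> N"
      unfolding X_def
      by (rule slice_in_vn_tensor[OF hilbert_tensor_flip[OF ht] PvN N])
         (use T vn_tensor_flip[of t P N] in blast)
    moreover have "cinner u (app X u') = k u u'" for u u'
      using cinner_slice[OF ht, of v u u' T v] k[of u u'] v
      by (simp add: X_def cinner_slice[OF hilbert_tensor_flip[OF ht]] cinner_scaleC_right)
    then have "T = tensor_op t X 1"
      by (intro slice_eqI[OF ht]) (simp add: slice_tensor_op[OF ht] k)
    ultimately show ?thesis by blast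
  qed
qed

section \<open>The opposite algebra\<close>

lemma cinner_to_cnj: "cinner (to_cnj u) (to_cnj v) = cinner v u"
  by (simp add: cinner_cnj_space.rep_eq to_cnj_inverse)

lemma app_cnj_op: "app (cnj_op x) (to_cnj u) = to_cnj (app x u)"
  by (simp add: cnj_op.rep_eq to_cnj_inverse)

lemma cnj_space_cases: obtains u where "v = to_cnj u"
  by (metis of_cnj_inverse)

lemma cnj_op_eqI:
  assumes "\<And>u. app S (to_cnj u) = app T (to_cnj u)" shows "S = T"
  by (rule bop_eqI) (metis assms cnj_space_cases)

lemma to_cnj_add: "to_cnj (u + v) = to_cnj u + to_cnj v"
  by (simp add: plus_cnj_space_def to_cnj_inverse)

lemma to_cnj_scaleC: "to_cnj (c *\<^sub>C u) = cnj c *\<^sub>C to_cnj u"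
  by (simp add: scaleC_cnj_space_def to_cnj_inverse)

lemma cnj_op_mult: "cnj_op (x * y) = cnj_op x * cnj_op y"
  by (rule cnj_op_eqI) (simp add: app_cnj_op)

lemma cnj_op_one [simp]: "cnj_op 1 = 1"
  by (rule cnj_op_eqI) (simp add: app_cnj_op)

lemma cnj_op_add: "cnj_op (x + y) = cnj_op x + cnj_op y"
  by (rule cnj_op_eqI) (simp add: app_cnj_op to_cnj_add)

lemma cnj_op_scale: "cnj_op (scale_op c x) = scale_op (cnj c) (cnj_op x)"
  by (rule cnj_op_eqI) (simp add: app_cnj_op to_cnj_scaleC)

lemma cnj_op_adj: "cnj_op (adj x) = adj (cnj_op x)"
proof (rule adj_eqI[symmetric])
  fix u v :: "'a cnj_space"
  obtain u' v' where "u = to_cnj u'" "v = to_cnj v'" by (metis cnj_space_cases)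
  then show "cinner u (app (cnj_op (adj x)) v) = cinner (app (cnj_op x) u) v"
    by (simp add: app_cnj_op cinner_to_cnj cinner_adj_left)
qed

text \<open>A total inverse of \<open>cnj_op\<close>, in place of the \<open>inv_into\<close> of
  \<open>op_end\<close>: \<open>opposite N\<close> becomes a preimage, closed by continuity, and
  slices can be carried back into \<M>.\<close>

lift_definition uncnj_op :: "'h::chilbert_space cnj_space bop \<Rightarrow> 'h bop"
  is "\<lambda>f x. of_cnj (f (to_cnj x))"
proof -
  fix f :: "'h cnj_space \<Rightarrow> 'h cnj_space"
  assume f: "bounded_linear f \<and> (\<forall>c x. f (c *\<^sub>C x) = c *\<^sub>C f x)"
  then obtain K where K: "\<And>x. norm (f x) \<le> norm x * K"
    using bounded_linear.bounded by blast
  have "bounded_linear (\<lambda>x. of_cnj (f (to_cnj x)))"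
  proof (rule bounded_linear_intro[where K = K])
    show "of_cnj (f (to_cnj (x + y))) = of_cnj (f (to_cnj x)) + of_cnj (f (to_cnj y))" for x y
      using f by (simp add: to_cnj_add linear_simps plus_cnj_space.rep_eq)
    show "of_cnj (f (to_cnj (scaleR r x))) = scaleR r (of_cnj (f (to_cnj x)))" for r x
      using f by (simp add: scaleR_scaleC to_cnj_scaleC scaleC_cnj_space.rep_eq)
    show "norm (of_cnj (f (to_cnj x))) \<le> norm x * K" for x
      using K[of "to_cnj x"] by (simp add: norm_cnj_space.rep_eq to_cnj_inverse)
  qed
  moreover have "of_cnj (f (to_cnj (c *\<^sub>C x))) = c *\<^sub>C of_cnj (f (to_cnj x))" for c x
    using f by (simp add: to_cnj_scaleC scaleC_cnj_space.rep_eq)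
  ultimately show "bounded_linear (\<lambda>x. of_cnj (f (to_cnj x))) \<and>
      (\<forall>c x. of_cnj (f (to_cnj (c *\<^sub>C x))) = c *\<^sub>C of_cnj (f (to_cnj x)))" by blast
qed

lemma uncnj_cnj [simp]: "uncnj_op (cnj_op x) = x"
  by (rule bop_eqI) (simp add: uncnj_op.rep_eq app_cnj_op to_cnj_inverse)

lemma cnj_uncnj [simp]: "cnj_op (uncnj_op y) = y"
  by (rule cnj_op_eqI) (simp add: uncnj_op.rep_eq app_cnj_op of_cnj_inverse)

lemma cnj_op_inject [simp]: "cnj_op x = cnj_op y \<longleftrightarrow> x = y"
  by (metis uncnj_cnj)

lemma in_opposite_iff: "y \<in> opposite N \<longleftrightarrow> uncnj_op y \<in> N"
  unfolding opposite_def by (metis cnj_uncnj image_iff uncnj_cnj)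

lemma cnj_op_in_opposite [simp]: "cnj_op x \<in> opposite N \<longleftrightarrow> x \<in> N"
  by (simp add: in_opposite_iff)

lemma oppositeE:
  assumes "y \<in> opposite N" obtains x where "x \<in> N" "y = cnj_op x"
  using assms by (auto simp: opposite_def)

lemma op_end_cnj_op: "x \<in> N \<Longrightarrow> op_end N \<pi> (cnj_op x) = cnj_op (\<pi> x)"
proof -
  assume x: "x \<in> N"
  have "inj_on cnj_op N" by (simp add: inj_on_def)
  then show ?thesis using x by (simp add: op_end_def inv_into_f_f)
qed

lemma continuous_map_uncnj_op:
  "continuous_map ultraweak ultraweak (uncnj_op :: 'h::chilbert_space cnj_space bop \<Rightarrow> 'h bop)"
proof (rule continuous_map_into_ultraweak)
  fix u v :: "nat \<Rightarrow> 'h" assume uv: "square_summable u" "square_summable v"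
  have ss: "square_summable (\<lambda>n. to_cnj (w n))" if "square_summable w" for w :: "nat \<Rightarrow> 'h"
    using that by (simp add: square_summable_def norm_cnj_space.rep_eq to_cnj_inverse)
  \<comment> \<open>The conjugate space reverses the inner product, so the pulled-back functional
    sees \<open>adj T\<close>; this is why continuity of \<open>adj\<close> enters.\<close>
  have "cinner p (app (uncnj_op T) q) = cinner (app T (to_cnj q)) (to_cnj p)" for p q :: 'h and T
    by (simp add: uncnj_op.rep_eq cinner_cnj_space.rep_eq to_cnj_inverse)
  then have "uw_functional u v (uncnj_op T) = uw_functional (\<lambda>n. to_cnj (v n)) (\<lambda>n. to_cnj (u n)) (adj T)" for T
    by (simp add: uw_functional_def cinner_adj_right)
  then show "continuous_map ultraweak euclidean (\<lambda>x. uw_functional u v (uncnj_op x))"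
    using continuous_map_compose[OF continuous_map_adj
        continuous_map_uw_functional[OF ss[OF uv(2)] ss[OF uv(1)]]]
    by (simp add: o_def)
qed

lemma von_neumann_algebra_opposite:
  assumes N: "von_neumann_algebra N" shows "von_neumann_algebra (opposite N)"
proof -
  note N' = von_neumann_algebraD[OF N]
  have "opposite N = {y. uncnj_op y \<in> N}" by (auto simp: in_opposite_iff)
  then have "closedin ultraweak (opposite N)"
    using closedin_continuous_map_preimage[OF continuous_map_uncnj_op N'(6)] by simp
  moreover have "1 \<in> opposite N"
    using N'(1) cnj_op_in_opposite[of 1 N] by simp
  moreover have "x + y \<in> opposite N" "x * y \<in> opposite N" if "x \<in> opposite N" "y \<in> opposite N" for x y
    using that N' by (auto elim!: oppositeE simp flip: cnj_op_add cnj_op_mult)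
  moreover have "scale_op c x \<in> opposite N" if "x \<in> opposite N" for c x
  proof -
    obtain y where y: "y \<in> N" "x = cnj_op y" using \<open>x \<in> opposite N\<close> by (rule oppositeE)
    then have "scale_op c x = cnj_op (scale_op (cnj c) y)" by (simp add: cnj_op_scale)
    then show ?thesis using y N' by simp
  qed
  moreover have "adj x \<in> opposite N" if "x \<in> opposite N" for x
    using that N' by (auto elim!: oppositeE simp flip: cnj_op_adj)
  ultimately show ?thesis by (simp add: von_neumann_algebra_def)
qed

lemma factor_opposite:
  assumes N: "factor N" shows "factor (opposite N)"
proof -
  have centre: "{x \<in> N. \<forall>y\<in>N. x * y = y * x} = range (\<lambda>c. scale_op c 1)"
    using N by (simp add: factor_def)
  have sc: "cnj_op (scale_op c 1) = scale_op (cnj c) 1" for c :: complex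
    by (simp add: cnj_op_scale)
  have "{x \<in> opposite N. \<forall>y\<in>opposite N. x * y = y * x} = cnj_op ` {x \<in> N. \<forall>y\<in>N. x * y = y * x}"
    by (auto simp: opposite_def simp flip: cnj_op_mult)
  also have "\<dots> = range (\<lambda>c. scale_op c 1)"
  proof -
    have "scale_op c 1 \<in> cnj_op ` range (\<lambda>c. scale_op c 1)" for c
      using sc[of "cnj c"] by (metis complex_cnj_cnj image_eqI rangeI)
    then show ?thesis unfolding centre by (auto simp: sc)
  qed
  finally show ?thesis
    using N von_neumann_algebra_opposite[of N] unfolding factor_def by blast
qed

section \<open>The equivariant Longo--Rehren inclusion\<close>

locale equivariant_lr =
  fixes D :: "('h::chilbert_space, 't::chilbert_space, 'k::chilbert_space, 'g::group_add) lr_data"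
  assumes elr: "equivariant_longo_rehren D"
begin

abbreviation "M \<equiv> alg_M D"
abbreviation "A \<equiv> alg_A D"
abbreviation "B \<equiv> alg_B D"
abbreviation "t \<equiv> htensor D"
abbreviation "ot x y \<equiv> tensor_op t x (cnj_op y)"

text \<open>\<open>el x y\<close> is \<open>x \<otimes> j(y)\<close>, hence conjugate-linear in \<open>y\<close>.\<close>

definition el where "el x y = elem D x (cnj_op y)"

lemma lr_unfold:
  "category_data D" "group_action D" "longo_rehren D" "beta_extends D"
  using elr by (simp_all add: equivariant_longo_rehren_def)

lemma factor_M: "factor M"
  using lr_unfold(1) by (simp add: category_data_def type_III_factor_def)

lemma vn_M: "von_neumann_algebra M"
  using factor_M by (simp add: factor_def)

lemma vn_A: "von_neumann_algebra A"
  unfolding alg_A_def vn_tensor_def by (rule von_neumann_algebra_vn_generated)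

lemma vn_B: "von_neumann_algebra B"
  using lr_unfold(3) unfolding longo_rehren_def by blast

lemmas M_closed [simp] = von_neumann_algebraD(1-5)[OF vn_M]
lemmas A_closed [simp] = von_neumann_algebraD(1-5)[OF vn_A]
lemmas B_closed [simp] = von_neumann_algebraD(1-5)[OF vn_B]

lemma ht: "hilbert_tensor t"
  using lr_unfold(1) by (simp add: category_data_def)

lemma iota: "normal_hom A B (iota D)"
  using lr_unfold(3) unfolding longo_rehren_def by blast

lemmas iota_hom = normal_homD[OF iota]

lemma iota_inj: "a \<in> A \<Longrightarrow> b \<in> A \<Longrightarrow> iota D a = iota D b \<longleftrightarrow> a = b"
  using lr_unfold(3) unfolding longo_rehren_def inj_on_def by blast

lemma A_generators: "A = vn_generated {ot x y | x y. x \<in> M \<and> y \<in> M}"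
proof -
  have "{tensor_op t x y | x y. x \<in> M \<and> y \<in> opposite M} = {ot x y | x y. x \<in> M \<and> y \<in> M}"
    unfolding opposite_def by blast
  then show ?thesis unfolding alg_A_def vn_tensor_def by simp
qed

lemma ot_in_A [simp]: "x \<in> M \<Longrightarrow> y \<in> M \<Longrightarrow> ot x y \<in> A"
  using vn_generated_incl[of "{ot x y | x y. x \<in> M \<and> y \<in> M}"] unfolding A_generators by blast

lemma el_iota: "el x y = iota D (ot x y)"
  by (simp add: el_def elem_def)

lemma elem_el: "elem D x 1 = el x 1"
  by (simp add: el_def)

lemma el_in_B [simp]: "x \<in> M \<Longrightarrow> y \<in> M \<Longrightarrow> el x y \<in> B"
  by (simp add: el_iota iota_hom(2))

lemma ot_mult: "ot x y * ot x' y' = ot (x * x') (y * y')"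
  by (simp add: tensor_op_mult[OF ht] cnj_op_mult)

lemma el_mult:
  "x \<in> M \<Longrightarrow> y \<in> M \<Longrightarrow> x' \<in> M \<Longrightarrow> y' \<in> M \<Longrightarrow> el x y * el x' y' = el (x * x') (y * y')"
  by (simp add: el_iota ot_mult flip: iota_hom(7))

lemma el_mult_assoc:
  "x \<in> M \<Longrightarrow> y \<in> M \<Longrightarrow> x' \<in> M \<Longrightarrow> y' \<in> M \<Longrightarrow> el x y * (el x' y' * b) = el (x * x') (y * y') * b"
  using el_mult[of x y x' y'] by (metis mult.assoc)

lemma el_adj: "x \<in> M \<Longrightarrow> y \<in> M \<Longrightarrow> adj (el x y) = el (adj x) (adj y)"
  by (simp add: el_iota adj_tensor_op[OF ht] cnj_op_adj flip: iota_hom(8))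

lemma el_one [simp]: "el 1 1 = 1"
  by (simp add: el_iota tensor_op_one[OF ht] iota_hom(6))

lemma el_left_inject:
  assumes "x \<in> M" "x' \<in> M" "el x 1 = el x' 1" shows "x = x'"
proof (rule bop_eqI)
  fix u
  \<comment> \<open>The difference vector serves in both legs: w \<otimes> w has norm equal to the
    square of that of \<open>w\<close>, so a test vector for the second leg need not be chosen
    separately.\<close>
  define w where "w = app x u - app x' u"
  have "ot x 1 = ot x' 1"
    using assms iota_inj[OF ot_in_A ot_in_A, of x 1 x' 1] by (simp add: el_iota)
  then have "t (app x u) (to_cnj w) = t (app x' u) (to_cnj w)"
    using app_tensor_op[OF ht, of _ 1 u "to_cnj w"] by (metis cnj_op_one one_bop.rep_eq)
  moreover have "t (app x u) (to_cnj w) = t w (to_cnj w) + t (app x' u) (to_cnj w)"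
    by (simp add: w_def flip: hilbert_tensorD(1)[OF ht])
  ultimately have "norm (t w (to_cnj w)) = 0" by simp
  then show "app x u = app x' u"
    by (simp add: norm_tensor[OF ht] norm_cnj_space.rep_eq to_cnj_inverse w_def)
qed

lemma el_right_inject:
  assumes "y \<in> M" "y' \<in> M" "el 1 y = el 1 y'" shows "y = y'"
proof (rule bop_eqI)
  fix u
  define w where "w = app y u - app y' u"
  have "ot 1 y = ot 1 y'"
    using assms iota_inj[OF ot_in_A ot_in_A, of 1 y 1 y'] by (simp add: el_iota)
  then have "t w (to_cnj (app y u)) = t w (to_cnj (app y' u))"
    using app_tensor_op[OF ht, of 1 _ w "to_cnj u"] by (metis app_cnj_op one_bop.rep_eq)
  moreover have "t w (to_cnj (app y u)) = t w (to_cnj w) + t w (to_cnj (app y' u))"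
    by (simp add: w_def flip: hilbert_tensorD(2)[OF ht] to_cnj_add)
  ultimately have "norm (t w (to_cnj w)) = 0" by simp
  then show "app y u = app y' u"
    by (simp add: norm_tensor[OF ht] norm_cnj_space.rep_eq to_cnj_inverse w_def)
qed

subsection \<open>The category and the group action\<close>

lemma rigid: "rigid_category M (cat D)"
  using lr_unfold(1) by (simp add: category_data_def)

lemma cat_Endo0: "\<pi> \<in> cat D \<Longrightarrow> \<pi> \<in> Endo0 M"
  using rigid unfolding rigid_category_def by blast

lemma cat_Endo: "\<pi> \<in> cat D \<Longrightarrow> \<pi> \<in> Endo M"
  by (rule Endo0D[OF cat_Endo0])

lemmas cat_hom = EndoD[OF cat_Endo]

lemma id_cat [simp]: "id_on M \<in> cat D"
  using rigid unfolding rigid_category_def by blast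

lemma compose_cat [simp]: "\<pi> \<in> cat D \<Longrightarrow> \<rho> \<in> cat D \<Longrightarrow> compose M \<pi> \<rho> \<in> cat D"
  using rigid unfolding rigid_category_def by blast

lemma subobject_cat:
  "\<rho> \<in> cat D \<Longrightarrow> \<tau> \<in> Endo M \<Longrightarrow> V \<in> intertwiners M \<tau> \<rho> \<Longrightarrow> adj V * V = 1 \<Longrightarrow> \<tau> \<in> cat D"
  using rigid unfolding rigid_category_def by blast

lemma conjugate_solution_cat:
  "\<pi> \<in> cat D \<Longrightarrow>
    conjugate_solution M \<pi> (conjugate D \<pi>) (sol_R D \<pi>) (sol_Rbar D \<pi>) (stat_dim M \<pi>)"
  using lr_unfold(1) cat_Endo0 by (simp add: category_data_def)

lemma conjugate_cat [simp]: "\<pi> \<in> cat D \<Longrightarrow> conjugate D \<pi> \<in> cat D"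
  using rigid conjugate_solution_cat unfolding rigid_category_def conjugate_of_def by blast

lemma sol_R_M [simp]: "\<pi> \<in> cat D \<Longrightarrow> sol_R D \<pi> \<in> M"
  and sol_Rbar: "\<pi> \<in> cat D \<Longrightarrow> sol_Rbar D \<pi> \<in> intertwiners M (id_on M) (compose M \<pi> (conjugate D \<pi>))"
  and sol_Rbar_R: "\<pi> \<in> cat D \<Longrightarrow> adj (sol_Rbar D \<pi>) * \<pi> (sol_R D \<pi>) = 1"
  using conjugate_solution_cat by (auto simp: conjugate_solution_def intertwiners_def)

lemma alpha_Auto: "alpha D g \<in> Auto M"
  using lr_unfold(2) by (simp add: group_action_def)

lemma alpha_Endo: "alpha D g \<in> Endo M"
  using alpha_Auto[of g] by (simp add: Auto_def)

lemmas alpha_hom = EndoD[OF alpha_Endo]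

lemma alpha_zero: "x \<in> M \<Longrightarrow> alpha D 0 x = x"
  using lr_unfold(2) by (simp add: group_action_def)

lemma alpha_add: "x \<in> M \<Longrightarrow> alpha D (g + h) x = alpha D g (alpha D h x)"
  using lr_unfold(2) by (simp add: group_action_def)

lemma alpha_inverse [simp]:
  "x \<in> M \<Longrightarrow> alpha D g (alpha D (- g) x) = x" "x \<in> M \<Longrightarrow> alpha D (- g) (alpha D g x) = x"
  using alpha_add[of x g "- g"] alpha_add[of x "- g" g] by (simp_all add: alpha_zero)

lemma alpha_cat_zero: "alpha D g \<in> cat D \<Longrightarrow> g = 0"
  using lr_unfold(2) by (auto simp: group_action_def)

lemma act_cat [simp]: "\<pi> \<in> cat D \<Longrightarrow> act_M D g \<pi> \<in> cat D"
  using lr_unfold(2) by (simp add: group_action_def)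

lemma act_M_app:
  assumes "\<pi> \<in> cat D" "x \<in> M" shows "act_M D g \<pi> x = alpha D g (\<pi> (alpha D (- g) x))"
proof -
  have "inj_on (alpha D g) M" using alpha_Auto[of g] by (simp add: Auto_def bij_betw_def)
  then have "inv_into M (alpha D g) x = alpha D (- g) x"
    using assms by (intro inv_into_f_eq) (simp_all add: alpha_hom(1))
  then show ?thesis using assms by (simp add: act_M_def conj_by_def)
qed

lemma cat_eqI: "\<pi> \<in> cat D \<Longrightarrow> \<rho> \<in> cat D \<Longrightarrow> (\<And>x. x \<in> M \<Longrightarrow> \<pi> x = \<rho> x) \<Longrightarrow> \<pi> = \<rho>"
  by (rule extensional_eqI[OF cat_hom(7) cat_hom(7)])

lemma act_M_add: "\<pi> \<in> cat D \<Longrightarrow> act_M D (g + h) \<pi> = act_M D g (act_M D h \<pi>)"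
  by (rule cat_eqI) (simp_all add: act_M_app alpha_hom(1) cat_hom(1) minus_add alpha_add
      del: add_uminus_conv_diff)

lemma act_M_zero [simp]: "\<pi> \<in> cat D \<Longrightarrow> act_M D 0 \<pi> = \<pi>"
  by (rule cat_eqI) (simp_all add: act_M_app alpha_zero cat_hom(1))

lemma act_M_inverse [simp]:
  "\<pi> \<in> cat D \<Longrightarrow> act_M D g (act_M D (- g) \<pi>) = \<pi>" "\<pi> \<in> cat D \<Longrightarrow> act_M D (- g) (act_M D g \<pi>) = \<pi>"
  by (simp_all flip: act_M_add)

lemma act_M_compose:
  "\<pi> \<in> cat D \<Longrightarrow> \<rho> \<in> cat D \<Longrightarrow> act_M D g (compose M \<pi> \<rho>) = compose M (act_M D g \<pi>) (act_M D g \<rho>)"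
  by (rule cat_eqI) (simp_all add: act_M_app alpha_hom(1) cat_hom(1))

lemma act_M_id [simp]: "act_M D g (id_on M) = id_on M"
  by (rule cat_eqI) (simp_all add: act_M_app alpha_hom(1))

lemma compose_id_cat [simp]:
  "\<pi> \<in> cat D \<Longrightarrow> compose M \<pi> (id_on M) = \<pi>" "\<pi> \<in> cat D \<Longrightarrow> compose M (id_on M) \<pi> = \<pi>"
  by (rule cat_eqI, simp_all add: cat_hom(1))+

subsection \<open>Implementing operators\<close>

lemma tensor_endD:
  assumes "tensor_end t M (opposite M) f (op_end M g) P"
  shows "P \<in> Endo A" "\<And>x y. x \<in> M \<Longrightarrow> y \<in> M \<Longrightarrow> P (ot x y) = ot (f x) (g y)"
  using assms by (simp_all add: tensor_end_def alg_A_def op_end_cnj_op)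

lemma tensor_endI:
  assumes "P \<in> Endo A" "\<And>x y. x \<in> M \<Longrightarrow> y \<in> M \<Longrightarrow> P (ot x y) = ot (f x) (g y)"
  shows "tensor_end t M (opposite M) f (op_end M g) P"
  using assms by (auto simp: tensor_end_def alg_A_def op_end_cnj_op elim!: oppositeE)

lemma normal_hom_A_eqI:
  assumes "normal_hom A P f" "normal_hom A Q g"
    and "\<And>x y. x \<in> M \<Longrightarrow> y \<in> M \<Longrightarrow> f (ot x y) = g (ot x y)" and a: "a \<in> A"
  shows "f a = g a"
proof (rule normal_hom_eq_on_vn_generated[OF vn_A assms(1,2)])
  show "a \<in> vn_generated {ot x y | x y. x \<in> M \<and> y \<in> M}" using a A_generators by simp
qed (use assms(3) in auto)

lemma lam_B [simp]: "\<pi> \<in> cat D \<Longrightarrow> lam D \<pi> \<in> B"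
  using lr_unfold(3) unfolding longo_rehren_def by blast

lemma B_generators: "B = vn_generated (iota D ` A \<union> lam D ` cat D)"
  using lr_unfold(3) unfolding longo_rehren_def by blast

lemma normal_hom_B_eqI:
  assumes f: "normal_hom B P f" and g: "normal_hom B Q g"
    and e: "\<And>x y. x \<in> M \<Longrightarrow> y \<in> M \<Longrightarrow> f (el x y) = g (el x y)"
    and l: "\<And>\<pi>. \<pi> \<in> cat D \<Longrightarrow> f (lam D \<pi>) = g (lam D \<pi>)" and b: "b \<in> B"
  shows "f b = g b"
proof (rule normal_hom_eq_on_vn_generated[OF vn_B f g])
  have "f (iota D a) = g (iota D a)" if "a \<in> A" for a
    using normal_hom_A_eqI[OF normal_hom_compose[OF vn_A iota f] normal_hom_compose[OF vn_A iota g] _ that]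
      e that by (simp add: el_iota)
  then show "f x = g x" if "x \<in> iota D ` A \<union> lam D ` cat D" for x using that l by auto
  show "iota D ` A \<union> lam D ` cat D \<subseteq> B" using iota_hom(2) by auto
  show "b \<in> vn_generated (iota D ` A \<union> lam D ` cat D)" using b B_generators by simp
qed

lemma lam_iota:
  assumes "\<pi> \<in> cat D"
  obtains P where "P \<in> Endo A" "\<And>x y. x \<in> M \<Longrightarrow> y \<in> M \<Longrightarrow> P (ot x y) = ot (\<pi> x) (\<pi> y)"
    "\<And>a. a \<in> A \<Longrightarrow> lam D \<pi> * iota D a = iota D (P a) * lam D \<pi>"
proof -
  have "\<exists>P. tensor_end t M (opposite M) \<pi> (op_end M \<pi>) P \<and>
      (\<forall>a\<in>A. lam D \<pi> * iota D a = iota D (P a) * lam D \<pi>)"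
    using lr_unfold(3) assms unfolding longo_rehren_def by blast
  then show ?thesis using that tensor_endD by metis
qed

lemma lam_el:
  assumes "\<pi> \<in> cat D" "x \<in> M" "y \<in> M"
  shows "lam D \<pi> * el x y = el (\<pi> x) (\<pi> y) * lam D \<pi>"
proof -
  obtain P where "\<And>x y. x \<in> M \<Longrightarrow> y \<in> M \<Longrightarrow> P (ot x y) = ot (\<pi> x) (\<pi> y)"
    "\<And>a. a \<in> A \<Longrightarrow> lam D \<pi> * iota D a = iota D (P a) * lam D \<pi>"
    using lam_iota[OF assms(1)] by metis
  then show ?thesis using assms by (simp add: el_iota)
qed

lemma lam_mult: "\<pi> \<in> cat D \<Longrightarrow> \<rho> \<in> cat D \<Longrightarrow> lam D \<pi> * lam D \<rho> = lam D (compose M \<pi> \<rho>)"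
  using lr_unfold(3) unfolding longo_rehren_def by blast

lemma lam_adj:
  "\<pi> \<in> cat D \<Longrightarrow> adj (lam D \<pi>) = adj (el (sol_R D \<pi>) (sol_R D \<pi>)) * lam D (conjugate D \<pi>)"
  using lr_unfold(3) unfolding longo_rehren_def el_def by blast

lemma lam_natural:
  "\<pi> \<in> cat D \<Longrightarrow> \<rho> \<in> cat D \<Longrightarrow> T \<in> intertwiners M \<pi> \<rho> \<Longrightarrow>
    el T 1 * lam D \<pi> = el 1 (adj T) * lam D \<rho>"
  using lr_unfold(3) unfolding longo_rehren_def el_def cnj_op_one by blast

lemma expectation: "faithful_normal_expectation B (iota D ` A) (expect D)"
  using lr_unfold(3) unfolding longo_rehren_def by blast

lemma expect_range:
  assumes "b \<in> B" shows "\<exists>a\<in>A. expect D b = iota D a"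
proof -
  have "expect D \<in> B \<rightarrow> iota D ` A" using expectation by (simp add: faithful_normal_expectation_def)
  from funcset_mem[OF this assms] show ?thesis by blast
qed

lemma expect_add: "b \<in> B \<Longrightarrow> c \<in> B \<Longrightarrow> expect D (b + c) = expect D b + expect D c"
  and expect_scale: "b \<in> B \<Longrightarrow> expect D (scale_op k b) = scale_op k (expect D b)"
  and expect_iota: "a \<in> A \<Longrightarrow> expect D (iota D a) = iota D a"
  and expect_bimodule: "a \<in> A \<Longrightarrow> a' \<in> A \<Longrightarrow> x \<in> B \<Longrightarrow>
    expect D (iota D a * x * iota D a') = iota D a * expect D x * iota D a'"
  and expect_faithful: "x \<in> B \<Longrightarrow> expect D (adj x * x) = 0 \<Longrightarrow> x = 0"
  and expect_continuous: "continuous_map (subtopology ultraweak B) ultraweak (expect D)"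
  using expectation
  by (simp_all add: faithful_normal_expectation_def linear_on_def normal_on_def)

lemma expect_left: "a \<in> A \<Longrightarrow> x \<in> B \<Longrightarrow> expect D (iota D a * x) = iota D a * expect D x"
  using expect_bimodule[of a 1 x] by (simp add: iota_hom(6))

lemma expect_right: "a \<in> A \<Longrightarrow> x \<in> B \<Longrightarrow> expect D (x * iota D a) = expect D x * iota D a"
  using expect_bimodule[of 1 a x] by (simp add: iota_hom(6))

lemma expect_diff: "b \<in> B \<Longrightarrow> c \<in> B \<Longrightarrow> expect D (b - c) = expect D b - expect D c"
  using expect_add[of "b - c" c] von_neumann_algebra_diff[OF vn_B] by simp

text \<open>
  \<open>p = \<lambda>\<^sub>i\<^sub>d\<close> is a left unit for all \<open>\<lambda>\<^sub>\<pi>\<close> and commutes with \<open>\<A>\<close>, so \<open>p p\<^sup>* = p\<^sup>*\<close> by the formula for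
  \<open>\<lambda>\<^sub>\<pi>\<^sup>*\<close>; hence \<open>p\<close> is a projection, and \<open>E(1 - p) = 0\<close>.
\<close>

lemma lam_id [simp]: "lam D (id_on M) = 1"
proof -
  define p where "p = lam D (id_on M)"
  define c where "c = conjugate D (id_on M)"
  define R where "R = sol_R D (id_on M)"
  have pB: "p \<in> B" and cc: "c \<in> cat D" and RM: "R \<in> M"
    by (simp_all add: p_def c_def R_def)
  have adjp: "adj p = el (adj R) (adj R) * lam D c"
    using lam_adj[of "id_on M"] RM by (simp add: p_def c_def R_def el_adj)
  have "p * el (adj R) (adj R) = el (adj R) (adj R) * p"
    using lam_el[of "id_on M" "adj R" "adj R"] RM by (simp add: p_def)
  moreover have "p * lam D c = lam D c" using cc by (simp add: p_def lam_mult)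
  ultimately have pp: "p * adj p = adj p"
    unfolding adjp by (metis mult.assoc)
  then have sa: "adj p = p" by (metis adj_adj adj_mult)
  define q where "q = 1 - p"
  have qB: "q \<in> B" using pB by (simp add: q_def von_neumann_algebra_diff[OF vn_B])
  have "p * p = p" using pp sa by simp
  then have "adj q * q = q" by (simp add: q_def sa algebra_simps)
  moreover have "expect D q = 0"
  proof -
    have irr: "id_on M \<in> irr D" using lr_unfold(1) by (simp add: category_data_def)
    have "\<forall>a\<in>A. \<forall>\<pi>\<in>irr D. expect D (iota D a * lam D \<pi>) = (if \<pi> = id_on M then iota D a else 0)"
      using lr_unfold(3) unfolding longo_rehren_def by blast
    then have "expect D (iota D 1 * p) = iota D 1"
      using irr by (simp add: p_def)
    moreover have "expect D 1 = 1" using expect_iota[of 1] by (simp add: iota_hom(6))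
    ultimately show ?thesis using pB by (simp add: q_def expect_diff iota_hom(6))
  qed
  ultimately have "q = 0" using expect_faithful[OF qB] by simp
  then show ?thesis by (simp add: q_def p_def)
qed

text \<open>Right multiplication by \<lambda>_\<pi> is undone explicitly. Between 1 \<otimes> j(adj
  R') and (adj R \<otimes> 1) \<lambda>_c it becomes \<lambda> of the composite \<pi>c, which
  naturality for R' \<in> (id, \<pi>c) turns into R' \<otimes> 1. What remains is
  \<open>y * \<pi> (adj R) * R'\<close>, whose last two factors cancel.\<close>

lemma lam_cancel:
  assumes \<pi>: "\<pi> \<in> cat D" and x: "x \<in> M" "x' \<in> M" and eq: "el x 1 * lam D \<pi> = el x' 1 * lam D \<pi>"
  shows "x = x'"
proof -
  define c where "c = conjugate D \<pi>"
  define R where "R = sol_R D \<pi>"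
  define R' where "R' = sol_Rbar D \<pi>"
  have cc: "c \<in> cat D" and RM: "R \<in> M" using \<pi> by (simp_all add: c_def R_def)
  have R': "R' \<in> intertwiners M (id_on M) (compose M \<pi> c)" using sol_Rbar[OF \<pi>] by (simp add: R'_def c_def)
  then have R'M: "R' \<in> M" by (rule intertwinersD)
  have "adj (adj R' * \<pi> R) = 1" using sol_Rbar_R[OF \<pi>] by (simp add: R_def R'_def)
  then have one: "\<pi> (adj R) * R' = 1" using \<pi> RM by (simp add: cat_hom(6))
  have nat: "el 1 (adj R') * lam D (compose M \<pi> c) = el R' 1"
    using lam_natural[OF id_cat _ R'] \<pi> cc by simp
  have key: "el 1 (adj R') * (el y 1 * lam D \<pi>) * (el (adj R) 1 * lam D c) = el y 1" if y: "y \<in> M" for y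
  proof -
    have "lam D \<pi> * (el (adj R) 1 * lam D c) = el (\<pi> (adj R)) 1 * lam D (compose M \<pi> c)"
      using \<pi> cc RM lam_el[OF \<pi>, of "adj R" 1] by (simp add: cat_hom(4) lam_mult mult.assoc[symmetric])
        (simp add: mult.assoc lam_mult)
    then have "el 1 (adj R') * (el y 1 * lam D \<pi>) * (el (adj R) 1 * lam D c)
      = el (y * \<pi> (adj R)) (adj R') * lam D (compose M \<pi> c)"
      using y RM R'M \<pi> by (simp add: mult.assoc el_mult_assoc cat_hom(1))
    also have "\<dots> = el (y * \<pi> (adj R)) 1 * (el 1 (adj R') * lam D (compose M \<pi> c))"
      using y RM R'M \<pi> by (simp add: el_mult_assoc cat_hom(1))
    also have "\<dots> = el y 1"
      using y RM R'M \<pi> by (simp add: nat el_mult cat_hom(1) mult.assoc one)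
    finally show ?thesis .
  qed
  have "el x 1 = el x' 1" by (metis key x eq)
  then show ?thesis using x by (intro el_left_inject)
qed

text \<open>By faithfulness of \<open>E\<close>, since the span of the \<open>a \<lambda>\<^sub>\<pi>\<close> is a dense *-subalgebra.\<close>

lemma zero_if_coefficients_zero:
  assumes T: "T \<in> B" and zero: "\<And>\<pi>. \<pi> \<in> cat D \<Longrightarrow> expect D (lam D \<pi> * T) = 0"
  shows "T = 0"
proof -
  define S where "S = {iota D a * lam D \<pi> | a \<pi>. a \<in> A \<and> \<pi> \<in> cat D}"
  \<comment> \<open>\<open>W\<close> is a closed subspace but not evidently an algebra, so \<B> has
    to be reached as the closed span of the *-monoid \<open>S\<close>. The element of
    \<open>W\<close> finally used is \<open>adj T\<close>.\<close>
  define W where "W = {b \<in> B. expect D (b * T) = 0}"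
  have SI: "iota D a * lam D \<pi> \<in> S" if "a \<in> A" "\<pi> \<in> cat D" for a \<pi>
    using that by (auto simp: S_def)
  have "vn_generated S \<subseteq> W"
  proof (rule vn_generated_subset_closed_csubspace)
    show "1 \<in> S" using SI[of 1 "id_on M"] by (simp add: iota_hom(6))
    show "x * y \<in> S" if xS: "x \<in> S" and yS: "y \<in> S" for x y
    proof -
      obtain a \<pi> where x: "x = iota D a * lam D \<pi>" "a \<in> A" "\<pi> \<in> cat D"
        using xS unfolding S_def by blast
      obtain b \<rho> where y: "y = iota D b * lam D \<rho>" "b \<in> A" "\<rho> \<in> cat D"
        using yS unfolding S_def by blast
      obtain P where P: "P \<in> Endo A" "\<And>a. a \<in> A \<Longrightarrow> lam D \<pi> * iota D a = iota D (P a) * lam D \<pi>"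
        using lam_iota[OF x(3)] by metis
      have "x * y = iota D a * (lam D \<pi> * iota D b) * lam D \<rho>" by (simp add: x y mult.assoc)
      also have "\<dots> = iota D (a * P b) * lam D (compose M \<pi> \<rho>)"
        using x y EndoD(1)[OF P(1), of b] by (simp add: P(2) iota_hom(7) mult.assoc lam_mult)
      finally show ?thesis using SI x y EndoD(1)[OF P(1), of b] by simp
    qed
    show "adj x \<in> S" if xS: "x \<in> S" for x
    proof -
      obtain a \<pi> where x: "x = iota D a * lam D \<pi>" "a \<in> A" "\<pi> \<in> cat D"
        using xS unfolding S_def by blast
      define c where "c = conjugate D \<pi>"
      define R where "R = sol_R D \<pi>"
      have c: "c \<in> cat D" "R \<in> M" using x by (simp_all add: c_def R_def)
      obtain P where P: "P \<in> Endo A" "\<And>a. a \<in> A \<Longrightarrow> lam D c * iota D a = iota D (P a) * lam D c"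
        using lam_iota[OF c(1)] by metis
      have "adj x = iota D (ot (adj R) (adj R)) * (lam D c * iota D (adj a))"
        using x c by (simp add: lam_adj el_adj mult.assoc iota_hom(8) el_iota[symmetric] flip: c_def R_def)
      also have "\<dots> = iota D (ot (adj R) (adj R) * P (adj a)) * lam D c"
        using x c EndoD(1)[OF P(1), of "adj a"] by (simp add: P(2) iota_hom(7) mult.assoc)
      finally show ?thesis using SI x c EndoD(1)[OF P(1), of "adj a"] by simp
    qed
    have "continuous_map (subtopology ultraweak B) ultraweak (\<lambda>b. expect D (b * T))"
    proof -
      have "continuous_map (subtopology ultraweak B) (subtopology ultraweak B) (\<lambda>b. b * T)"
        using T by (auto simp: continuous_map_in_subtopology
            intro: continuous_map_from_subtopology[OF continuous_map_mult_right])
      from continuous_map_compose[OF this expect_continuous] show ?thesis by (simp add: o_def)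
    qed
    from closedin_continuous_maps_eq[OF Hausdorff_ultraweak this, of "\<lambda>_. 0"]
    have "closedin (subtopology ultraweak B) W" by (simp add: W_def)
    then have "closedin ultraweak W"
      using closedin_trans_full von_neumann_algebraD(6)[OF vn_B] by blast
    then show "closed_csubspace W"
      using T by (auto simp: closed_csubspace_def W_def distrib_right expect_add expect_scale)
    show "S \<subseteq> W"
      using T zero by (auto simp: S_def W_def iota_hom(2) mult.assoc expect_left)
  qed
  moreover have "B \<subseteq> vn_generated S"
  proof -
    have "iota D a \<in> S" if "a \<in> A" for a using SI[OF that id_cat] by simp
    moreover have "lam D \<pi> \<in> S" if "\<pi> \<in> cat D" for \<pi> using SI[OF _ that, of 1] by (simp add: iota_hom(6))
    ultimately have "iota D ` A \<union> lam D ` cat D \<subseteq> vn_generated S"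
      using vn_generated_incl[of S] by blast
    then show ?thesis
      by (subst B_generators) (rule vn_generated_least[OF von_neumann_algebra_vn_generated])
  qed
  ultimately have "adj T \<in> W" using B_closed(5)[OF T] by blast
  then have "expect D (adj T * T) = 0" by (simp add: W_def)
  then show ?thesis by (rule expect_faithful[OF T])
qed

subsection \<open>The automorphisms of B\<close>

lemma beta_Endo: "beta D g \<in> Endo B"
  using lr_unfold(4) by (simp add: beta_extends_def Auto_def)

lemmas beta_hom = EndoD[OF beta_Endo]

lemma beta_iota:
  obtains P where "P \<in> Endo A" "\<And>x y. x \<in> M \<Longrightarrow> y \<in> M \<Longrightarrow> P (ot x y) = ot (alpha D g x) (alpha D g y)"
    "\<And>a. a \<in> A \<Longrightarrow> beta D g (iota D a) = iota D (P a)"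
    "\<And>\<pi>. \<pi> \<in> cat D \<Longrightarrow> beta D g (lam D \<pi>) = lam D (act_M D g \<pi>)"
proof -
  obtain P where P: "tensor_end t M (opposite M) (alpha D g) (op_end M (alpha D g)) P"
    "\<And>a \<pi>. a \<in> A \<Longrightarrow> \<pi> \<in> cat D \<Longrightarrow> beta D g (iota D a * lam D \<pi>) = iota D (P a) * lam D (act_M D g \<pi>)"
    using lr_unfold(4) unfolding beta_extends_def by blast
  note P1 = tensor_endD[OF P(1)]
  have "beta D g (iota D a) = iota D (P a)" if "a \<in> A" for a
    using P(2)[OF that id_cat] by simp
  moreover have "beta D g (lam D \<pi>) = lam D (act_M D g \<pi>)" if "\<pi> \<in> cat D" for \<pi>
    using P(2)[OF A_closed(1) that] EndoD(4)[OF P1(1)] by (simp add: iota_hom(6))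
  ultimately show ?thesis using that P1 by blast
qed

lemma beta_el [simp]: "x \<in> M \<Longrightarrow> y \<in> M \<Longrightarrow> beta D g (el x y) = el (alpha D g x) (alpha D g y)"
  by (rule beta_iota[of g]) (simp add: el_iota)

lemma beta_lam [simp]: "\<pi> \<in> cat D \<Longrightarrow> beta D g (lam D \<pi>) = lam D (act_M D g \<pi>)"
  by (rule beta_iota[of g])

lemma normal_hom_id_B: "normal_hom B B (id_on B)"
  using Endo_id_on[OF vn_B] by (simp add: Endo_def)

text \<open>Each \<beta>_g is specified separately by its values on generators, so the relation
  between \<beta>_g and \<beta>_{-g} has to be derived there.\<close>

lemma beta_inverse [simp]: assumes "b \<in> B" shows "beta D g (beta D (- g) b) = b"
proof -
  have "compose B (beta D g) (beta D (- g)) b = id_on B b"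
    by (rule normal_hom_B_eqI[OF normal_hom_compose[OF vn_B beta_hom(8) beta_hom(8)] normal_hom_id_B _ _ assms])
       (simp_all add: alpha_hom(1))
  then show ?thesis using assms by simp
qed

lemma beta_inverse' [simp]: "b \<in> B \<Longrightarrow> beta D (- g) (beta D g b) = b"
  using beta_inverse[of b "- g"] by simp

lemma act_B_eq: "act_B D g \<theta> = compose B (beta D g) (compose B \<theta> (beta D (- g)))"
proof -
  have "inj_on (beta D g) B" using lr_unfold(4) by (simp add: beta_extends_def Auto_def bij_betw_def)
  then have "inv_into B (beta D g) x = beta D (- g) x" if "x \<in> B" for x
    using that by (intro inv_into_f_eq) (simp_all add: beta_hom(1))
  then have "compose B \<theta> (restrict (inv_into B (beta D g)) B) = compose B \<theta> (beta D (- g))"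
    by (auto simp: compose_def)
  then show ?thesis by (simp add: act_B_def conj_by_def)
qed

lemma act_B_app: "b \<in> B \<Longrightarrow> act_B D g \<theta> b = beta D g (\<theta> (beta D (- g) b))"
  by (simp add: act_B_eq)

lemma act_B_Endo0: "\<theta> \<in> Endo0 B \<Longrightarrow> act_B D g \<theta> \<in> Endo0 B"
  unfolding act_B_eq
  by (rule Endo0_conjugate_by_inverse_pair[OF vn_B]) (simp_all add: beta_Endo)

end

lemma isometry_mult:
  assumes "adj u * u = 1" "adj v * v = 1" shows "adj (u * v) * (u * v) = 1"
proof -
  have "adj (u * v) * (u * v) = adj v * (adj u * u) * v" by (simp add: mult.assoc)
  then show ?thesis by (simp add: assms)
qed

text \<open>Common pattern of the half braiding computations: \<open>c\<close> moves left past
  \<open>b\<close>, changing to \<open>d\<close>, and then past \<open>a\<close>, changing to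
  \<open>f\<close>.\<close>

lemma exchange_mult:
  fixes a :: "'a::semigroup_mult"
  assumes "b * c = d * e" "a * d = f * a'" shows "(a * b) * c = f * (a' * e)"
proof -
  have "(a * b) * c = (a * d) * e" by (simp only: mult.assoc assms(1))
  then show ?thesis by (simp only: assms(2) mult.assoc)
qed

context equivariant_lr begin

subsection \<open>Eta extensions\<close>

lemma half_braidingD:
  assumes "half_braiding D g \<sigma> \<E>"
  shows "\<sigma> \<in> cat D" "\<And>\<pi>. \<pi> \<in> cat D \<Longrightarrow> \<E> \<pi> \<in> M"
    "\<And>\<pi>. \<pi> \<in> cat D \<Longrightarrow> adj (\<E> \<pi>) * \<E> \<pi> = 1" "\<And>\<pi>. \<pi> \<in> cat D \<Longrightarrow> \<E> \<pi> * adj (\<E> \<pi>) = 1"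
    "\<And>\<pi> x. \<pi> \<in> cat D \<Longrightarrow> x \<in> M \<Longrightarrow> \<E> \<pi> * \<sigma> (\<pi> x) = act_M D g \<pi> (\<sigma> x) * \<E> \<pi>"
    "\<And>\<pi> \<rho>. \<pi> \<in> cat D \<Longrightarrow> \<rho> \<in> cat D \<Longrightarrow> \<E> (compose M \<pi> \<rho>) = act_M D g \<pi> (\<E> \<rho>) * \<E> \<pi>"
    "\<And>\<pi> \<rho> T. \<pi> \<in> cat D \<Longrightarrow> \<rho> \<in> cat D \<Longrightarrow> T \<in> intertwiners M \<pi> \<rho> \<Longrightarrow>
      alpha D g T * \<E> \<pi> = \<E> \<rho> * \<sigma> T"
  using assms by (simp_all add: half_braiding_def unitary_in_def intertwiners_def)

lemma half_braidingI:
  assumes "\<sigma> \<in> cat D" "\<And>\<pi>. \<pi> \<in> cat D \<Longrightarrow> \<E> \<pi> \<in> M"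
    "\<And>\<pi>. \<pi> \<in> cat D \<Longrightarrow> adj (\<E> \<pi>) * \<E> \<pi> = 1" "\<And>\<pi>. \<pi> \<in> cat D \<Longrightarrow> \<E> \<pi> * adj (\<E> \<pi>) = 1"
    "\<And>\<pi> x. \<pi> \<in> cat D \<Longrightarrow> x \<in> M \<Longrightarrow> \<E> \<pi> * \<sigma> (\<pi> x) = act_M D g \<pi> (\<sigma> x) * \<E> \<pi>"
    "\<And>\<pi> \<rho>. \<pi> \<in> cat D \<Longrightarrow> \<rho> \<in> cat D \<Longrightarrow> \<E> (compose M \<pi> \<rho>) = act_M D g \<pi> (\<E> \<rho>) * \<E> \<pi>"
    "\<And>\<pi> \<rho> T. \<pi> \<in> cat D \<Longrightarrow> \<rho> \<in> cat D \<Longrightarrow> T \<in> intertwiners M \<pi> \<rho> \<Longrightarrow>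
      alpha D g T * \<E> \<pi> = \<E> \<rho> * \<sigma> T"
  shows "half_braiding D g \<sigma> \<E>"
  using assms by (simp add: half_braiding_def unitary_in_def intertwiners_def)

lemma eta_half_braiding: "eta_extension D g \<sigma> \<E> \<theta> \<Longrightarrow> half_braiding D g \<sigma> \<E>"
  and eta_Endo0: "eta_extension D g \<sigma> \<E> \<theta> \<Longrightarrow> \<theta> \<in> Endo0 B"
  and eta_lam: "eta_extension D g \<sigma> \<E> \<theta> \<Longrightarrow> \<pi> \<in> cat D \<Longrightarrow>
    \<theta> (lam D \<pi>) = el (adj (\<E> \<pi>)) 1 * lam D (act_M D g \<pi>)"
  by (simp_all add: eta_extension_def elem_el)

lemmas etaD = half_braidingD[OF eta_half_braiding]
lemmas eta_hom = EndoD[OF Endo0D[OF eta_Endo0]]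

lemma eta_iota:
  assumes "eta_extension D g \<sigma> \<E> \<theta>"
  obtains P where "P \<in> Endo A" "\<And>x y. x \<in> M \<Longrightarrow> y \<in> M \<Longrightarrow> P (ot x y) = ot (\<sigma> x) (alpha D g y)"
    "\<And>a. a \<in> A \<Longrightarrow> \<theta> (iota D a) = iota D (P a)"
proof -
  have "\<exists>P. tensor_end t M (opposite M) \<sigma> (op_end M (alpha D g)) P \<and> (\<forall>a\<in>A. \<theta> (iota D a) = iota D (P a))"
    using assms by (simp add: eta_extension_def)
  then show ?thesis using that tensor_endD by metis
qed

lemma eta_el:
  assumes "eta_extension D g \<sigma> \<E> \<theta>" "x \<in> M" "y \<in> M"
  shows "\<theta> (el x y) = el (\<sigma> x) (alpha D g y)"
  by (rule eta_iota[OF assms(1)]) (simp add: el_iota assms)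

lemma eta_extensionI:
  assumes "half_braiding D g \<sigma> \<E>" "\<theta> \<in> Endo0 B"
    and "P \<in> Endo A" "\<And>x y. x \<in> M \<Longrightarrow> y \<in> M \<Longrightarrow> P (ot x y) = ot (\<sigma> x) (alpha D g y)"
    and "\<And>a. a \<in> A \<Longrightarrow> \<theta> (iota D a) = iota D (P a)"
    and "\<And>\<pi>. \<pi> \<in> cat D \<Longrightarrow> \<theta> (lam D \<pi>) = el (adj (\<E> \<pi>)) 1 * lam D (act_M D g \<pi>)"
  shows "eta_extension D g \<sigma> \<E> \<theta>"
  using assms tensor_endI[of P \<sigma> "alpha D g"] unfolding eta_extension_def elem_el by blast

lemma alpha_intertwiner:
  assumes "T \<in> intertwiners M \<pi> \<rho>" "\<pi> \<in> cat D" "\<rho> \<in> cat D"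
  shows "alpha D h T \<in> intertwiners M (act_M D h \<pi>) (act_M D h \<rho>)"
proof -
  note T = intertwinersD[OF assms(1)]
  have "alpha D h T * alpha D h (\<pi> y) = alpha D h (\<rho> y) * alpha D h T" if "y \<in> M" for y
    using T(1) T(2)[OF that] that assms by (metis alpha_hom(5) cat_hom(1))
  then show ?thesis
    using T(1) assms by (simp add: intertwiners_def alpha_hom(1) act_M_app)
qed

text \<open>\<F>(\<pi>) carries \<pi> past \<rho> and turns it into h[\<pi>]; \<E>(h[\<pi>]) then
  carries that past \<sigma>. Each axiom is that of \<F> mapped through \<sigma>, combined with that
  of \<E>.\<close>

lemma half_braiding_compose:
  assumes E: "half_braiding D g \<sigma> \<E>" and F: "half_braiding D h \<rho> \<F>"
  shows "half_braiding D (g + h) (compose M \<sigma> \<rho>) (\<lambda>\<pi>. \<E> (act_M D h \<pi>) * \<sigma> (\<F> \<pi>))"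
proof (rule half_braidingI)
  note E' = half_braidingD[OF E] and F' = half_braidingD[OF F]
  note s = cat_hom[OF E'(1)] and r = cat_hom[OF F'(1)]
  show "compose M \<sigma> \<rho> \<in> cat D" using E'(1) F'(1) by simp
  fix \<pi> assume \<pi>: "\<pi> \<in> cat D"
  let ?X = "\<lambda>\<pi>. \<E> (act_M D h \<pi>) * \<sigma> (\<F> \<pi>)"
  note p = cat_hom[OF \<pi>] and F\<pi> = F'(2-5)[OF \<pi>]
  have h\<pi>: "act_M D h \<pi> \<in> cat D" using \<pi> by simp
  note E\<pi> = E'(2-5)[OF h\<pi>] and hp = cat_hom[OF h\<pi>]
  show XM: "?X \<pi> \<in> M" using E\<pi>(1) F\<pi>(1) s(1) by simp
  have sF: "adj (\<sigma> (\<F> \<pi>)) * \<sigma> (\<F> \<pi>) = 1" "\<sigma> (\<F> \<pi>) * adj (\<sigma> (\<F> \<pi>)) = 1"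
    using F\<pi>(1-3) s(4,5,6) by (metis M_closed(5))+
  show "adj (?X \<pi>) * ?X \<pi> = 1"
    by (rule isometry_mult[OF E\<pi>(2) sF(1)])
  show "?X \<pi> * adj (?X \<pi>) = 1"
    using isometry_mult[of "adj (\<sigma> (\<F> \<pi>))" "adj (\<E> (act_M D h \<pi>))"] E\<pi>(3) sF(2) by simp
  show "?X \<pi> * compose M \<sigma> \<rho> (\<pi> x) = act_M D (g + h) \<pi> (compose M \<sigma> \<rho> x) * ?X \<pi>" if x: "x \<in> M" for x
  proof -
    have "\<sigma> (\<F> \<pi>) * \<sigma> (\<rho> (\<pi> x)) = \<sigma> (act_M D h \<pi> (\<rho> x)) * \<sigma> (\<F> \<pi>)"
      using F\<pi>(4)[OF x] F\<pi>(1) x s(5) by (metis p(1) r(1) hp(1))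
    moreover have "\<E> (act_M D h \<pi>) * \<sigma> (act_M D h \<pi> (\<rho> x)) = act_M D g (act_M D h \<pi>) (\<sigma> (\<rho> x)) * \<E> (act_M D h \<pi>)"
      using E\<pi>(4)[of "\<rho> x"] x r(1) by simp
    ultimately have "?X \<pi> * \<sigma> (\<rho> (\<pi> x)) = act_M D g (act_M D h \<pi>) (\<sigma> (\<rho> x)) * ?X \<pi>"
      by (rule exchange_mult)
    then show ?thesis using x p(1) \<pi> by (simp add: act_M_add)
  qed
  fix \<tau> assume \<tau>: "\<tau> \<in> cat D"
  have h\<tau>: "act_M D h \<tau> \<in> cat D" using \<tau> by simp
  show "?X (compose M \<pi> \<tau>) = act_M D (g + h) \<pi> (?X \<tau>) * ?X \<pi>"
  proof -
    have "\<sigma> (\<F> (compose M \<pi> \<tau>)) = \<sigma> (act_M D h \<pi> (\<F> \<tau>)) * \<sigma> (\<F> \<pi>)"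
      using F'(6)[OF \<pi> \<tau>] F\<pi>(1) F'(2)[OF \<tau>] s(5) hp(1) by simp
    moreover have "\<E> (act_M D h (compose M \<pi> \<tau>)) =
        act_M D g (act_M D h \<pi>) (\<E> (act_M D h \<tau>)) * \<E> (act_M D h \<pi>)"
      using E'(6)[OF h\<pi> h\<tau>] \<pi> \<tau> by (simp add: act_M_compose)
    moreover have "\<E> (act_M D h \<pi>) * \<sigma> (act_M D h \<pi> (\<F> \<tau>)) * \<sigma> (\<F> \<pi>) =
        act_M D g (act_M D h \<pi>) (\<sigma> (\<F> \<tau>)) * ?X \<pi>"
      by (rule exchange_mult[OF refl E\<pi>(4)[OF F'(2)[OF \<tau>]]])
    moreover have "act_M D (g + h) \<pi> (?X \<tau>) =
        act_M D g (act_M D h \<pi>) (\<E> (act_M D h \<tau>)) * act_M D g (act_M D h \<pi>) (\<sigma> (\<F> \<tau>))"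
      using cat_hom(5)[OF act_cat[OF h\<pi>]] E'(2)[OF h\<tau>] F'(2)[OF \<tau>] s(1) \<pi> by (simp add: act_M_add)
    ultimately show ?thesis by (simp only: mult.assoc)
  qed
  fix T assume T: "T \<in> intertwiners M \<pi> \<tau>"
  have TM: "T \<in> M" using T by (rule intertwinersD)
  have "\<sigma> (\<F> \<tau>) * \<sigma> (\<rho> T) = \<sigma> (alpha D h T) * \<sigma> (\<F> \<pi>)"
    using F'(7)[OF \<pi> \<tau> T] TM F\<pi>(1) F'(2)[OF \<tau>] s(5) by (metis alpha_hom(1) r(1))
  moreover have "\<E> (act_M D h \<tau>) * \<sigma> (alpha D h T) = alpha D g (alpha D h T) * \<E> (act_M D h \<pi>)"
    by (rule E'(7)[OF h\<pi> h\<tau> alpha_intertwiner[OF T \<pi> \<tau>], symmetric])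
  ultimately have "?X \<tau> * \<sigma> (\<rho> T) = alpha D g (alpha D h T) * ?X \<pi>" by (rule exchange_mult)
  then show "alpha D (g + h) T * ?X \<pi> = ?X \<tau> * compose M \<sigma> \<rho> T"
    using TM by (simp add: alpha_add)
qed

lemma eta_compose:
  assumes E: "eta_extension D g \<sigma> \<E> s" and F: "eta_extension D h \<rho> \<F> r"
  shows "eta_extension D (g + h) (compose M \<sigma> \<rho>) (\<lambda>\<pi>. \<E> (act_M D h \<pi>) * \<sigma> (\<F> \<pi>)) (compose B s r)"
proof -
  obtain P where P: "P \<in> Endo A" "\<And>x y. x \<in> M \<Longrightarrow> y \<in> M \<Longrightarrow> P (ot x y) = ot (\<sigma> x) (alpha D g y)"
    "\<And>a. a \<in> A \<Longrightarrow> s (iota D a) = iota D (P a)" using eta_iota[OF E] by metis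
  obtain Q where Q: "Q \<in> Endo A" "\<And>x y. x \<in> M \<Longrightarrow> y \<in> M \<Longrightarrow> Q (ot x y) = ot (\<rho> x) (alpha D h y)"
    "\<And>a. a \<in> A \<Longrightarrow> r (iota D a) = iota D (Q a)" using eta_iota[OF F] by metis
  note E' = etaD[OF E] and F' = etaD[OF F]
  show ?thesis
  proof (rule eta_extensionI[where P = "compose A P Q"])
    show "half_braiding D (g + h) (compose M \<sigma> \<rho>) (\<lambda>\<pi>. \<E> (act_M D h \<pi>) * \<sigma> (\<F> \<pi>))"
      by (rule half_braiding_compose[OF eta_half_braiding[OF E] eta_half_braiding[OF F]])
    show "compose B s r \<in> Endo0 B" by (rule Endo0_compose[OF vn_B eta_Endo0[OF E] eta_Endo0[OF F]])
    show "compose A P Q \<in> Endo A" by (rule Endo_compose[OF vn_A P(1) Q(1)])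
    show "compose A P Q (ot x y) = ot (compose M \<sigma> \<rho> x) (alpha D (g + h) y)" if "x \<in> M" "y \<in> M" for x y
      using that by (simp add: P Q cat_hom(1)[OF F'(1)] alpha_hom(1) alpha_add)
    show "compose B s r (iota D a) = iota D (compose A P Q a)" if "a \<in> A" for a
      using that by (simp add: P Q iota_hom(2) EndoD(1)[OF Q(1)])
    fix \<pi> assume \<pi>: "\<pi> \<in> cat D"
    have "s (r (lam D \<pi>)) = s (el (adj (\<F> \<pi>)) 1) * s (lam D (act_M D h \<pi>))"
      using \<pi> F'(2)[OF \<pi>] by (simp add: eta_lam[OF F] eta_hom(5)[OF E])
    also have "\<dots> = el (adj (\<sigma> (\<F> \<pi>))) 1 * (el (adj (\<E> (act_M D h \<pi>))) 1 * lam D (act_M D g (act_M D h \<pi>)))"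
      using \<pi> F'(2)[OF \<pi>] by (simp add: eta_lam[OF E] eta_el[OF E] alpha_hom(4) cat_hom(6)[OF E'(1)])
    also have "\<dots> = el (adj (\<E> (act_M D h \<pi>) * \<sigma> (\<F> \<pi>))) 1 * lam D (act_M D (g + h) \<pi>)"
      using \<pi> F'(2)[OF \<pi>] E'(2)[of "act_M D h \<pi>"] cat_hom(1)[OF E'(1)]
      by (simp add: el_mult_assoc act_M_add)
    finally show "compose B s r (lam D \<pi>) =
        el (adj (\<E> (act_M D h \<pi>) * \<sigma> (\<F> \<pi>))) 1 * lam D (act_M D (g + h) \<pi>)"
      using \<pi> by simp
  qed
qed

text \<open>The degree k g k^-1 is written \<open>k + (g + - k)\<close>, \<open>group_add\<close>
  being additive but not necessarily commutative. The form \<open>+ -\<close> is protected from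
  simplification so that \<open>act_M_add\<close> and \<open>alpha_add\<close> can split it.\<close>

lemma half_braiding_act:
  assumes E: "half_braiding D g \<sigma> \<E>"
  shows "half_braiding D (k + (g + - k)) (act_M D k \<sigma>) (\<lambda>\<pi>. alpha D k (\<E> (act_M D (- k) \<pi>)))"
proof (rule half_braidingI)
  note E' = half_braidingD[OF E]
  note s = cat_hom[OF E'(1)]
  have act3: "act_M D (k + (g + - k)) \<pi> x = alpha D k (act_M D g (act_M D (- k) \<pi>) (alpha D (- k) x))"
    if "\<pi> \<in> cat D" "x \<in> M" for \<pi> x
    using that by (simp add: act_M_add act_M_app[of "act_M D g (act_M D (- k) \<pi>)"] del: add_uminus_conv_diff)
  show "act_M D k \<sigma> \<in> cat D" using E'(1) by simp
  fix \<pi> assume \<pi>: "\<pi> \<in> cat D"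
  define \<pi>' where "\<pi>' = act_M D (- k) \<pi>"
  have \<pi>': "\<pi>' \<in> cat D" using \<pi> by (simp add: \<pi>'_def)
  note E\<pi> = E'(2-5)[OF \<pi>']
  let ?X = "\<lambda>\<pi>. alpha D k (\<E> (act_M D (- k) \<pi>))"
  show "?X \<pi> \<in> M" using E\<pi> by (simp add: alpha_hom(1) flip: \<pi>'_def)
  show "adj (?X \<pi>) * ?X \<pi> = 1" "?X \<pi> * adj (?X \<pi>) = 1"
    unfolding \<pi>'_def[symmetric] using E\<pi>(1-3) by (metis M_closed(5) alpha_hom(4-6))+
  show "?X \<pi> * act_M D k \<sigma> (\<pi> x) = act_M D (k + (g + - k)) \<pi> (act_M D k \<sigma> x) * ?X \<pi>" if x: "x \<in> M" for x
  proof -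
    define y where "y = alpha D (- k) x"
    have y: "y \<in> M" using x by (simp add: y_def alpha_hom(1))
    have "alpha D (- k) (\<pi> x) = \<pi>' y"
      using x \<pi> by (simp add: \<pi>'_def y_def act_M_app alpha_hom(1) cat_hom(1))
    then have "?X \<pi> * act_M D k \<sigma> (\<pi> x) = alpha D k (\<E> \<pi>' * \<sigma> (\<pi>' y))"
      using x y \<pi> \<pi>' E\<pi>(1) E'(1) by (simp add: act_M_app[of \<sigma>] cat_hom(1) alpha_hom(5) flip: \<pi>'_def)
    also have "\<dots> = alpha D k (act_M D g \<pi>' (\<sigma> y)) * ?X \<pi>"
      using y \<pi>' E\<pi> E'(1) by (simp add: cat_hom(1) alpha_hom(5) flip: \<pi>'_def)
    also have "alpha D k (act_M D g \<pi>' (\<sigma> y)) = act_M D (k + (g + - k)) \<pi> (act_M D k \<sigma> x)"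
      using x y \<pi> E'(1) by (simp add: act3 act_M_app[of \<sigma>] cat_hom(1) alpha_hom(1) flip: \<pi>'_def y_def
          del: add_uminus_conv_diff)
    finally show ?thesis .
  qed
  fix \<tau> assume \<tau>: "\<tau> \<in> cat D"
  define \<tau>' where "\<tau>' = act_M D (- k) \<tau>"
  have \<tau>': "\<tau>' \<in> cat D" using \<tau> by (simp add: \<tau>'_def)
  show "?X (compose M \<pi> \<tau>) = act_M D (k + (g + - k)) \<pi> (?X \<tau>) * ?X \<pi>"
    using \<pi> \<tau> \<pi>' \<tau>' E\<pi> E'(2)[OF \<tau>'] E'(6)[OF \<pi>' \<tau>']
    by (simp add: act3 alpha_hom(1,5) cat_hom(1) act_M_compose flip: \<pi>'_def \<tau>'_def del: add_uminus_conv_diff)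
  fix T assume T: "T \<in> intertwiners M \<pi> \<tau>"
  have TM: "T \<in> M" using T by (rule intertwinersD)
  have "alpha D g (alpha D (- k) T) * \<E> \<pi>' = \<E> \<tau>' * \<sigma> (alpha D (- k) T)"
    using E'(7)[OF \<pi>' \<tau>'] alpha_intertwiner[OF T \<pi> \<tau>] by (simp add: \<pi>'_def \<tau>'_def)
  then have "alpha D k (alpha D g (alpha D (- k) T)) * alpha D k (\<E> \<pi>') = alpha D k (\<E> \<tau>') * alpha D k (\<sigma> (alpha D (- k) T))"
    using TM E\<pi>(1) E'(2)[OF \<tau>'] by (metis alpha_hom(1,5) s(1))
  then show "alpha D (k + (g + - k)) T * ?X \<pi> = ?X \<tau> * act_M D k \<sigma> T"
    using TM E'(1) by (simp add: alpha_add alpha_hom(1) act_M_app flip: \<pi>'_def \<tau>'_def del: add_uminus_conv_diff)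
qed

lemma eta_act:
  assumes E: "eta_extension D g \<sigma> \<E> s"
  shows "eta_extension D (k + (g + - k)) (act_M D k \<sigma>) (\<lambda>\<pi>. alpha D k (\<E> (act_M D (- k) \<pi>))) (act_B D k s)"
proof -
  obtain P where P: "P \<in> Endo A" "\<And>x y. x \<in> M \<Longrightarrow> y \<in> M \<Longrightarrow> P (ot x y) = ot (\<sigma> x) (alpha D g y)"
    "\<And>a. a \<in> A \<Longrightarrow> s (iota D a) = iota D (P a)" using eta_iota[OF E] by metis
  obtain Q where Q: "Q \<in> Endo A" "\<And>x y. x \<in> M \<Longrightarrow> y \<in> M \<Longrightarrow> Q (ot x y) = ot (alpha D k x) (alpha D k y)"
    "\<And>a. a \<in> A \<Longrightarrow> beta D k (iota D a) = iota D (Q a)" using beta_iota[of k] by metis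
  obtain Q' where Q': "Q' \<in> Endo A" "\<And>x y. x \<in> M \<Longrightarrow> y \<in> M \<Longrightarrow> Q' (ot x y) = ot (alpha D (- k) x) (alpha D (- k) y)"
    "\<And>a. a \<in> A \<Longrightarrow> beta D (- k) (iota D a) = iota D (Q' a)" using beta_iota[of "- k"] by metis
  note E' = etaD[OF E]
  note s = cat_hom[OF E'(1)]
  show ?thesis
  proof (rule eta_extensionI[where P = "compose A Q (compose A P Q')"])
    show "half_braiding D (k + (g + - k)) (act_M D k \<sigma>) (\<lambda>\<pi>. alpha D k (\<E> (act_M D (- k) \<pi>)))"
      by (rule half_braiding_act[OF eta_half_braiding[OF E]])
    show "act_B D k s \<in> Endo0 B" by (rule act_B_Endo0[OF eta_Endo0[OF E]])
    show "compose A Q (compose A P Q') \<in> Endo A"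
      by (intro Endo_compose vn_A P(1) Q(1) Q'(1))
    show "compose A Q (compose A P Q') (ot x y) = ot (act_M D k \<sigma> x) (alpha D (k + (g + - k)) y)"
      if "x \<in> M" "y \<in> M" for x y
      using that E'(1) by (simp add: P Q Q' s(1) alpha_hom(1) alpha_add act_M_app del: add_uminus_conv_diff)
    show "act_B D k s (iota D a) = iota D (compose A Q (compose A P Q') a)" if "a \<in> A" for a
      using that by (simp add: act_B_app P Q Q' iota_hom(2) EndoD(1)[OF Q'(1)] EndoD(1)[OF P(1)])
    fix \<pi> assume \<pi>: "\<pi> \<in> cat D"
    define \<pi>' where "\<pi>' = act_M D (- k) \<pi>"
    have \<pi>': "\<pi>' \<in> cat D" using \<pi> by (simp add: \<pi>'_def)
    have "act_B D k s (lam D \<pi>) = beta D k (el (adj (\<E> \<pi>')) 1 * lam D (act_M D g \<pi>'))"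
      using \<pi> \<pi>' by (simp add: act_B_app eta_lam[OF E] flip: \<pi>'_def)
    also have "\<dots> = el (adj (alpha D k (\<E> \<pi>'))) 1 * lam D (act_M D k (act_M D g \<pi>'))"
      using \<pi>' E'(2)[OF \<pi>'] by (simp add: beta_hom(5) alpha_hom(4,6))
    also have "act_M D k (act_M D g \<pi>') = act_M D (k + (g + - k)) \<pi>"
      using \<pi> by (simp add: act_M_add \<pi>'_def del: add_uminus_conv_diff)
    finally show "act_B D k s (lam D \<pi>) =
        el (adj (alpha D k (\<E> (act_M D (- k) \<pi>)))) 1 * lam D (act_M D (k + (g + - k)) \<pi>)"
      by (simp only: \<pi>'_def)
  qed
qed

text \<open>Each datum leaves its own trace: the degree on the opposite leg, where \<alpha> of -h +
  g becomes the identity and hence lies in the category; \<sigma> on the left leg; the half braiding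
  in the image of \<lambda>_\<pi>, after \<open>lam_cancel\<close>.\<close>

lemma eta_unique:
  assumes E: "eta_extension D g \<sigma> \<E> s" and F: "eta_extension D h \<rho> \<F> s"
  shows "g = h" "\<sigma> = \<rho>" "\<pi> \<in> cat D \<Longrightarrow> \<E> \<pi> = \<F> \<pi>"
proof -
  note E' = etaD[OF E] and F' = etaD[OF F]
  have "alpha D g y = alpha D h y" if "y \<in> M" for y
  proof (rule el_right_inject)
    show "el 1 (alpha D g y) = el 1 (alpha D h y)"
      using eta_el[OF E, of 1 y] eta_el[OF F, of 1 y] that
      by (simp add: cat_hom(4)[OF E'(1)] cat_hom(4)[OF F'(1)])
  qed (simp_all add: that alpha_hom(1))
  then have "alpha D (- h + g) y = id_on M y" if "y \<in> M" for y
    using that by (simp add: alpha_add)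
  then have "alpha D (- h + g) = id_on M"
    by (rule extensional_eqI[OF alpha_hom(7) cat_hom(7)[OF id_cat]])
  then have "- h + g = 0" by (intro alpha_cat_zero) simp
  then show gh: "g = h" using eq_neg_iff_add_eq_0[of "- h" g] by simp
  show "\<sigma> = \<rho>"
  proof (rule cat_eqI[OF E'(1) F'(1)], rule el_left_inject)
    fix x assume x: "x \<in> M"
    show "el (\<sigma> x) 1 = el (\<rho> x) 1"
      using eta_el[OF E x, of 1] eta_el[OF F x, of 1] by (simp add: alpha_hom(4))
  qed (simp_all add: cat_hom(1)[OF E'(1)] cat_hom(1)[OF F'(1)])
  assume \<pi>: "\<pi> \<in> cat D"
  have "adj (\<E> \<pi>) = adj (\<F> \<pi>)"
  proof (rule lam_cancel)
    show "el (adj (\<E> \<pi>)) 1 * lam D (act_M D g \<pi>) = el (adj (\<F> \<pi>)) 1 * lam D (act_M D g \<pi>)"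
      using eta_lam[OF E \<pi>] eta_lam[OF F \<pi>] gh by simp
  qed (use \<pi> E'(2) F'(2) in simp_all)
  then show "\<E> \<pi> = \<F> \<pi>" by (metis adj_adj)
qed

lemma braiding_G_eq:
  assumes E: "eta_extension D g \<sigma> \<E> s" and F: "eta_extension D h \<rho> \<F> r"
  shows "braiding_G D s r = el (\<E> \<rho>) 1"
  unfolding braiding_G_def
proof (rule the_equality)
  show "\<exists>g' \<sigma>' \<E>' h' \<rho>' \<F>'. eta_extension D g' \<sigma>' \<E>' s \<and> eta_extension D h' \<rho>' \<F>' r \<and>
      el (\<E> \<rho>) 1 = elem D (\<E>' \<rho>') 1"
    using E F unfolding elem_el by blast
next
  fix X assume "\<exists>g' \<sigma>' \<E>' h' \<rho>' \<F>'. eta_extension D g' \<sigma>' \<E>' s \<and> eta_extension D h' \<rho>' \<F>' r \<and>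
      X = elem D (\<E>' \<rho>') 1"
  then obtain g' \<sigma>' \<E>' h' \<rho>' \<F>' where E': "eta_extension D g' \<sigma>' \<E>' s" and F': "eta_extension D h' \<rho>' \<F>' r"
    and X: "X = elem D (\<E>' \<rho>') 1" by blast
  have "\<rho>' = \<rho>" by (rule eta_unique(2)[OF F' F])
  moreover have "\<E>' \<rho> = \<E> \<rho>" by (rule eta_unique(3)[OF E' E etaD(1)[OF F]])
  ultimately show "X = el (\<E> \<rho>) 1" by (simp add: X elem_el)
qed

subsection \<open>Intertwiners between eta extensions\<close>

text \<open>
  \<open>V\<^sup>* V\<close> is central in the factor \<open>\<M>\<close>, hence a positive scalar, so that a multiple of \<open>V\<close> is an
  isometry exhibiting \<open>\<alpha>\<^sub>-\<^sub>k\<close> as a subobject of \<open>\<pi>\<close>.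
\<close>

lemma intertwiner_alpha_cat:
  assumes \<pi>: "\<pi> \<in> cat D" and V: "V \<in> intertwiners M (alpha D (- k)) \<pi>" and "V \<noteq> 0"
  shows "k = 0"
proof -
  note VM = intertwinersD(1)[OF V] and VI = intertwinersD(2)[OF V]
  \<comment> \<open>By the adjoint relation \<open>adj V\<close> intertwines in the other direction,
    so \<open>adj V * V\<close> commutes with the range of \<alpha>_{-k}, which is all of
    \<M>.\<close>
  have "adj V * V * z = z * (adj V * V)" if z: "z \<in> M" for z
  proof -
    define y where "y = alpha D k z"
    have y: "y \<in> M" "alpha D (- k) y = z" using z by (simp_all add: y_def alpha_hom(1))
    have "V * adj z = \<pi> (adj y) * V" using VI[of "adj y"] y by (simp add: alpha_hom(6))
    then have "adj (V * adj z) = adj (\<pi> (adj y) * V)" by simp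
    then have "z * adj V = adj V * \<pi> y" using y \<pi> by (simp add: cat_hom(6))
    then show ?thesis using VI[of y] y by (metis mult.assoc)
  qed
  then have "adj V * V \<in> {x \<in> M. \<forall>y\<in>M. x * y = y * x}" using VM by simp
  then obtain c where c: "adj V * V = scale_op c 1" using factor_M unfolding factor_def by blast
  obtain v where v: "app V v \<noteq> 0" using \<open>V \<noteq> 0\<close> bop_eqI[of V 0] by auto
  then have "v \<noteq> 0" by auto
  define r where "r = (norm (app V v))\<^sup>2 / (norm v)\<^sup>2"
  have "r > 0" using v \<open>v \<noteq> 0\<close> by (simp add: r_def)
  have "complex_of_real ((norm (app V v))\<^sup>2) = cinner v (app (adj V * V) v)"
    by (simp only: times_bop.rep_eq cinner_adj_right cinner_self)
  also have "\<dots> = c * complex_of_real ((norm v)\<^sup>2)"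
    unfolding c by (simp add: cinner_scaleC_right cinner_self)
  finally have "c = complex_of_real r"
    using \<open>v \<noteq> 0\<close> by (simp add: r_def field_simps)
  define q where "q = 1 / sqrt r"
  define W where "W = scale_op (of_real q) V"
  have "q * (q * r) = 1" using \<open>r > 0\<close> by (simp add: q_def field_simps)
  then have "complex_of_real q * (complex_of_real q * c) = 1"
    unfolding \<open>c = _\<close> by (metis of_real_1 of_real_mult)
  then have "adj W * W = 1" by (simp add: W_def c mult.left_commute)
  moreover have "W \<in> intertwiners M (alpha D (- k)) \<pi>"
    using VM VI by (simp add: W_def intertwiners_def)
  ultimately have "alpha D (- k) \<in> cat D"
    using subobject_cat[OF \<pi> alpha_Endo] by blast
  then show ?thesis using alpha_cat_zero by fastforce
qed

text \<open>Operators 1 \<otimes> j(z) pass through a slice over the first leg, so the commutation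
  rule of \<open>c\<close> is inherited by an operator on the opposite leg alone.
  \<open>uncnj_op\<close> brings it back to \<M>, and z = \<alpha>_{-k}(x) puts the rule into
  intertwiner form.\<close>

lemma slice_intertwiner:
  assumes \<pi>: "\<pi> \<in> cat D" and c: "c \<in> A"
    and comm: "\<And>z. z \<in> M \<Longrightarrow> iota D c * el 1 z = el 1 (\<pi> (alpha D k z)) * iota D c"
  shows "uncnj_op (slice t u u' c) \<in> intertwiners M (alpha D (- k)) \<pi>"
proof -
  define V where "V = uncnj_op (slice t u u' c)"
  have cV: "slice t u u' c = cnj_op V" by (simp add: V_def)
  have "slice t u u' c \<in> opposite M"
    using slice_in_vn_tensor[OF ht vn_M von_neumann_algebra_opposite[OF vn_M]] c
    by (simp add: alg_A_def)
  then have VM: "V \<in> M" by (simp add: cV)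
  have "V * alpha D (- k) x = \<pi> x * V" if x: "x \<in> M" for x
  proof -
    define z where "z = alpha D (- k) x"
    have z: "z \<in> M" "alpha D k z = x" using x by (simp_all add: z_def alpha_hom(1))
    have "iota D (c * ot 1 z) = iota D (ot 1 (\<pi> x) * c)"
      using comm[OF z(1)] z x c \<pi> cat_hom(1)[OF \<pi> x] ot_in_A[of 1]
      by (simp add: el_iota iota_hom(7) del: cnj_op_one)
    then have "c * tensor_op t 1 (cnj_op z) = tensor_op t 1 (cnj_op (\<pi> x)) * c"
      using c z(1) cat_hom(1)[OF \<pi> x] by (simp add: iota_inj)
    then have "slice t u u' c * cnj_op z = cnj_op (\<pi> x) * slice t u u' c"
      by (metis slice_mult_left[OF ht] slice_mult_right[OF ht])
    then have "cnj_op (V * z) = cnj_op (\<pi> x * V)" by (simp add: cV cnj_op_mult)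
    then show ?thesis by (simp add: z_def)
  qed
  then show ?thesis using VM by (simp add: intertwiners_def V_def)
qed

lemma zero_if_slices_zero:
  assumes "c \<in> A" "\<And>u u'. uncnj_op (slice t u u' c) = 0" shows "c = 0"
proof (rule slice_eqI[OF ht])
  fix u u'
  have "cnj_op 0 = (0 :: 'h cnj_space bop)" using cnj_op_scale[of 0 1] by simp
  then show "slice t u u' c = slice t u u' 0"
    using assms(2)[of u u'] cnj_uncnj[of "slice t u u' c"] by (simp add: slice_zero[OF ht])
qed

lemma el_intertwiner:
  assumes E: "eta_extension D g \<sigma> \<E> s" and F: "eta_extension D g \<rho> \<F> r"
    and X: "X \<in> M" and T: "el X 1 \<in> intertwiners B s r"
  shows "X \<in> intertwiners M \<sigma> \<rho>"
proof -
  note E' = etaD[OF E] and F' = etaD[OF F]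
  have "X * \<sigma> x = \<rho> x * X" if x: "x \<in> M" for x
  proof (rule el_left_inject)
    show "el (X * \<sigma> x) 1 = el (\<rho> x * X) 1"
      using intertwinersD(2)[OF T, of "el x 1"] X x cat_hom(1)[OF E'(1) x] cat_hom(1)[OF F'(1) x]
      by (simp add: eta_el[OF E] eta_el[OF F] alpha_hom(4) el_mult)
  qed (use X x cat_hom(1)[OF E'(1) x] cat_hom(1)[OF F'(1) x] in simp_all)
  then show ?thesis using X by (simp add: intertwiners_def)
qed

text \<open>
  \<open>T\<close> is compared with its expectation through the coefficients \<open>E(\<lambda>\<^sub>\<pi> T)\<close>, all of whose slices
  intertwine \<open>\<alpha>\<^sub>-\<^sub>k\<close> and \<open>\<pi>\<close>, where \<open>k = h - g\<close>.  For \<open>k = 0\<close> these slices are intertwiners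
  \<open>V \<in> (id, \<pi>)\<close>, for which \<open>(1 \<otimes> j(V\<^sup>*)) \<lambda>\<^sub>\<pi> = V \<otimes> 1\<close> lies in \<open>\<A>\<close>.
\<close>

lemma eta_intertwiner:
  assumes E: "eta_extension D g \<sigma> \<E> s" and F: "eta_extension D h \<rho> \<F> r"
    and T: "T \<in> intertwiners B s r" and "T \<noteq> 0"
  shows "g = h" "\<exists>X\<in>M. T = el X 1"
proof -
  note E' = etaD[OF E] and F' = etaD[OF F]
  note TB = intertwinersD(1)[OF T]
  define k where "k = h + - g"
  \<comment> \<open>On 1 \<otimes> j(y) both extensions act through \<alpha> alone, so this rule
    depends on \<open>k\<close> but not on \<sigma> or \<rho>.\<close>
  have comm: "T * el 1 z = el 1 (alpha D k z) * T" if z: "z \<in> M" for z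
  proof -
    define y where "y = alpha D (- g) z"
    have y: "y \<in> M" "alpha D g y = z" using z by (simp_all add: y_def alpha_hom(1))
    have "alpha D h y = alpha D k z" using z by (simp add: y_def k_def alpha_add del: add_uminus_conv_diff)
    then show ?thesis
      using intertwinersD(2)[OF T, of "el 1 y"] y
      by (simp add: eta_el[OF E] eta_el[OF F] cat_hom(4)[OF E'(1)] cat_hom(4)[OF F'(1)])
  qed
  \<comment> \<open>Stated for an arbitrary \<open>U\<close> because it is applied twice: to
    \<open>T\<close>, to exclude k \<noteq> 0, and to T - E(T), to show that \<open>T\<close> lies
    in \<A>.\<close>
  have coeff: "\<exists>c\<in>A. expect D (lam D \<pi> * U) = iota D c \<and>
      (\<forall>u u'. uncnj_op (slice t u u' c) \<in> intertwiners M (alpha D (- k)) \<pi>)"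
    if \<pi>: "\<pi> \<in> cat D" and U: "U \<in> B" "\<And>z. z \<in> M \<Longrightarrow> U * el 1 z = el 1 (alpha D k z) * U" for \<pi> U
  proof -
    obtain c where c: "c \<in> A" "expect D (lam D \<pi> * U) = iota D c"
      using expect_range[of "lam D \<pi> * U"] \<pi> U(1) by auto
    have "iota D c * el 1 z = el 1 (\<pi> (alpha D k z)) * iota D c" if z: "z \<in> M" for z
    proof -
      have "iota D c * el 1 z = expect D (lam D \<pi> * U * el 1 z)"
        using \<pi> U(1) z ot_in_A[of 1 z] by (simp add: el_iota expect_right c(2) del: cnj_op_one)
      also have "lam D \<pi> * U * el 1 z = el 1 (\<pi> (alpha D k z)) * (lam D \<pi> * U)"
      proof -
        have "lam D \<pi> * U * el 1 z = (lam D \<pi> * el 1 (alpha D k z)) * U"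
          by (simp only: mult.assoc U(2)[OF z])
        also have "lam D \<pi> * el 1 (alpha D k z) = el 1 (\<pi> (alpha D k z)) * lam D \<pi>"
          using lam_el[OF \<pi>, of 1 "alpha D k z"] z \<pi> by (simp add: alpha_hom(1) cat_hom(4))
        finally show ?thesis by (simp only: mult.assoc)
      qed
      also have "expect D \<dots> = el 1 (\<pi> (alpha D k z)) * iota D c"
        using \<pi> U(1) cat_hom(1)[OF \<pi> alpha_hom(1)[OF z]] ot_in_A[of 1 "\<pi> (alpha D k z)"]
        by (simp add: el_iota expect_left c(2) del: cnj_op_one)
      finally show ?thesis .
    qed
    then show ?thesis using c slice_intertwiner[OF \<pi> c(1)] by blast
  qed
  have k0: "k = 0"
  proof (rule ccontr)
    assume "k \<noteq> 0"
    have "T = 0"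
    proof (rule zero_if_coefficients_zero[OF TB])
      fix \<pi> assume \<pi>: "\<pi> \<in> cat D"
      obtain c where c: "c \<in> A" "expect D (lam D \<pi> * T) = iota D c"
        "\<And>u u'. uncnj_op (slice t u u' c) \<in> intertwiners M (alpha D (- k)) \<pi>"
        using coeff[OF \<pi> TB comm] by blast
      have "c = 0"
        using intertwiner_alpha_cat[OF \<pi> c(3)] \<open>k \<noteq> 0\<close> by (intro zero_if_slices_zero[OF c(1)]) blast
      then show "expect D (lam D \<pi> * T) = 0"
        using c(2) normal_hom_zero[OF vn_A iota] by simp
    qed
    then show False using \<open>T \<noteq> 0\<close> by simp
  qed
  then show "g = h" by (simp add: k_def)
  have comm0: "T * el 1 z = el 1 z * T" if "z \<in> M" for z
    using comm[OF that] that k0 by (simp add: alpha_zero)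
  obtain a where a: "a \<in> A" "expect D T = iota D a" using expect_range[OF TB] by blast
  have aB: "iota D a \<in> B" using a iota_hom(2) by simp
  have comma: "iota D a * el 1 z = el 1 z * iota D a" if z: "z \<in> M" for z
  proof -
    have "expect D (T * el 1 z) = expect D (el 1 z * T)" using comm0[OF z] by simp
    then show ?thesis
      using TB z ot_in_A[of 1 z] by (simp add: el_iota expect_left expect_right a(2) del: cnj_op_one)
  qed
  define U where "U = T - iota D a"
  have UB: "U \<in> B" using TB aB by (simp add: U_def von_neumann_algebra_diff[OF vn_B])
  have EU: "expect D U = 0" using TB aB a by (simp add: U_def expect_diff expect_iota)
  have commU: "U * el 1 z = el 1 (alpha D k z) * U" if "z \<in> M" for z
    using comm0[OF that] comma[OF that] that k0
    by (simp add: U_def alpha_zero left_diff_distrib right_diff_distrib)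
  have "U = 0"
  proof (rule zero_if_coefficients_zero[OF UB])
    fix \<pi> assume \<pi>: "\<pi> \<in> cat D"
    obtain c where c: "c \<in> A" "expect D (lam D \<pi> * U) = iota D c"
      "\<And>u u'. uncnj_op (slice t u u' c) \<in> intertwiners M (alpha D (- k)) \<pi>"
      using coeff[OF \<pi> UB commU] by blast
    have "c = 0"
    proof (rule zero_if_slices_zero[OF c(1)])
      fix u u'
      define V where "V = uncnj_op (slice t u u' c)"
      have V: "V \<in> intertwiners M (id_on M) \<pi>"
        using c(3)[of u u'] k0 by (simp add: V_def intertwiners_def alpha_zero)
      note VM = intertwinersD(1)[OF V]
      \<comment> \<open>Naturality replaces (1 \<otimes> j(adj V)) \<lambda>_\<pi> by V \<otimes> 1,
        which E pulls out, leaving E(U) = 0. Slicing (1 \<otimes> j(adj V)) c = 0 with the same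
        \<open>u\<close>, \<open>u'\<close> that produced \<open>V\<close> then gives
        \<open>adj (cnj_op V) * cnj_op V = 0\<close>.\<close>
      have "el 1 (adj V) * iota D c = expect D (el 1 (adj V) * (lam D \<pi> * U))"
        using \<pi> UB VM ot_in_A[of 1 "adj V"] by (simp add: el_iota expect_left c(2) del: cnj_op_one)
      also have "el 1 (adj V) * (lam D \<pi> * U) = el V 1 * U"
        using lam_natural[OF id_cat \<pi> V] by (simp add: mult.assoc[symmetric])
      also have "expect D \<dots> = 0"
        using UB VM EU ot_in_A[of V 1] by (simp add: el_iota expect_left del: cnj_op_one)
      finally have "iota D (ot 1 (adj V) * c) = iota D 0"
        using c(1) VM ot_in_A[of 1 "adj V"] normal_hom_zero[OF vn_A iota]
        by (simp add: el_iota iota_hom(7) del: cnj_op_one)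
      then have "tensor_op t 1 (cnj_op (adj V)) * c = 0"
        using c(1) VM ot_in_A[of 1 "adj V"] von_neumann_algebra_zero[OF vn_A] by (simp add: iota_inj)
      then have "cnj_op (adj V) * slice t u u' c = 0"
        by (metis slice_mult_left[OF ht] slice_zero[OF ht])
      then have "adj (cnj_op V) * cnj_op V = 0" by (simp add: V_def cnj_op_adj)
      then have "cnj_op V = 0" by (simp add: adj_mult_self_eq_0)
      then have "cnj_op V = cnj_op (scale_op 0 1)" by (simp only: cnj_op_scale) simp
      then show "uncnj_op (slice t u u' c) = 0" unfolding V_def[symmetric] by (simp only: cnj_op_inject) simp
    qed
    then show "expect D (lam D \<pi> * U) = 0"
      using c(2) normal_hom_zero[OF vn_A iota] by simp
  qed
  then have Ta: "T = iota D a" by (simp add: U_def)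
  \<comment> \<open>\<open>T\<close> now lies in \<A> and commutes with the opposite leg, whose
    algebra is a factor; only the left leg remains.\<close>
  have "\<exists>X\<in>M. a = tensor_op t X 1"
  proof (rule vn_tensor_commuting_right[OF ht vn_M factor_opposite[OF factor_M]])
    show "a \<in> vn_tensor t M (opposite M)" using a by (simp add: alg_A_def)
    fix y assume "y \<in> opposite M"
    then obtain z where z: "z \<in> M" "y = cnj_op z" by (rule oppositeE)
    have "iota D (a * ot 1 z) = iota D (ot 1 z * a)"
      using comma[OF z(1)] a z ot_in_A[of 1 z] by (simp add: el_iota iota_hom(7) del: cnj_op_one)
    then show "a * tensor_op t 1 y = tensor_op t 1 y * a"
      using a z ot_in_A[of 1 z] by (simp add: iota_inj)
  qed
  then show "\<exists>X\<in>M. T = el X 1" by (auto simp: Ta el_iota)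
qed

end

section \<open>The braiding axioms for eta extensions\<close>

lemma normal_hom_Ad:
  assumes N: "von_neumann_algebra N" and f: "normal_hom N N f" and u: "unitary_in N u"
  shows "normal_hom N N (\<lambda>x\<in>N. u * f x * adj u)"
proof -
  note f' = normal_homD[OF f] and N' = von_neumann_algebraD[OF N]
  have u': "u \<in> N" "adj u * u = 1" "u * adj u = 1" using u by (simp_all add: unitary_in_def)
  have "u * f (x * y) * adj u = (u * f x * adj u) * (u * f y * adj u)" if "x \<in> N" "y \<in> N" for x y
  proof -
    have "(u * f x * adj u) * (u * f y * adj u) = u * f x * (adj u * u) * f y * adj u"
      by (simp only: mult.assoc)
    then show ?thesis using that by (simp add: u' f'(7) mult.assoc)
  qed
  moreover have "continuous_map (subtopology ultraweak N) ultraweak (\<lambda>x\<in>N. u * f x * adj u)"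
  proof -
    have "continuous_map (subtopology ultraweak N) ultraweak (\<lambda>x. u * f x * adj u)"
      using continuous_map_compose[OF continuous_map_compose[OF f'(5) continuous_map_mult_left]
          continuous_map_mult_right] by (simp add: o_def)
    then show ?thesis by (rule continuous_map_eq) simp
  qed
  ultimately show ?thesis
    using f'(2-4,6,8) N' u'
    by (simp add: normal_hom_def linear_on_def normal_on_def distrib_left distrib_right mult.assoc)
qed

context equivariant_lr begin

lemma normal_hom_eta: "eta_extension D g \<sigma> \<E> s \<Longrightarrow> normal_hom B B s"
  by (rule eta_hom(8))

lemma eta_objects_subset_ZG: "eta_objects D g \<subseteq> ZG D g"
proof
  fix \<theta> assume \<theta>: "\<theta> \<in> eta_objects D g"
  then obtain \<sigma> \<E> where E: "eta_extension D g \<sigma> \<E> \<theta>" by (auto simp: eta_objects_def)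
  have "\<theta> = (\<lambda>x\<in>B. 1 * \<theta> x * adj 1)"
    using eta_hom(7)[OF E] by (auto simp: PiE_def extensional_restrict)
  moreover have "unitary_in B 1" by (simp add: unitary_in_def)
  ultimately have "unitarily_equivalent B \<theta> \<theta>" unfolding unitarily_equivalent_def by blast
  then show "\<theta> \<in> ZG D g" using \<theta> eta_Endo0[OF E] by (auto simp: ZG_def)
qed

lemma unitary_el:
  assumes E: "eta_extension D g \<sigma> \<E> s" and \<rho>: "\<rho> \<in> cat D"
  shows "unitary_in B (el (\<E> \<rho>) 1)"
  using etaD(2-4)[OF E \<rho>] by (simp add: unitary_in_def el_adj el_mult)

text \<open>With u = \<E>(\<rho>) \<otimes> 1, both Ad u of the product s r and g[r] s are normal
  homomorphisms, compared on generators. On \<A> this is the intertwining property of \<E>(\<rho>);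
  on \<lambda>_\<pi> it is a Yang-Baxter type identity between \<E> and \<F>.\<close>

lemma eta_braiding_intertwiner:
  assumes E: "eta_extension D g \<sigma> \<E> s" and F: "eta_extension D h \<rho> \<F> r"
  shows "el (\<E> \<rho>) 1 \<in> intertwiners B (compose B s r) (compose B (act_B D g r) s)"
proof -
  note E' = etaD[OF E] and F' = etaD[OF F]
  note sg = cat_hom[OF E'(1)] and rh = cat_hom[OF F'(1)]
  have g\<rho>: "act_M D g \<rho> \<in> cat D" using F'(1) by simp
  note gr = cat_hom[OF g\<rho>]
  define u where "u = el (\<E> \<rho>) 1"
  have u: "unitary_in B u" unfolding u_def by (rule unitary_el[OF E F'(1)])
  note E\<rho> = E'(2-5)[OF F'(1)]
  \<comment> \<open>Both products have the same degree, so their actions on the opposite leg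
    agree.\<close>
  have grade: "g + (h + - g) + g = g + h" by (simp add: add.assoc)
  note sr = eta_compose[OF E F] and rs = eta_compose[OF eta_act[OF F, of g] E, unfolded grade]
  have adju: "adj u = el (adj (\<E> \<rho>)) 1" using E\<rho>(1) by (simp add: u_def el_adj)
  have key: "u * compose B s r b * adj u = compose B (act_B D g r) s b" if b: "b \<in> B" for b
  proof -
    have "(\<lambda>b\<in>B. u * compose B s r b * adj u) b = compose B (act_B D g r) s b"
    proof (rule normal_hom_B_eqI[OF normal_hom_Ad[OF vn_B normal_hom_eta[OF sr] u] normal_hom_eta[OF rs] _ _ b])
      fix x y assume xy: "x \<in> M" "y \<in> M"
      have "\<E> \<rho> * \<sigma> (\<rho> x) * adj (\<E> \<rho>) = act_M D g \<rho> (\<sigma> x) * (\<E> \<rho> * adj (\<E> \<rho>))"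
        using E\<rho>(4)[OF xy(1)] by (simp only: mult.assoc[symmetric])
      then have "\<E> \<rho> * \<sigma> (\<rho> x) * adj (\<E> \<rho>) = act_M D g \<rho> (\<sigma> x)" by (simp add: E\<rho>(3))
      then have "u * el (\<sigma> (\<rho> x)) (alpha D (g + h) y) * adj u
          = el (act_M D g \<rho> (\<sigma> x)) (alpha D (g + h) y)"
        unfolding adju unfolding u_def using xy E\<rho>(1)
        by (simp add: el_mult sg(1) rh(1) alpha_hom(1))
      then show "(\<lambda>b\<in>B. u * compose B s r b * adj u) (el x y) = compose B (act_B D g r) s (el x y)"
        using eta_el[OF sr xy] eta_el[OF rs xy] xy by simp
    next
      fix \<pi> assume \<pi>: "\<pi> \<in> cat D"
      have h\<pi>: "act_M D h \<pi> \<in> cat D" and gh\<pi>: "act_M D g (act_M D h \<pi>) \<in> cat D" using \<pi> by simp_all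
      note F\<pi> = F'(2)[OF \<pi>] and E\<pi> = E'(2)[OF \<pi>] and Eh\<pi> = E'(2)[OF h\<pi>]
      \<comment> \<open>\<open>a\<close> and \<open>c\<close> are the half braidings of s r at \<pi>
        and of g[r] s at \<pi>; \<open>d\<close> arises when \<open>adj u\<close> is moved to the
        left of \<lambda>.\<close>
      define a where "a = \<E> (act_M D h \<pi>) * \<sigma> (\<F> \<pi>)"
      define c where "c = alpha D g (\<F> \<pi>) * act_M D g \<rho> (\<E> \<pi>)"
      define d where "d = act_M D g (act_M D h \<pi>) (\<E> \<rho>)"
      have aM: "a \<in> M" and cM: "c \<in> M" and dM: "d \<in> M"
        using F\<pi> E\<pi> Eh\<pi> E\<rho>(1) cat_hom(1)[OF gh\<pi>] by (simp_all add: a_def c_def d_def sg(1) gr(1) alpha_hom(1))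
      have F\<pi>I: "\<F> \<pi> \<in> intertwiners M (compose M \<rho> \<pi>) (compose M (act_M D h \<pi>) \<rho>)"
        using F\<pi> F'(5)[OF \<pi>] by (simp add: intertwiners_def)
      \<comment> \<open>Naturality of \<E> for the intertwiner \<F>(\<pi>) from \<rho>\<pi> to
        h[\<pi>]\<rho>, with \<E> at both composites expanded by multiplicativity.\<close>
      have "c * \<E> \<rho> = d * a"
        using E'(7)[OF _ _ F\<pi>I] E'(6)[OF F'(1) \<pi>] E'(6)[OF h\<pi> F'(1)] F'(1) \<pi>
        by (simp add: a_def c_def d_def mult.assoc)
      then have "d * a * adj (\<E> \<rho>) = c * (\<E> \<rho> * adj (\<E> \<rho>))" by (simp only: mult.assoc[symmetric])
      then have "adj (d * a * adj (\<E> \<rho>)) = adj c" by (simp add: E\<rho>(3))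
      then have c: "\<E> \<rho> * adj a * adj d = adj c" by (simp add: mult.assoc)
      have "u * compose B s r (lam D \<pi>) * adj u
          = el (\<E> \<rho>) 1 * el (adj a) 1 * (lam D (act_M D g (act_M D h \<pi>)) * el (adj (\<E> \<rho>)) 1)"
        using eta_lam[OF sr \<pi>] \<pi> by (simp only: u_def adju[unfolded u_def] a_def act_M_add mult.assoc)
      also have "\<dots> = el (\<E> \<rho> * adj a * adj d) 1 * lam D (act_M D g (act_M D h \<pi>))"
        using E\<rho>(1) aM dM cat_hom(4,6)[OF gh\<pi>]
        by (simp add: lam_el[OF gh\<pi>] el_mult el_mult_assoc mult.assoc d_def)
      also have "\<dots> = compose B (act_B D g r) s (lam D \<pi>)"
        using eta_lam[OF rs \<pi>] \<pi> unfolding c by (simp add: c_def act_M_add)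
      finally show "(\<lambda>b\<in>B. u * compose B s r b * adj u) (lam D \<pi>) = compose B (act_B D g r) s (lam D \<pi>)"
        using \<pi> by simp
    qed
    then show ?thesis using b by simp
  qed
  have uu: "u \<in> B" "adj u * u = 1" using u by (simp_all add: unitary_in_def)
  have "u * compose B s r b = compose B (act_B D g r) s b * u" if b: "b \<in> B" for b
  proof -
    have "compose B (act_B D g r) s b * u = u * compose B s r b * (adj u * u)"
      by (simp only: key[OF b, symmetric] mult.assoc)
    then show ?thesis by (simp add: uu(2))
  qed
  then show ?thesis using uu(1) by (simp add: intertwiners_def u_def)
qed

lemma act_B_el:
  assumes E: "eta_extension D h \<xi> \<E> x" and X: "X \<in> M"
  shows "act_B D g x (el X 1) = el (act_M D g \<xi> X) 1"
  using eta_el[OF eta_act[OF E] X, of 1] by (simp add: alpha_hom(4))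

text \<open>This is multiplicativity of \<E> at \<xi>\<eta>: g[x] acts on \<E>(\<eta>) \<otimes> 1
  by g[\<xi>], as its opposite leg fixes 1.\<close>

lemma braiding_compose_right:
  assumes s: "s \<in> eta_objects D g" and x: "x \<in> eta_objects D h" and y: "y \<in> eta_objects D k"
  shows "act_B D g x (braiding_G D s y) * braiding_G D s x = braiding_G D s (compose B x y)"
proof -
  obtain \<sigma> \<E> \<xi> \<F> \<eta> \<G> where E: "eta_extension D g \<sigma> \<E> s" and F: "eta_extension D h \<xi> \<F> x"
    and G: "eta_extension D k \<eta> \<G> y" using s x y by (auto simp: eta_objects_def)
  note c = etaD(1)[OF F] etaD(1)[OF G] and E' = etaD[OF E]
  show ?thesis
    using c E'(2)[OF c(1)] E'(2)[OF c(2)] E'(6)[OF c] cat_hom(1)[OF act_cat[OF c(1), of g]]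
    by (simp add: braiding_G_eq[OF E F] braiding_G_eq[OF E G] braiding_G_eq[OF E eta_compose[OF F G]]
        act_B_el[OF F] el_mult)
qed

text \<open>A nonzero \<open>T\<close> forces equal degrees and equals X \<otimes> 1 with X \<in>
  (\<rho>, \<rho>'), so naturality of the half braiding applies. Different degrees h and h' fall
  under T = 0, where both sides vanish.\<close>

lemma braiding_natural_right:
  assumes s: "s \<in> eta_objects D g" and r: "r \<in> eta_objects D h" and r': "r' \<in> eta_objects D h'"
    and T: "T \<in> intertwiners B r r'"
  shows "beta D g T * braiding_G D s r = braiding_G D s r' * s T"
proof -
  obtain \<sigma> \<E> \<rho> \<F> \<rho>' \<F>' where E: "eta_extension D g \<sigma> \<E> s" and F: "eta_extension D h \<rho> \<F> r"
    and F': "eta_extension D h' \<rho>' \<F>' r'" using s r r' by (auto simp: eta_objects_def)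
  note c = etaD(1)[OF F] etaD(1)[OF F'] and E' = etaD[OF E]
  show ?thesis
  proof (cases "T = 0")
    case True
    then show ?thesis
      using normal_hom_zero[OF vn_B beta_hom(8)] normal_hom_zero[OF vn_B normal_hom_eta[OF E]] by simp
  next
    case False
    have h: "h = h'" using eta_intertwiner(1)[OF F F' T False] .
    obtain X where X: "X \<in> M" "T = el X 1" using eta_intertwiner(2)[OF F F' T False] by blast
    have "X \<in> intertwiners M \<rho> \<rho>'" using el_intertwiner[OF F _ X(1)] F' T h X(2) by blast
    from E'(7)[OF c this] show ?thesis
      using X E'(2)[OF c(1)] E'(2)[OF c(2)] cat_hom(1)[OF E'(1)]
      by (simp add: braiding_G_eq[OF E F] braiding_G_eq[OF E F'] eta_el[OF E] alpha_hom(1,4) el_mult)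
  qed
qed

text \<open>The half braiding of the product was built as this very expression, since
  \<open>s\<close> maps \<F>(\<xi>) \<otimes> 1 to \<sigma>(\<F>(\<xi>)) \<otimes> 1.\<close>

lemma braiding_compose_left:
  assumes s: "s \<in> eta_objects D g" and r: "r \<in> eta_objects D h" and x: "x \<in> eta_objects D k"
  shows "braiding_G D s (act_B D h x) * s (braiding_G D r x) = braiding_G D (compose B s r) x"
proof -
  obtain \<sigma> \<E> \<rho> \<F> \<xi> \<G> where E: "eta_extension D g \<sigma> \<E> s" and F: "eta_extension D h \<rho> \<F> r"
    and G: "eta_extension D k \<xi> \<G> x" using s r x by (auto simp: eta_objects_def)
  note c = etaD(1)[OF G] and E' = etaD[OF E] and F' = etaD[OF F]
  have "act_M D h \<xi> \<in> cat D" using c by simp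
  then show ?thesis
    using F'(2)[OF c] E'(2)[of "act_M D h \<xi>"] cat_hom(1)[OF E'(1)]
    by (simp add: braiding_G_eq[OF E eta_act[OF G]] braiding_G_eq[OF F G]
        braiding_G_eq[OF eta_compose[OF E F] G] eta_el[OF E] alpha_hom(4) el_mult)
qed

text \<open>No axiom relates the half braidings of \<open>s\<close> and \<open>s'\<close> to each
  other. The link comes from \<open>T\<close> itself: its intertwining relation at \<lambda>_\<xi>,
  with \<lambda> cancelled, compares the two adjoints, and unitarity converts this into the
  claim.\<close>

lemma braiding_natural_left:
  assumes s: "s \<in> eta_objects D g" and s': "s' \<in> eta_objects D g" and x: "x \<in> eta_objects D h"
    and T: "T \<in> intertwiners B s s'"
  shows "act_B D g x T * braiding_G D s x = braiding_G D s' x * T"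
proof -
  obtain \<sigma> \<E> \<sigma>' \<E>' \<xi> \<G> where E: "eta_extension D g \<sigma> \<E> s" and F: "eta_extension D g \<sigma>' \<E>' s'"
    and G: "eta_extension D h \<xi> \<G> x" using s s' x by (auto simp: eta_objects_def)
  note c = etaD(1)[OF G] and E' = etaD[OF E] and F' = etaD[OF F]
  show ?thesis
  proof (cases "T = 0")
    case True
    then show ?thesis
      using normal_hom_zero[OF vn_B normal_hom_eta[OF eta_act[OF G]]] by simp
  next
    case False
    obtain X where X: "X \<in> M" "T = el X 1" using eta_intertwiner(2)[OF E F T False] by blast
    have g\<xi>: "act_M D g \<xi> \<in> cat D" using c by simp
    note M = E'(2-4)[OF c] F'(2-4)[OF c] cat_hom(1)[OF g\<xi> X(1)]
    have "X * adj (\<E> \<xi>) = adj (\<E>' \<xi>) * act_M D g \<xi> X"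
    proof (rule lam_cancel[OF g\<xi>])
      have "el (X * adj (\<E> \<xi>)) 1 * lam D (act_M D g \<xi>) = el X 1 * s (lam D \<xi>)"
        using X(1) M by (simp add: eta_lam[OF E c] el_mult_assoc)
      also have "\<dots> = s' (lam D \<xi>) * el X 1"
        using intertwinersD(2)[OF T, of "lam D \<xi>"] X(2) c by simp
      also have "\<dots> = el (adj (\<E>' \<xi>) * act_M D g \<xi> X) 1 * lam D (act_M D g \<xi>)"
        using X(1) M by (simp add: eta_lam[OF F c] mult.assoc lam_el[OF g\<xi>] cat_hom(4)[OF g\<xi>] el_mult_assoc)
      finally show "el (X * adj (\<E> \<xi>)) 1 * lam D (act_M D g \<xi>) =
        el (adj (\<E>' \<xi>) * act_M D g \<xi> X) 1 * lam D (act_M D g \<xi>)" .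
    qed (use X M in simp_all)
    then have "\<E>' \<xi> * (X * adj (\<E> \<xi>)) * \<E> \<xi> = \<E>' \<xi> * (adj (\<E>' \<xi>) * act_M D g \<xi> X) * \<E> \<xi>" by simp
    then have "\<E>' \<xi> * X * (adj (\<E> \<xi>) * \<E> \<xi>) = (\<E>' \<xi> * adj (\<E>' \<xi>)) * act_M D g \<xi> X * \<E> \<xi>"
      by (simp only: mult.assoc)
    then have "act_M D g \<xi> X * \<E> \<xi> = \<E>' \<xi> * X" by (simp add: M)
    then show ?thesis
      using X M by (simp add: braiding_G_eq[OF E G] braiding_G_eq[OF F G] act_B_el[OF G] el_mult)
  qed
qed

text \<open>The transported half braiding first undoes \<open>k\<close> on its argument, so at
  k[\<rho>] it equals \<alpha>_k(\<E>(\<rho>)).\<close>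

lemma braiding_equivariant:
  assumes s: "s \<in> eta_objects D g" and r: "r \<in> eta_objects D h"
  shows "braiding_G D (act_B D k s) (act_B D k r) = beta D k (braiding_G D s r)"
proof -
  obtain \<sigma> \<E> \<rho> \<F> where E: "eta_extension D g \<sigma> \<E> s" and F: "eta_extension D h \<rho> \<F> r"
    using s r by (auto simp: eta_objects_def)
  show ?thesis
    using etaD(1)[OF F] etaD(2)[OF E etaD(1)[OF F]]
    by (simp add: braiding_G_eq[OF eta_act[OF E] eta_act[OF F]] braiding_G_eq[OF E F] alpha_hom(4))
qed

lemma braiding_unitary_intertwiner:
  assumes s: "s \<in> eta_objects D g" and r: "r \<in> eta_objects D h"
  shows "unitary_in B (braiding_G D s r)"
    "braiding_G D s r \<in> intertwiners B (compose B s r) (compose B (act_B D g r) s)"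
proof -
  obtain \<sigma> \<E> \<rho> \<F> where E: "eta_extension D g \<sigma> \<E> s" and F: "eta_extension D h \<rho> \<F> r"
    using s r by (auto simp: eta_objects_def)
  show "unitary_in B (braiding_G D s r)"
    by (simp add: braiding_G_eq[OF E F] unitary_el[OF E etaD(1)[OF F]])
  show "braiding_G D s r \<in> intertwiners B (compose B s r) (compose B (act_B D g r) s)"
    by (simp add: braiding_G_eq[OF E F] eta_braiding_intertwiner[OF E F])
qed

end

theorem theorem5p8:
  fixes D :: "('h::chilbert_space, 't::chilbert_space, 'k::chilbert_space, 'g::group_add) lr_data"
  assumes "equivariant_longo_rehren D"
  shows
    "((\<forall>g. eta_objects D g \<subseteq> ZG D g) \<and>
      (\<forall>g h \<sigma> \<E> \<rho> \<F> s r. eta_extension D g \<sigma> \<E> s \<and> eta_extension D h \<rho> \<F> r \<longrightarrow>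
         braiding_G D s r = elem D (\<E> \<rho>) 1)) \<and>

     (\<forall>g h. \<forall>s\<in>eta_objects D g. \<forall>r\<in>eta_objects D h.
        unitary_in (alg_B D) (braiding_G D s r) \<and>
        braiding_G D s r \<in> intertwiners (alg_B D)
          (compose (alg_B D) s r) (compose (alg_B D) (act_B D g r) s)) \<and>

     (\<forall>g h k. \<forall>s\<in>eta_objects D g. \<forall>x\<in>eta_objects D h. \<forall>y\<in>eta_objects D k.
        act_B D g x (braiding_G D s y) * braiding_G D s x = braiding_G D s (compose (alg_B D) x y)) \<and>
     (\<forall>g h h'. \<forall>s\<in>eta_objects D g. \<forall>r\<in>eta_objects D h. \<forall>r'\<in>eta_objects D h'.
        \<forall>T\<in>intertwiners (alg_B D) r r'.
          beta D g T * braiding_G D s r = braiding_G D s r' * s T) \<and>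

     (\<forall>g h k. \<forall>s\<in>eta_objects D g. \<forall>r\<in>eta_objects D h. \<forall>x\<in>eta_objects D k.
        braiding_G D s (act_B D h x) * s (braiding_G D r x) = braiding_G D (compose (alg_B D) s r) x) \<and>
     (\<forall>g h. \<forall>s\<in>eta_objects D g. \<forall>s'\<in>eta_objects D g. \<forall>x\<in>eta_objects D h.
        \<forall>T\<in>intertwiners (alg_B D) s s'.
          act_B D g x T * braiding_G D s x = braiding_G D s' x * T) \<and>

     (\<forall>g h k. \<forall>s\<in>eta_objects D g. \<forall>r\<in>eta_objects D h.
        braiding_G D (act_B D k s) (act_B D k r) = beta D k (braiding_G D s r))"
proof -
  interpret equivariant_lr D by (unfold_locales) (rule assms)
  show ?thesis
  proof (intro conjI allI ballI impI)
    fix g h \<sigma> \<E> \<rho> \<F> s r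
    assume "eta_extension D g \<sigma> \<E> s \<and> eta_extension D h \<rho> \<F> r"
    then show "braiding_G D s r = elem D (\<E> \<rho>) 1" by (simp only: elem_el) (blast intro: braiding_G_eq)
  qed (fact eta_objects_subset_ZG | erule (1) braiding_unitary_intertwiner |
      erule (2) braiding_compose_right | erule (3) braiding_natural_right |
      erule (2) braiding_compose_left | erule (3) braiding_natural_left |
      erule (1) braiding_equivariant)+
qed

end
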